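(* Let $A$ and $B$ be separable C*-algebras. If $B$ is Hilbert-Schmidt stable and $A$ is homotopy dominated by $B$, then all hyperlinear traces on $A$ are MF, and all amenable traces on $A$ are quasidiagonal.
   Context: Fix a non-trivial ultrafilter $\omega$ on $\mathbb N$. On matrices, $tr$ is the normalized trace and $\|T\|_2=tr(T^*T)^{1/2}$. $\prod M_n$ is the C*-algebra of bounded sequences $(T_n)$, $T_n\in M_n$, and $\oplus_{2,\omega}M_n=\{(T_n)\in\prod M_n\mid\lim_{n\to\omega}\|T_n\|_2=0\}$. A C*-algebra $B$ is Hilbert-Schmidt stable if every $*$-homomorphism from $B$ to $\prod M_n/\oplus_{2,\omega}M_n$ lifts to a $*$-homomorphism from $B$ to $\prod M_n$. A trace on a C*-algebra $A$ is a positive linear functional $\tau$ with $\|\tau\|\le1$ and $\tau(ab)=\tau(ba)$. A trace $\tau$ on $A$ is hyperlinear if there are maps $\phi_n:A\to M_{k_n}$, $n\in\mathbb N$, such that for all $a,b\in A$, $\lambda,\mu\in\mathbb C$: $\|\phi_n(ab)-\phi_n(a)\phi_n(b)\|_2\to0$, $\|\phi_n(\lambda a+\mu b)-\lambda\phi_n(a)-\mu\phi_n(b)\|_2\to0$, $\|\phi_n(a^* )-\phi_n(a)^*\|_2\to0$, $\sup_n\|\phi_n(a)\|<\infty$ and $|\tau(a)-tr\,\phi_n(a)|\to0$. It is MF if there are maps $\phi_n$ satisfying the same conditions with $\|\cdot\|_2$ replaced by the operator norm in the first three. It is amenable if there are contractive completely positive (linear) maps $\phi_n:A\to M_{k_n}$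 with $\|\phi_n(ab)-\phi_n(a)\phi_n(b)\|_2\to0$ and $|\tau(a)-tr\,\phi_n(a)|\to0$ for all $a,b$; it is quasidiagonal if the same holds with $\|\cdot\|_2$ replaced by the operator norm. $A$ is homotopy dominated by $B$ if there are $*$-homomorphisms $\alpha:B\to A$ and $\beta:A\to B$ such that $\alpha\circ\beta$ is homotopic to $\mathrm{id}_A$, i.e. there is a $*$-homomorphism $\Phi:A\to A\otimes C[0,1]$ with $\mathrm{ev}_0\circ\Phi=\alpha\circ\beta$ and $\mathrm{ev}_1\circ\Phi=\mathrm{id}_A$. *)

theory Defs
  imports "HOL-Analysis.Analysis" "HOL-Algebra.Congruence" "Jordan_Normal_Form.Schur_Decomposition"
begin

text \<open>C*-algebras are not assumed to be unital.  Over the real Banach algebra structure of the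
  library we add the complex scalar multiplication and the involution.\<close>

class cstar_algebra = real_normed_algebra + banach +
  fixes scaleC :: "complex \<Rightarrow> 'a \<Rightarrow> 'a" (infixr "*\<^sub>C" 75)
    and star :: "'a \<Rightarrow> 'a"
  assumes scaleC_add_right: "c *\<^sub>C (x + y) = c *\<^sub>C x + c *\<^sub>C y"
    and scaleC_add_left: "(c + d) *\<^sub>C x = c *\<^sub>C x + d *\<^sub>C x"
    and scaleC_scaleC: "c *\<^sub>C (d *\<^sub>C x) = (c * d) *\<^sub>C x"
    and scaleC_of_real: "complex_of_real r *\<^sub>C x = r *\<^sub>R x"
    and scaleC_mult_left: "(c *\<^sub>C x) * y = c *\<^sub>C (x * y)"
    and scaleC_mult_right: "x * (c *\<^sub>C y) = c *\<^sub>C (x * y)"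
    and norm_scaleC: "norm (c *\<^sub>C x) = cmod c * norm x"
    and star_star: "star (star x) = x"
    and star_add: "star (x + y) = star x + star y"
    and star_scaleC: "star (c *\<^sub>C x) = cnj c *\<^sub>C star x"
    and star_mult: "star (x * y) = star y * star x"
    and cstar_identity: "norm (star x * x) = (norm x)\<^sup>2"

definition separable_cstar :: "'a::cstar_algebra itself \<Rightarrow> bool" where
  "separable_cstar _ \<longleftrightarrow> separable_space (euclidean :: 'a topology)"

text \<open>A carrier-based signature for the *-algebras that are not themselves types (they depend on
  an ultrafilter or are spaces of continuous paths).\<close>

record 'x star_alg = "'x partial_object" +
  sa_add :: "'x \<Rightarrow> 'x \<Rightarrow> 'x"
  sa_scale :: "complex \<Rightarrow> 'x \<Rightarrow> 'x"
  sa_mult :: "'x \<Rightarrow> 'x \<Rightarrow> 'x"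
  sa_star :: "'x \<Rightarrow> 'x"

definition star_hom :: "'x star_alg \<Rightarrow> 'y star_alg \<Rightarrow> ('x \<Rightarrow> 'y) \<Rightarrow> bool" where
  "star_hom X Y f \<longleftrightarrow>
     f \<in> carrier X \<rightarrow> carrier Y \<and>
     (\<forall>x\<in>carrier X. \<forall>y\<in>carrier X. f (sa_add X x y) = sa_add Y (f x) (f y)) \<and>
     (\<forall>c. \<forall>x\<in>carrier X. f (sa_scale X c x) = sa_scale Y c (f x)) \<and>
     (\<forall>x\<in>carrier X. \<forall>y\<in>carrier X. f (sa_mult X x y) = sa_mult Y (f x) (f y)) \<and>
     (\<forall>x\<in>carrier X. f (sa_star X x) = sa_star Y (f x))"

definition cstar_alg :: "'a::cstar_algebra star_alg" where
  "cstar_alg = \<lparr> carrier = UNIV, sa_add = (+), sa_scale = scaleC, sa_mult = (*), sa_star = star \<rparr>"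

text \<open>The algebra \<open>A \<otimes> C[0,1]\<close>, identified as usual with the continuous functions from
  \<open>[0,1]\<close> to \<open>A\<close>.  Such a function is made a unique object of type \<^typ>\<open>real \<Rightarrow> 'a\<close> by
  extensionality outside \<open>[0,1]\<close>; evaluation at \<open>t\<close> is then application to \<open>t\<close>.\<close>

definition path_alg :: "(real \<Rightarrow> 'a::cstar_algebra) star_alg" where
  "path_alg =
     \<lparr> carrier = {f \<in> extensional {0..1}. continuous_on {0..1} f},
       sa_add = (\<lambda>f g. \<lambda>t\<in>{0..1}. f t + g t),
       sa_scale = (\<lambda>c f. \<lambda>t\<in>{0..1}. c *\<^sub>C f t),
       sa_mult = (\<lambda>f g. \<lambda>t\<in>{0..1}. f t * g t),
       sa_star = (\<lambda>f. \<lambda>t\<in>{0..1}. star (f t)) \<rparr>"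

definition homotopic_homs ::
  "('a::cstar_algebra \<Rightarrow> 'b::cstar_algebra) \<Rightarrow> ('a \<Rightarrow> 'b) \<Rightarrow> bool" where
  "homotopic_homs f g \<longleftrightarrow>
     (\<exists>\<Phi>. star_hom cstar_alg path_alg \<Phi> \<and> (\<forall>a. \<Phi> a 0 = f a) \<and> (\<forall>a. \<Phi> a 1 = g a))"

definition homotopy_dominated ::
  "'a::cstar_algebra itself \<Rightarrow> 'b::cstar_algebra itself \<Rightarrow> bool" where
  "homotopy_dominated _ _ \<longleftrightarrow>
     (\<exists>(\<alpha> :: 'b \<Rightarrow> 'a) (\<beta> :: 'a \<Rightarrow> 'b).
        star_hom cstar_alg cstar_alg \<alpha> \<and> star_hom cstar_alg cstar_alg \<beta> \<and>
        homotopic_homs (\<alpha> \<circ> \<beta>) id)"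

definition mat_tr :: "complex mat \<Rightarrow> complex" where
  "mat_tr T = (\<Sum>i<dim_row T. T $$ (i, i)) / of_nat (dim_row T)"

definition hs_norm :: "complex mat \<Rightarrow> real" where
  "hs_norm T = sqrt (Re (mat_tr (mat_adjoint T * T)))"

definition vec_l2norm :: "complex Matrix.vec \<Rightarrow> real" where
  "vec_l2norm v = L2_set (\<lambda>i. cmod (vec_index v i)) {..<dim_vec v}"

definition op_norm :: "complex mat \<Rightarrow> real" where
  "op_norm T = (SUP v \<in> {v \<in> carrier_vec (dim_col T). vec_l2norm v \<le> 1}. vec_l2norm (T *\<^sub>v v))"

definition nontrivial_ultrafilter :: "nat filter \<Rightarrow> bool" where
  "nontrivial_ultrafilter \<omega> \<longleftrightarrow>
     \<omega> \<noteq> bot \<and>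
     (\<forall>P. eventually P \<omega> \<or> eventually (\<lambda>n. \<not> P n) \<omega>) \<and>
     (\<forall>m. eventually (\<lambda>n. n \<noteq> m) \<omega>)"

text \<open>The product of the matrix algebras \<open>M\<^sub>1, M\<^sub>2, \<dots>\<close>: since \<^typ>\<open>nat\<close> starts at \<open>0\<close>,
  the entry at \<open>n\<close> of a sequence is a matrix of size \<open>Suc n\<close>.\<close>

definition matseq_alg :: "(nat \<Rightarrow> complex mat) star_alg" where
  "matseq_alg =
     \<lparr> carrier = {T. (\<forall>n. T n \<in> carrier_mat (Suc n) (Suc n)) \<and> bdd_above (range (\<lambda>n. op_norm (T n)))},
       sa_add = (\<lambda>S T n. S n + T n),
       sa_scale = (\<lambda>c T n. c \<cdot>\<^sub>m T n),
       sa_mult = (\<lambda>S T n. S n * T n),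
       sa_star = (\<lambda>T n. mat_adjoint (T n)) \<rparr>"

definition matseq_null :: "nat filter \<Rightarrow> (nat \<Rightarrow> complex mat) set" where
  "matseq_null \<omega> = {T \<in> carrier matseq_alg. ((\<lambda>n. hs_norm (T n)) \<longlongrightarrow> 0) \<omega>}"

definition matseq_rel :: "nat filter \<Rightarrow> (nat \<Rightarrow> complex mat) rel" where
  "matseq_rel \<omega> = {(S, T). S \<in> carrier matseq_alg \<and> T \<in> carrier matseq_alg \<and>
                          (\<lambda>n. S n - T n) \<in> matseq_null \<omega>}"

text \<open>The quotient of the product by the ideal \<^term>\<open>matseq_null \<omega>\<close>.  The operations are those
  of representatives; the union over all representatives is the union of copies of one class.\<close>

definition matseq_quot_alg :: "nat filter \<Rightarrow> (nat \<Rightarrow> complex mat) set star_alg" where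
  "matseq_quot_alg \<omega> =
     \<lparr> carrier = carrier matseq_alg // matseq_rel \<omega>,
       sa_add = (\<lambda>X Y. \<Union>S\<in>X. \<Union>T\<in>Y. matseq_rel \<omega> `` {sa_add matseq_alg S T}),
       sa_scale = (\<lambda>c X. \<Union>T\<in>X. matseq_rel \<omega> `` {sa_scale matseq_alg c T}),
       sa_mult = (\<lambda>X Y. \<Union>S\<in>X. \<Union>T\<in>Y. matseq_rel \<omega> `` {sa_mult matseq_alg S T}),
       sa_star = (\<lambda>X. \<Union>T\<in>X. matseq_rel \<omega> `` {sa_star matseq_alg T}) \<rparr>"

definition hilbert_schmidt_stable :: "nat filter \<Rightarrow> 'b::cstar_algebra itself \<Rightarrow> bool" where
  "hilbert_schmidt_stable \<omega> _ \<longleftrightarrow>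
     (\<forall>\<pi> :: 'b \<Rightarrow> (nat \<Rightarrow> complex mat) set.
        star_hom cstar_alg (matseq_quot_alg \<omega>) \<pi> \<longrightarrow>
        (\<exists>\<psi> :: 'b \<Rightarrow> nat \<Rightarrow> complex mat.
           star_hom cstar_alg matseq_alg \<psi> \<and> (\<forall>b. \<pi> b = matseq_rel \<omega> `` {\<psi> b})))"

definition cstar_trace :: "('a::cstar_algebra \<Rightarrow> complex) \<Rightarrow> bool" where
  "cstar_trace \<tau> \<longleftrightarrow>
     (\<forall>a b. \<tau> (a + b) = \<tau> a + \<tau> b) \<and>
     (\<forall>c a. \<tau> (c *\<^sub>C a) = c * \<tau> a) \<and>
     (\<forall>a. \<tau> (star a * a) \<in> \<real>\<^sub>\<ge>\<^sub>0) \<and>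
     (\<forall>a. cmod (\<tau> a) \<le> norm a) \<and>
     (\<forall>a b. \<tau> (a * b) = \<tau> (b * a))"

text \<open>The conditions common to the following notions are parametrised by the norm \<open>N\<close> (either
  \<^const>\<open>hs_norm\<close> or \<^const>\<open>op_norm\<close>) in which the algebraic relations hold asymptotically.\<close>

definition matrix_maps :: "(nat \<Rightarrow> nat) \<Rightarrow> (nat \<Rightarrow> 'a \<Rightarrow> complex mat) \<Rightarrow> bool" where
  "matrix_maps k \<phi> \<longleftrightarrow> (\<forall>n. k n \<ge> 1 \<and> (\<forall>a. \<phi> n a \<in> carrier_mat (k n) (k n)))"

definition asymp_mult ::
  "(complex mat \<Rightarrow> real) \<Rightarrow> (nat \<Rightarrow> 'a::cstar_algebra \<Rightarrow> complex mat) \<Rightarrow> bool" where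
  "asymp_mult N \<phi> \<longleftrightarrow> (\<forall>a b. (\<lambda>n. N (\<phi> n (a * b) - \<phi> n a * \<phi> n b)) \<longlonglongrightarrow> 0)"

definition asymp_linear ::
  "(complex mat \<Rightarrow> real) \<Rightarrow> (nat \<Rightarrow> 'a::cstar_algebra \<Rightarrow> complex mat) \<Rightarrow> bool" where
  "asymp_linear N \<phi> \<longleftrightarrow>
     (\<forall>c d a b. (\<lambda>n. N (\<phi> n (c *\<^sub>C a + d *\<^sub>C b) - c \<cdot>\<^sub>m \<phi> n a - d \<cdot>\<^sub>m \<phi> n b)) \<longlonglongrightarrow> 0)"

definition asymp_star ::
  "(complex mat \<Rightarrow> real) \<Rightarrow> (nat \<Rightarrow> 'a::cstar_algebra \<Rightarrow> complex mat) \<Rightarrow> bool" where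
  "asymp_star N \<phi> \<longleftrightarrow> (\<forall>a. (\<lambda>n. N (\<phi> n (star a) - mat_adjoint (\<phi> n a))) \<longlonglongrightarrow> 0)"

definition approximates_trace ::
  "(nat \<Rightarrow> 'a \<Rightarrow> complex mat) \<Rightarrow> ('a \<Rightarrow> complex) \<Rightarrow> bool" where
  "approximates_trace \<phi> \<tau> \<longleftrightarrow> (\<forall>a. (\<lambda>n. cmod (\<tau> a - mat_tr (\<phi> n a))) \<longlonglongrightarrow> 0)"

definition trace_approx_by_maps ::
  "(complex mat \<Rightarrow> real) \<Rightarrow> ('a::cstar_algebra \<Rightarrow> complex) \<Rightarrow> bool" where
  "trace_approx_by_maps N \<tau> \<longleftrightarrow>
     (\<exists>k \<phi>. matrix_maps k \<phi> \<and> asymp_mult N \<phi> \<and> asymp_linear N \<phi> \<and> asymp_star N \<phi> \<and>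
        (\<forall>a. bdd_above (range (\<lambda>n. op_norm (\<phi> n a)))) \<and> approximates_trace \<phi> \<tau>)"

definition hyperlinear_trace :: "('a::cstar_algebra \<Rightarrow> complex) \<Rightarrow> bool" where
  "hyperlinear_trace \<tau> \<longleftrightarrow> cstar_trace \<tau> \<and> trace_approx_by_maps hs_norm \<tau>"

definition MF_trace :: "('a::cstar_algebra \<Rightarrow> complex) \<Rightarrow> bool" where
  "MF_trace \<tau> \<longleftrightarrow> cstar_trace \<tau> \<and> trace_approx_by_maps op_norm \<tau>"

text \<open>An element of a C*-algebra is positive iff it has the form \<open>x\<^sup>* x\<close>; this is used for
  \<open>M\<^sub>m(A)\<close> and for \<open>M\<^sub>m(M\<^sub>k) = M\<^bsub>m k\<^esub>\<close>.\<close>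

definition cstar_mat_positive :: "nat \<Rightarrow> 'a::cstar_algebra mat \<Rightarrow> bool" where
  "cstar_mat_positive m P \<longleftrightarrow>
     (\<exists>X \<in> carrier_mat m m. P = map_mat star (transpose_mat X) * X)"

definition complex_mat_positive :: "nat \<Rightarrow> complex mat \<Rightarrow> bool" where
  "complex_mat_positive m P \<longleftrightarrow> (\<exists>X \<in> carrier_mat m m. P = mat_adjoint X * X)"

text \<open>Entrywise application \<open>M\<^sub>m(A) \<rightarrow> M\<^sub>m(M\<^sub>k)\<close> of a map \<open>A \<rightarrow> M\<^sub>k\<close>, the result being written as
  a block matrix of size \<open>m k\<close>.\<close>

definition mat_amplification ::
  "nat \<Rightarrow> nat \<Rightarrow> ('a \<Rightarrow> complex mat) \<Rightarrow> 'a mat \<Rightarrow> complex mat" where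
  "mat_amplification m k f P =
     Matrix.mat (m * k) (m * k) (\<lambda>(p, q). f (P $$ (p div k, q div k)) $$ (p mod k, q mod k))"

definition ccp_map :: "nat \<Rightarrow> ('a::cstar_algebra \<Rightarrow> complex mat) \<Rightarrow> bool" where
  "ccp_map k f \<longleftrightarrow>
     (\<forall>a. f a \<in> carrier_mat k k) \<and>
     (\<forall>a b. f (a + b) = f a + f b) \<and>
     (\<forall>c a. f (c *\<^sub>C a) = c \<cdot>\<^sub>m f a) \<and>
     (\<forall>a. op_norm (f a) \<le> norm a) \<and>
     (\<forall>m P. cstar_mat_positive m P \<longrightarrow> complex_mat_positive (m * k) (mat_amplification m k f P))"

definition trace_approx_by_ccp_maps ::
  "(complex mat \<Rightarrow> real) \<Rightarrow> ('a::cstar_algebra \<Rightarrow> complex) \<Rightarrow> bool" where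
  "trace_approx_by_ccp_maps N \<tau> \<longleftrightarrow>
     (\<exists>k \<phi>. matrix_maps k \<phi> \<and> (\<forall>n. ccp_map (k n) (\<phi> n)) \<and> asymp_mult N \<phi> \<and>
        approximates_trace \<phi> \<tau>)"

definition amenable_trace :: "('a::cstar_algebra \<Rightarrow> complex) \<Rightarrow> bool" where
  "amenable_trace \<tau> \<longleftrightarrow> cstar_trace \<tau> \<and> trace_approx_by_ccp_maps hs_norm \<tau>"

definition quasidiagonal_trace :: "('a::cstar_algebra \<Rightarrow> complex) \<Rightarrow> bool" where
  "quasidiagonal_trace \<tau> \<longleftrightarrow> cstar_trace \<tau> \<and> trace_approx_by_ccp_maps op_norm \<tau>"

end

theory Submission
  imports Defs
begin

text \<open>Let \<open>\<tau>\<close> be a trace on \<open>A\<close> with approximating maps \<open>\<phi>\<^sub>n\<close>.  Their errors are small in the normalised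
Hilbert-Schmidt norm, which means: small in operator norm on the orthogonal complement of a subspace
\<open>V\<^sub>0\<close> whose dimension is a vanishing proportion of the whole.  The trace does not see such a
subspace.  The idea of the proof is to replace \<open>\<phi>\<^sub>n\<close> near \<open>V\<^sub>0\<close> by an exactly multiplicative map,
and to use the homotopy to interpolate, so slowly that nothing is spoilt in operator norm.

The exact map comes from stability.  After amplification to all matrix sizes (\<open>resize\<close>) the maps
\<open>\<phi>\<^sub>n \<circ> \<alpha>\<close> define a homomorphism of \<open>B\<close> into the quotient by the Hilbert-Schmidt null sequences;
Hilbert-Schmidt stability provides genuine representations \<open>\<psi>\<^sub>n\<close> of \<open>B\<close> at vanishing
Hilbert-Schmidt distance (\<open>lift_hom\<close>).  Sampling the homotopy \<open>\<Phi>\<close> from \<open>\<alpha> \<circ> \<beta>\<close> to the identity at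
points \<open>0 = t\<^sub>1 < \<dots> < t\<^sub>K = 1\<close> gives maps \<open>\<sigma>\<^sub>0 = \<psi>\<^sub>n \<circ> \<beta>\<close> and \<open>\<sigma>\<^sub>i = \<phi>\<^sub>n \<circ> \<Phi>\<^sub>t\<^sub>i\<close>.  On the complement of a small
\<open>V\<^sub>0\<close> each \<open>\<sigma>\<^sub>i\<close> is almost multiplicative and consecutive ones almost agree on a given finite set.
For the second point one needs that \<open>\<phi>\<^sub>n(x)\<close> has norm at most \<open>\<parallel>x\<parallel> + \<epsilon>\<close> off a small subspace, although
nothing is assumed about the norms of \<open>\<phi>\<^sub>n(x)\<close> beyond boundedness.  This follows from the moments
of \<open>x\<^sup>* x\<close>: the trace of \<open>(\<phi>\<^sub>n(x)\<^sup>* \<phi>\<^sub>n(x))\<^sup>m\<close> converges to \<open>\<tau>((x\<^sup>* x)\<^sup>m) \<le> \<parallel>x\<parallel>\<^sup>2\<^sup>m\<close> (\<open>ess_bounded_norm\<close>).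

Interpolation needs an approximate unit of the small subspaces that almost commutes with the
matrices \<open>\<sigma>\<^sub>i(a)\<close>.  Put \<open>V\<^sub>m\<^sub>+\<^sub>1 = V\<^sub>m + \<Sum> X V\<^sub>m\<close>, the sum running over these matrices and their adjoints.  The
dimension grows by a bounded factor in each step, so \<open>V\<^sub>M\<close> is still tracially negligible for fixed
\<open>M\<close>, and in a basis adapted to the flag all \<open>\<sigma>\<^sub>i(a)\<close> are block tridiagonal (\<open>block_tridiagonal\<close>).  Hence
they almost commute with diagonal matrices \<open>D\<^sub>i\<close> that depend slowly on the block index
(\<open>op_bounded_comm_diag\<close>).  Choose the \<open>D\<^sub>i\<close> as tents with \<open>\<Sum> D\<^sub>i\<^sup>2 = 1\<close>, with \<open>D\<^sub>0 = 1\<close> on \<open>V\<^sub>0\<close> and the last tent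
equal to \<open>1\<close> beyond \<open>V\<^sub>M\<close>, and let \<open>\<theta>(a) = \<Sum> D\<^sub>i \<sigma>\<^sub>i(a) D\<^sub>i\<close>.  In \<open>\<theta>(a b) - \<theta>(a) \<theta>(b)\<close> only equal or
neighbouring indices interact.  Either both are \<open>0\<close>, and \<open>\<sigma>\<^sub>0\<close> is exactly multiplicative, or the
product error is only seen on the complement of \<open>V\<^sub>0\<close>, where it is small in operator norm
(\<open>patch_mult\<close>).  The traces of \<open>\<theta>(a)\<close> and \<open>\<phi>\<^sub>n(a)\<close> differ only on \<open>V\<^sub>M\<close> (\<open>patch_trace\<close>).  If the \<open>\<phi>\<^sub>n\<close> are
contractive and completely positive, then so is \<open>\<theta>\<close>.  This is \<open>local_approximation\<close>; separability of
\<open>A\<close> then allows a diagonal argument over finite sets.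

The little C*-algebra theory involved avoids spectral theory.  It rests on the fact that a
self-adjoint \<open>h\<close> of norm less than \<open>1\<close> satisfies \<open>1 - h = (1 - y)\<^sup>2\<close> with \<open>y\<close> self-adjoint, a fixed
point of a contraction.\<close>

section \<open>C*-algebras without spectral theory\<close>

lemma scaleC_zero_left: "0 *\<^sub>C (x::'a::cstar_algebra) = 0"
  using scaleC_of_real[of 0 x] by simp

lemma scaleC_one: "1 *\<^sub>C (x::'a::cstar_algebra) = x"
  using scaleC_of_real[of 1 x] by simp

lemma scaleC_minus_one: "(-1) *\<^sub>C (x::'a::cstar_algebra) = - x"
  using scaleC_of_real[of "-1" x] by simp

lemma scaleC_minus_left: "(- c) *\<^sub>C (x::'a::cstar_algebra) = - (c *\<^sub>C x)"
  using scaleC_scaleC[of "-1" c x] by (simp add: scaleC_minus_one)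

lemma scaleC_minus_right: "c *\<^sub>C (- x::'a::cstar_algebra) = - (c *\<^sub>C x)"
  using scaleC_scaleC[of c "-1" x] scaleC_minus_left[of c x] by (simp add: scaleC_minus_one)

lemma scaleC_diff_right: "c *\<^sub>C (x - y::'a::cstar_algebra) = c *\<^sub>C x - c *\<^sub>C y"
  using scaleC_add_right[of c x "-y"] by (simp add: scaleC_minus_right)

lemma star_zero [simp]: "star (0::'a::cstar_algebra) = 0"
  using star_add[of "0::'a" 0] by simp

lemma star_minus: "star (- x) = - star (x::'a::cstar_algebra)"
  using star_add[of x "-x"] by (simp add: eq_neg_iff_add_eq_0 add.commute)

lemma star_diff: "star (x - y) = star x - star (y::'a::cstar_algebra)"
  using star_add[of x "-y"] by (simp add: star_minus)

lemma star_scaleR: "star (r *\<^sub>R x) = r *\<^sub>R star (x::'a::cstar_algebra)"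
  using star_scaleC[of "complex_of_real r" x] by (simp add: scaleC_of_real)

lemma norm_le_norm_star: "norm (x::'a::cstar_algebra) \<le> norm (star x)"
proof (cases "x = 0")
  case False
  have "norm x * norm x \<le> norm (star x) * norm x"
    using cstar_identity[of x] norm_mult_ineq[of "star x" x] by (simp add: power2_eq_square)
  then show ?thesis using False by simp
qed simp

lemma norm_star: "norm (star x) = norm (x::'a::cstar_algebra)"
  using norm_le_norm_star[of x] norm_le_norm_star[of "star x"] by (simp add: star_star)

lemma continuous_on_star: "continuous_on S (star :: 'a::cstar_algebra \<Rightarrow> 'a)"
proof -
  have "dist (star x) (star y) = dist x y" for x y :: 'a
    by (simp add: dist_norm norm_star flip: star_diff)
  then show ?thesis by (auto simp: continuous_on_iff)
qed

lemma norm_square_selfadjoint: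
  "star x = x \<Longrightarrow> norm (x * x) = (norm (x::'a::cstar_algebra))\<^sup>2"
  using cstar_identity[of x] by simp

text \<open>The equation says \<open>(1 - y)\<^sup>2 = 1 - h\<close> without mentioning a unit.  It is the fixed-point equation of
\<open>y \<mapsto> (h + y\<^sup>2) / 2\<close>, a contraction of the closed ball of radius \<open>1 - \<surd>(1 - \<parallel>h\<parallel>)\<close>; self-adjointness and
commutation with the commutant of \<open>h\<close> are closed conditions preserved by this map.\<close>

lemma cstar_sqrt_one_minus:
  fixes h :: "'a::cstar_algebra"
  assumes "norm h < 1" "star h = h"
  shows "\<exists>y. star y = y \<and> y + y = h + y * y \<and> (\<forall>c. c * h = h * c \<longrightarrow> c * y = y * c)"
proof -
  define r where "r = 1 - sqrt (1 - norm h)"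
  have sq: "(sqrt (1 - norm h))\<^sup>2 = 1 - norm h" using assms by simp
  have r: "0 \<le> r" "r < 1" using assms by (auto simp: r_def)
  have rr: "norm h + r * r = 2 * r"
    using sq by (simp add: r_def power2_eq_square algebra_simps)
  define S where "S = {y::'a. norm y \<le> r} \<inter> {y. star y = y} \<inter> (\<Inter>c\<in>{c. c * h = h * c}. {y. c * y = y * c})"
  define T where "T = (\<lambda>y::'a. (1/2) *\<^sub>R (h + y * y))"
  have "closed S" unfolding S_def
    by (intro closed_Int closed_INT ballI closed_Collect_le closed_Collect_eq continuous_on_star continuous_intros)
  then have "complete S" by (simp add: complete_eq_closed)
  moreover have "S \<noteq> {}" proof -
    have "0 \<in> S" using r by (auto simp: S_def)
    then show ?thesis by blast
  qed
  moreover have "T ` S \<subseteq> S"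
  proof
    fix x assume "x \<in> T ` S"
    then obtain y where y: "y \<in> S" "x = T y" by auto
    have n: "norm y \<le> r" "star y = y" and c: "\<And>c. c * h = h * c \<Longrightarrow> c * y = y * c"
      using y by (auto simp: S_def)
    have "norm y * norm y \<le> r * r" using n(1) r by (intro mult_mono) auto
    then have "norm (h + y * y) \<le> norm h + r * r"
      using norm_triangle_ineq[of h "y*y"] norm_mult_ineq[of y y] by linarith
    then have "norm x \<le> r" using rr y by (simp add: T_def)
    moreover have "star x = x" using n assms y by (simp add: T_def star_scaleR star_add star_mult)
    moreover have "c * x = x * c" if "c * h = h * c" for c
    proof -
      have "c * (y * y) = y * y * c" using c[OF that] by (metis mult.assoc)
      then show ?thesis using that y by (simp add: T_def distrib_left distrib_right)
    qed
    ultimately show "x \<in> S" by (auto simp: S_def)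
  qed
  moreover have "dist (T x) (T y) \<le> r * dist x y" if "x \<in> S" "y \<in> S" for x y
  proof -
    have n: "norm x \<le> r" "norm y \<le> r" using that by (auto simp: S_def)
    have "norm (x * x - y * y) = norm (x * (x - y) + (x - y) * y)" by (simp add: algebra_simps)
    also have "\<dots> \<le> norm x * norm (x - y) + norm (x - y) * norm y"
      using norm_triangle_ineq norm_mult_ineq by (meson add_mono order_trans)
    also have "\<dots> \<le> r * norm (x - y) + norm (x - y) * r"
      using n r by (intro add_mono mult_mono) auto
    finally have "norm (x * x - y * y) \<le> 2 * (r * norm (x - y))" by simp
    moreover have "T x - T y = (1/2) *\<^sub>R (x * x - y * y)" by (simp add: T_def algebra_simps)
    ultimately show ?thesis by (simp add: dist_norm)
  qed
  ultimately have "\<exists>!x\<in>S. T x = x" using r Banach_fix[of S r T] by blast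
  then obtain y where y: "y \<in> S" "T y = y" by blast
  have "y + y = h + y * y"
  proof -
    have "2 *\<^sub>R T y = h + y * y" by (simp add: T_def)
    then show ?thesis using y by (simp add: scaleR_2)
  qed
  moreover have "star y = y" "\<forall>c. c * h = h * c \<longrightarrow> c * y = y * c" using y(1) by (simp_all add: S_def)
  ultimately show ?thesis by blast
qed

text \<open>The hypothesis says that \<open>1 - z\<close> is an isometry in the unitisation, where the bound is the triangle
inequality.  The proof stays inside the algebra.\<close>

lemma norm_one_minus_isometry:
  fixes z :: "'a::cstar_algebra"
  assumes "star z + z = star z * z"
  shows "norm z \<le> 2"
proof (cases "z = 0")
  case False
  have "norm z * norm z = norm (star z + z)" using cstar_identity[of z] assms by (simp add: power2_eq_square)
  also have "\<dots> \<le> 2 * norm z" using norm_triangle_ineq[of "star z" z] by (simp add: norm_star)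
  finally show ?thesis using False by simp
qed simp

lemma norm_imag_part:
  fixes w b :: "'a::cstar_algebra"
  assumes "norm (w + \<i> *\<^sub>C b) \<le> 2" "star w = w" "star b = b"
  shows "norm b \<le> 2"
proof -
  define z where "z = w + \<i> *\<^sub>C b"
  have "z - star z = (2 * \<i>) *\<^sub>C b"
  proof -
    have "star z = w - \<i> *\<^sub>C b" using assms by (simp add: z_def star_add star_scaleC scaleC_minus_left)
    then show ?thesis using scaleC_add_left[of \<i> \<i> b] by (simp add: z_def)
  qed
  then have "2 * norm b = norm (z - star z)" by (simp add: norm_scaleC norm_mult)
  also have "\<dots> \<le> norm z + norm (star z)" by (rule norm_triangle_ineq4)
  finally show ?thesis using assms(1) by (simp add: z_def norm_star)
qed

text \<open>If \<open>b\<^sup>2 + (1 - w)\<^sup>2 = 1\<close> for commuting self-adjoint \<open>b\<close> and \<open>w\<close>, then \<open>(1 - w) - \<i> b\<close> is unitary.\<close>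

lemma one_minus_unitary:
  fixes w b :: "'a::cstar_algebra"
  assumes "star w = w" "star b = b" "w + w = b * b + w * w" "b * w = w * b"
  shows "star (w + \<i> *\<^sub>C b) + (w + \<i> *\<^sub>C b) = star (w + \<i> *\<^sub>C b) * (w + \<i> *\<^sub>C b)"
proof -
  have s: "star (w + \<i> *\<^sub>C b) = w - \<i> *\<^sub>C b" using assms by (simp add: star_add star_scaleC scaleC_minus_left)
  have "(w - \<i> *\<^sub>C b) * (w + \<i> *\<^sub>C b) = w * w + \<i> *\<^sub>C (w * b) - \<i> *\<^sub>C (b * w) - \<i> *\<^sub>C (\<i> *\<^sub>C (b * b))"
    by (simp add: algebra_simps scaleC_mult_left scaleC_mult_right scaleC_diff_right)
  also have "\<dots> = w * w + b * b" using assms(4) by (simp add: scaleC_scaleC scaleC_minus_one)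
  finally show ?thesis using s assms(3) by (simp add: add.commute)
qed

lemma star_homD:
  fixes f :: "'a::cstar_algebra \<Rightarrow> 'b::cstar_algebra"
  assumes "star_hom cstar_alg cstar_alg f"
  shows "f (x + y) = f x + f y" "f (c *\<^sub>C x) = c *\<^sub>C f x" "f (x * y) = f x * f y" "f (star x) = star (f x)"
  using assms by (auto simp: star_hom_def cstar_alg_def)

lemma star_hom_scaleR:
  fixes f :: "'a::cstar_algebra \<Rightarrow> 'b::cstar_algebra"
  assumes "star_hom cstar_alg cstar_alg f"
  shows "f (r *\<^sub>R x) = r *\<^sub>R f x"
  using star_homD(2)[OF assms, of "complex_of_real r" x] by (simp add: scaleC_of_real)

lemma star_hom_bounded_unit_ball:
  fixes f :: "'a::cstar_algebra \<Rightarrow> 'b::cstar_algebra"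
  assumes f: "star_hom cstar_alg cstar_alg f" and a: "star a = a" "norm a < 1"
  shows "norm (f a) \<le> 2"
proof -
  note h = star_homD[OF f]
  have "norm (a * a) < 1" using a norm_square_selfadjoint[of a] by (simp add: power_less_one_iff)
  then obtain y where y: "star y = y" "y + y = a * a + y * y" "a * y = y * a"
    using cstar_sqrt_one_minus[of "a * a"] a(1) by (metis mult.assoc star_mult)
  have "f y + f y = f a * f a + f y * f y" using arg_cong[OF y(2), of f] by (simp add: h)
  moreover have "f a * f y = f y * f a" using arg_cong[OF y(3), of f] by (simp add: h)
  moreover have "star (f y) = f y" "star (f a) = f a" using y a by (simp_all flip: h(4))
  ultimately show ?thesis using norm_imag_part norm_one_minus_isometry one_minus_unitary by blast
qed

text \<open>On self-adjoint elements squaring doubles the exponent of the norm in both algebras, so the crude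
bound \<open>2\<close> improves to its \<open>2\<^sup>k\<close>-th root.\<close>

lemma star_hom_power2:
  fixes f :: "'a::cstar_algebra \<Rightarrow> 'b::cstar_algebra"
  assumes f: "star_hom cstar_alg cstar_alg f"
  shows "star a = a \<Longrightarrow> norm a < 1 \<Longrightarrow> (norm (f a)) ^ (2 ^ k) \<le> 2"
proof (induction k arbitrary: a)
  case 0 then show ?case using star_hom_bounded_unit_ball[OF f] by simp
next
  case (Suc k)
  note h = star_homD[OF f]
  have "norm (a * a) < 1" using Suc.prems norm_square_selfadjoint[of a] by (simp add: power_less_one_iff)
  then have "norm (f (a * a)) ^ (2 ^ k) \<le> 2" using Suc by (simp add: star_mult)
  moreover have "norm (f (a * a)) = (norm (f a))\<^sup>2"
    using norm_square_selfadjoint[of "f a"] Suc.prems by (simp add: h flip: h(4))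
  ultimately show ?case by (simp add: power_mult[symmetric] mult.commute)
qed

text \<open>Contractivity without spectral radius: for self-adjoint \<open>a\<close> of norm less than \<open>1\<close> the image of \<open>a\<close> is
the imaginary part of a unitary because \<open>1 - a\<^sup>2\<close> is a square, and then the previous lemma applies.\<close>

lemma star_hom_contractive:
  fixes f :: "'a::cstar_algebra \<Rightarrow> 'b::cstar_algebra"
  assumes f: "star_hom cstar_alg cstar_alg f"
  shows "norm (f a) \<le> norm a"
proof -
  note h = star_homD[OF f]
  have ball: "norm (f b) \<le> 1" if "star b = b" "norm b < 1" for b
  proof (rule ccontr)
    assume "\<not> norm (f b) \<le> 1"
    then obtain n where "2 < norm (f b) ^ n" using real_arch_pow[of "norm (f b)" 2] by auto
    moreover have "norm (f b) ^ n \<le> norm (f b) ^ (2 ^ n)" using \<open>\<not> norm (f b) \<le> 1\<close>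
      by (intro power_increasing) (auto simp: less_imp_le)
    ultimately show False using star_hom_power2[OF f that, of n] by simp
  qed
  have sa: "norm (f b) \<le> norm b" if "star b = b" for b
  proof (rule field_le_epsilon)
    fix e :: real assume e: "e > 0"
    define t where "t = norm b + e"
    have t: "t > 0" "norm b < t" using e by (auto simp: t_def add_nonneg_pos)
    have "norm (f ((1/t) *\<^sub>R b)) \<le> 1" using that t by (intro ball) (auto simp: star_scaleR)
    then show "norm (f b) \<le> norm b + e" using t by (simp add: star_hom_scaleR[OF f] t_def divide_simps)
  qed
  have "(norm (f a))\<^sup>2 = norm (f (star a * a))" using cstar_identity[of "f a"] by (simp add: h)
  also have "\<dots> \<le> norm (star a * a)" by (rule sa) (simp add: star_mult star_star)
  finally have "(norm (f a))\<^sup>2 \<le> (norm a)\<^sup>2" by (simp add: cstar_identity)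
  then show ?thesis using norm_ge_zero power2_le_imp_le by blast
qed

text \<open>In other words the products span a dense subspace.  For self-adjoint \<open>b\<close> there is a unitary \<open>1 - z\<close> with
\<open>z \<equiv> \<i> b\<close> modulo products.  Its powers \<open>1 - u\<^sub>n\<close> are unitary, so \<open>\<parallel>u\<^sub>n\<parallel> \<le> 2\<close>, while \<open>u\<^sub>n \<equiv> n z\<close> modulo products;
hence \<open>n \<bar>g b\<bar>\<close> stays bounded.\<close>

lemma bounded_functional_vanishing_on_products:
  fixes g :: "'a::cstar_algebra \<Rightarrow> complex"
  assumes add: "\<And>x y. g (x + y) = g x + g y" and scale: "\<And>c x. g (c *\<^sub>C x) = c * g x"
    and bound: "\<And>x. cmod (g x) \<le> C * norm x" and prod: "\<And>x y. g (x * y) = 0"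
  shows "g a = 0"
proof -
  have diff: "g (x - y) = g x - g y" for x y
    using add[of "x - y" y] by simp
  have sm: "g b = 0" if b: "star b = b" "norm b < 1" for b
  proof -
    have "norm (b * b) < 1" using b norm_square_selfadjoint[of b] by (simp add: power_less_one_iff)
    then obtain y where y: "star y = y" "y + y = b * b + y * y" "b * y = y * b"
      using cstar_sqrt_one_minus[of "b * b"] b(1) by (metis mult.assoc star_mult)
    have "2 * g y = 0" using arg_cong[OF y(2), of g] by (simp add: add prod)
    define z where "z = y + \<i> *\<^sub>C b"
    have gz: "g z = \<i> * g b" using \<open>2 * g y = 0\<close> by (simp add: z_def add scale)
    have z: "star z + z = star z * z" unfolding z_def using y b by (intro one_minus_unitary) auto
    have "\<exists>u. star u + u = star u * u \<and> g u = of_nat n * g z" for n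
    proof (induction n)
      case 0 then show ?case using scale[of 0 z] by (intro exI[of _ 0]) (simp add: scaleC_zero_left)
    next
      case (Suc n)
      then obtain u where u: "star u + u = star u * u" "g u = of_nat n * g z" by blast
      \<comment> \<open>That is, \<open>1 - v = (1 - u) (1 - z)\<close>.\<close>
      define v where "v = u + z - u * z"
      have "star v + v = star v * v"
      proof -
        have "star v * v = star u * u + star z * z + star u * z + star z * u - (star u * u) * z - star z * (star u * u)
            - (star z * star u * z + star z * (u * z)) + star z * (star u * u) * z
            "
          by (simp add: v_def star_add star_diff star_mult algebra_simps)
        moreover have "star z * (star u * u) * z = star z * star u * z + star z * (u * z)"
          by (simp add: algebra_simps flip: u(1))
        ultimately have "star v * v = star u + u + (star z + z) + star u * z + star z * u
            - (star u + u) * z - star z * (star u + u)" using u z by simp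
        also have "\<dots> = star v + v"  by (simp add: v_def star_add star_diff star_mult algebra_simps)
        finally show ?thesis by simp
      qed
      moreover have "g v = of_nat (Suc n) * g z" using u by (simp add: v_def add diff prod algebra_simps)
      ultimately show ?case by blast
    qed
    then have "real n * cmod (g b) \<le> 2 * \<bar>C\<bar>" for n
    proof -
      obtain u where u: "star u + u = star u * u" "g u = of_nat n * g z"
        using \<open>\<And>n. \<exists>u. star u + u = star u * u \<and> g u = of_nat n * g z\<close> by blast
      have "real n * cmod (g b) = cmod (g u)" using u gz by (simp add: norm_mult)
      also have "\<dots> \<le> C * norm u" by (rule bound)
      also have "\<dots> \<le> \<bar>C\<bar> * norm u" by (intro mult_right_mono) auto
      also have "\<dots> \<le> \<bar>C\<bar> * 2" using norm_one_minus_isometry[OF u(1)] by (intro mult_left_mono) auto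
      finally show ?thesis by simp
    qed
    then show "g b = 0"
      using reals_Archimedean3[of "cmod (g b)"] by (metis not_le zero_less_norm_iff)
  qed
  have scaleR: "g (r *\<^sub>R x) = of_real r * g x" for r x using scale[of "of_real r" x] by (simp add: scaleC_of_real)
  have sa: "g b = 0" if "star b = b" for b
  proof -
    define t where "t = norm b + 1"
    have t: "t > 0" "norm b < t" by (auto simp: t_def add_nonneg_pos)
    have "g ((1/t) *\<^sub>R b) = 0" using that t by (intro sm) (auto simp: star_scaleR)
    then show ?thesis using t by (simp add: scaleR)
  qed
  have "g (a + star a) = 0" "g (\<i> *\<^sub>C (a - star a)) = 0"
    by (auto intro!: sa simp: star_add star_diff star_scaleC star_star scaleC_diff_right scaleC_minus_left)
  then have "g a + g (star a) = 0" "g a - g (star a) = 0" by (simp_all add: add diff scale)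
  then show ?thesis by simp
qed

section \<open>Matrices as kernels on an initial segment of the natural numbers\<close>

text \<open>Kernels are functions on all of \<open>nat \<times> nat\<close> of which only the part below the size \<open>N\<close> matters; no
carrier conditions accompany the algebra.  The form is antilinear in the first argument.\<close>

definition inprod :: "nat \<Rightarrow> (nat \<Rightarrow> complex) \<Rightarrow> (nat \<Rightarrow> complex) \<Rightarrow> complex" where
  "inprod N u v = (\<Sum>p<N. cnj (u p) * v p)"

definition vnorm :: "nat \<Rightarrow> (nat \<Rightarrow> complex) \<Rightarrow> real" where
  "vnorm N v = L2_set (\<lambda>p. cmod (v p)) {..<N}"

definition kapply :: "nat \<Rightarrow> (nat \<Rightarrow> nat \<Rightarrow> complex) \<Rightarrow> (nat \<Rightarrow> complex) \<Rightarrow> nat \<Rightarrow> complex" where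
  "kapply N a v = (\<lambda>p. \<Sum>q<N. a p q * v q)"

definition kmult :: "nat \<Rightarrow> (nat \<Rightarrow> nat \<Rightarrow> complex) \<Rightarrow> (nat \<Rightarrow> nat \<Rightarrow> complex) \<Rightarrow> nat \<Rightarrow> nat \<Rightarrow> complex" where
  "kmult N a b = (\<lambda>p q. \<Sum>r<N. a p r * b r q)"

definition adj :: "(nat \<Rightarrow> nat \<Rightarrow> complex) \<Rightarrow> nat \<Rightarrow> nat \<Rightarrow> complex" where
  "adj a = (\<lambda>p q. cnj (a q p))"

definition op_bounded :: "nat \<Rightarrow> (nat \<Rightarrow> nat \<Rightarrow> complex) \<Rightarrow> real \<Rightarrow> bool" where
  "op_bounded N a c \<longleftrightarrow> (\<forall>v. vnorm N (kapply N a v) \<le> c * vnorm N v)"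

definition ent :: "complex mat \<Rightarrow> nat \<Rightarrow> nat \<Rightarrow> complex" where
  "ent T = (\<lambda>p q. T $$ (p, q))"

subsection \<open>Vectors\<close>

lemma vnorm_nonneg [simp]: "0 \<le> vnorm N v"
  by (simp add: vnorm_def)

lemma vnorm_sq: "(vnorm N v)\<^sup>2 = (\<Sum>p<N. (cmod (v p))\<^sup>2)"
  by (simp add: vnorm_def L2_set_def sum_nonneg)

lemma vnorm_cong: "(\<And>p. p < N \<Longrightarrow> u p = v p) \<Longrightarrow> vnorm N u = vnorm N v"
  unfolding vnorm_def by (rule L2_set_cong) auto

lemma vnorm_zero [simp]: "vnorm N (\<lambda>p. 0) = 0"
  by (simp add: vnorm_def L2_set_def)

lemma vnorm_eq_0: "vnorm N v = 0 \<longleftrightarrow> (\<forall>p<N. v p = 0)"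
  by (auto simp: vnorm_def L2_set_eq_0_iff)

lemma vnorm_triangle: "vnorm N (\<lambda>p. u p + v p) \<le> vnorm N u + vnorm N v"
proof -
  have "vnorm N (\<lambda>p. u p + v p) \<le> L2_set (\<lambda>p. cmod (u p) + cmod (v p)) {..<N}"
    unfolding vnorm_def by (rule L2_set_mono) (auto intro: norm_triangle_ineq)
  also have "\<dots> \<le> vnorm N u + vnorm N v" unfolding vnorm_def by (rule L2_set_triangle_ineq)
  finally show ?thesis .
qed

lemma vnorm_scale: "vnorm N (\<lambda>p. c * v p) = cmod c * vnorm N v"
  by (simp add: vnorm_def norm_mult L2_set_right_distrib)

lemma vnorm_diff: "vnorm N (\<lambda>p. u p - v p) \<le> vnorm N u + vnorm N v"
  using vnorm_triangle[of N u "\<lambda>p. (-1) * v p"] vnorm_scale[of N "-1" v] by simp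

lemma vnorm_mono: "(\<And>p. p < N \<Longrightarrow> cmod (u p) \<le> cmod (v p)) \<Longrightarrow> vnorm N u \<le> vnorm N v"
  unfolding vnorm_def by (rule L2_set_mono) auto

lemma inprod_self: "inprod N v v = complex_of_real ((vnorm N v)\<^sup>2)"
  by (simp add: inprod_def vnorm_sq complex_norm_square mult.commute flip: of_real_power)

lemma inprod_cnj: "cnj (inprod N u v) = inprod N v u"
  by (simp add: inprod_def mult.commute)

lemma inprod_add_right: "inprod N u (\<lambda>p. v p + w p) = inprod N u v + inprod N u w"
  by (simp add: inprod_def algebra_simps sum.distrib)

lemma inprod_diff_right: "inprod N u (\<lambda>p. v p - w p) = inprod N u v - inprod N u w"
  by (simp add: inprod_def algebra_simps sum_subtractf)

lemma inprod_scale_right: "inprod N u (\<lambda>p. c * v p) = c * inprod N u v"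
  by (simp add: inprod_def sum_distrib_left algebra_simps)

lemma inprod_sum_right: "inprod N u (\<lambda>p. \<Sum>i\<in>I. v i p) = (\<Sum>i\<in>I. inprod N u (v i))"
  by (simp add: inprod_def sum_distrib_left) (rule sum.swap)

lemma inprod_diff_left: "inprod N (\<lambda>p. v p - w p) u = inprod N v u - inprod N w u"
  by (simp add: inprod_def algebra_simps sum_subtractf)

lemma inprod_scale_left: "inprod N (\<lambda>p. c * v p) u = cnj c * inprod N v u"
  by (simp add: inprod_def sum_distrib_left algebra_simps)

lemma inprod_sum_left: "inprod N (\<lambda>p. \<Sum>i\<in>I. v i p) u = (\<Sum>i\<in>I. inprod N (v i) u)"
  by (simp add: inprod_def sum_distrib_right cnj_sum) (rule sum.swap)

lemma Cauchy_Schwarz_inprod: "cmod (inprod N u v) \<le> vnorm N u * vnorm N v"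
proof -
  have "cmod (inprod N u v) \<le> (\<Sum>p<N. \<bar>cmod (u p)\<bar> * \<bar>cmod (v p)\<bar>)"
    unfolding inprod_def by (rule order_trans[OF norm_sum]) (simp add: norm_mult)
  also have "\<dots> \<le> vnorm N u * vnorm N v" unfolding vnorm_def by (rule L2_set_mult_ineq)
  finally show ?thesis .
qed

subsection \<open>Operators and operator bounds\<close>

lemma kapply_scale_right: "kapply N a (\<lambda>p. c * v p) = (\<lambda>p. c * kapply N a v p)"
  by (simp add: kapply_def algebra_simps sum_distrib_left)

lemma kapply_add_left: "kapply N (\<lambda>p q. a p q + b p q) v = (\<lambda>p. kapply N a v p + kapply N b v p)"
  by (simp add: kapply_def algebra_simps sum.distrib)

lemma kapply_diff_left: "kapply N (\<lambda>p q. a p q - b p q) v = (\<lambda>p. kapply N a v p - kapply N b v p)"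
  by (simp add: kapply_def algebra_simps sum_subtractf)

lemma kapply_kmult: "kapply N (kmult N a b) v = kapply N a (kapply N b v)"
proof
  fix p
  have "kapply N (kmult N a b) v p = (\<Sum>q<N. \<Sum>r<N. a p r * b r q * v q)" by (simp add: kapply_def kmult_def sum_distrib_right)
  also have "\<dots> = (\<Sum>r<N. \<Sum>q<N. a p r * b r q * v q)" by (rule sum.swap)
  also have "\<dots> = kapply N a (kapply N b v) p" by (simp add: kapply_def sum_distrib_left mult.assoc)
  finally show "kapply N (kmult N a b) v p = kapply N a (kapply N b v) p" .
qed

lemma kapply_cong: "(\<And>q. q < N \<Longrightarrow> u q = v q) \<Longrightarrow> kapply N a u = kapply N a v"
  by (auto simp: kapply_def)

lemma inprod_kapply_adj: "inprod N u (kapply N a v) = inprod N (kapply N (adj a) u) v"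
proof -
  have "inprod N u (kapply N a v) = (\<Sum>p<N. \<Sum>q<N. cnj (u p) * a p q * v q)" by (simp add: inprod_def kapply_def sum_distrib_left mult.assoc)
  also have "\<dots> = (\<Sum>q<N. \<Sum>p<N. cnj (u p) * a p q * v q)" by (rule sum.swap)
  also have "\<dots> = inprod N (kapply N (adj a) u) v" by (simp add: inprod_def kapply_def adj_def sum_distrib_left sum_distrib_right mult_ac)
  finally show ?thesis .
qed

lemma adj_adj [simp]: "adj (adj a) = a" by (simp add: adj_def)

lemma vnorm_kapply_sq: "(vnorm N (kapply N a v))\<^sup>2 = Re (inprod N v (kapply N (kmult N (adj a) a) v))"
proof -
  have "inprod N v (kapply N (kmult N (adj a) a) v) = inprod N (kapply N a v) (kapply N a v)"
    using inprod_kapply_adj[of N v "adj a" "kapply N a v"] by (simp add: kapply_kmult)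
  then show ?thesis by (simp add: inprod_self)
qed

lemma op_boundedD: "op_bounded N a c \<Longrightarrow> vnorm N (kapply N a v) \<le> c * vnorm N v"
  by (simp add: op_bounded_def)

lemma op_bounded_mono: "op_bounded N a c \<Longrightarrow> c \<le> d \<Longrightarrow> op_bounded N a d"
  unfolding op_bounded_def by (meson mult_right_mono vnorm_nonneg order_trans)

lemma op_bounded_cong: "op_bounded N a c \<Longrightarrow> (\<And>p q. p < N \<Longrightarrow> q < N \<Longrightarrow> a p q = b p q) \<Longrightarrow> op_bounded N b c"
proof -
  assume a: "op_bounded N a c" and e: "\<And>p q. p < N \<Longrightarrow> q < N \<Longrightarrow> a p q = b p q"
  have "vnorm N (kapply N b v) = vnorm N (kapply N a v)" for v
    by (rule vnorm_cong) (simp add: kapply_def e)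
  then show ?thesis using a by (simp add: op_bounded_def)
qed

lemma op_bounded_add: "op_bounded N a c \<Longrightarrow> op_bounded N b d \<Longrightarrow> op_bounded N (\<lambda>p q. a p q + b p q) (c + d)"
  unfolding op_bounded_def kapply_add_left distrib_right by (blast intro: order_trans[OF vnorm_triangle] add_mono)

lemma op_bounded_diff: "op_bounded N a c \<Longrightarrow> op_bounded N b d \<Longrightarrow> op_bounded N (\<lambda>p q. a p q - b p q) (c + d)"
  unfolding op_bounded_def kapply_diff_left distrib_right by (blast intro: order_trans[OF vnorm_diff] add_mono)

lemma op_bounded_zero: "op_bounded N (\<lambda>p q. 0) 0" by (simp add: op_bounded_def kapply_def)

lemma op_bounded_sum: "finite I \<Longrightarrow> (\<And>i. i \<in> I \<Longrightarrow> op_bounded N (a i) (c i)) \<Longrightarrow> op_bounded N (\<lambda>p q. \<Sum>i\<in>I. a i p q) (\<Sum>i\<in>I. c i)"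
  by (induction I rule: finite_induct) (auto simp: op_bounded_zero intro: op_bounded_add)

lemma op_bounded_kmult: "op_bounded N a c \<Longrightarrow> op_bounded N b d \<Longrightarrow> 0 \<le> c \<Longrightarrow> op_bounded N (kmult N a b) (c * d)"
  unfolding op_bounded_def kapply_kmult by (metis (no_types, opaque_lifting) mult.assoc mult_left_mono order_trans)

lemma op_bounded_scale: "op_bounded N a c \<Longrightarrow> op_bounded N (\<lambda>p q. z * a p q) (cmod z * c)"
proof -
  assume a: "op_bounded N a c"
  have "kapply N (\<lambda>p q. z * a p q) v = (\<lambda>p. z * kapply N a v p)" for v by (simp add: kapply_def sum_distrib_left algebra_simps)
  then show ?thesis using a by (auto simp: op_bounded_def vnorm_scale mult.assoc intro!: mult_left_mono)
qed

lemma op_bounded_from_form: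
  assumes "0 \<le> c" "\<And>u v. cmod (inprod N u (kapply N a v)) \<le> c * vnorm N u * vnorm N v"
  shows "op_bounded N a c"
  unfolding op_bounded_def
proof
  fix v
  let ?x = "kapply N a v"
  have "vnorm N ?x * vnorm N ?x = cmod (inprod N ?x ?x)" by (simp add: inprod_self norm_power power2_eq_square norm_mult)
  also have "\<dots> \<le> c * vnorm N ?x * vnorm N v" by (rule assms(2))
  finally have "vnorm N ?x * vnorm N ?x \<le> vnorm N ?x * (c * vnorm N v)" by (simp add: algebra_simps)
  then show "vnorm N ?x \<le> c * vnorm N v" using assms(1)
    by (cases "vnorm N ?x = 0") (auto simp: mult_le_cancel_left_pos less_le)
qed

lemma op_bounded_adj: "op_bounded N a c \<Longrightarrow> 0 \<le> c \<Longrightarrow> op_bounded N (adj a) c"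
proof (rule op_bounded_from_form)
  fix u v assume a: "op_bounded N a c"
  have "cmod (inprod N u (kapply N (adj a) v)) = cmod (inprod N (kapply N a u) v)" using inprod_kapply_adj[of N u "adj a" v] by simp
  also have "\<dots> \<le> vnorm N (kapply N a u) * vnorm N v" by (rule Cauchy_Schwarz_inprod)
  also have "\<dots> \<le> c * vnorm N u * vnorm N v" using a by (intro mult_right_mono) (auto simp: op_bounded_def)
  finally show "cmod (inprod N u (kapply N (adj a) v)) \<le> c * vnorm N u * vnorm N v" .
qed

lemma vnorm_unit: "q < N \<Longrightarrow> vnorm N (\<lambda>i. if i = q then 1 else 0) = 1"
proof -
  assume q: "q < N"
  have e: "(cmod (if i = q then 1 else 0))\<^sup>2 = (if i = q then 1 else 0)" for i by simp
  have "(vnorm N (\<lambda>i. if i = q then 1 else 0))\<^sup>2 = 1" unfolding vnorm_sq e using q by simp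
  then show ?thesis using vnorm_nonneg[of N "\<lambda>i. if i = q then 1 else 0"] by (simp add: power2_eq_1_iff)
qed

lemma kapply_unit: "q < N \<Longrightarrow> kapply N a (\<lambda>i. if i = q then 1 else 0) = (\<lambda>i. a i q)"
proof -
  assume q: "q < N"
  have e: "a p i * (if i = q then 1 else 0) = (if i = q then a p i else 0)" for p i by simp
  show ?thesis unfolding kapply_def e using q by simp
qed

lemma op_bounded_col: "op_bounded N a c \<Longrightarrow> q < N \<Longrightarrow> vnorm N (\<lambda>p. a p q) \<le> c"
  using op_boundedD[of N a c "\<lambda>i. if i = q then 1 else 0"] by (simp add: vnorm_unit kapply_unit)

lemma op_bounded_entry: "op_bounded N a c \<Longrightarrow> p < N \<Longrightarrow> q < N \<Longrightarrow> cmod (a p q) \<le> c"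
  using member_le_L2_set[of "{..<N}" p "\<lambda>p. cmod (a p q)"] op_bounded_col[of N a c q]
  by (simp add: vnorm_def)

text \<open>A matrix that factors through a family of matrices \<open>T i\<close> by means of a row contraction \<open>U\<close> and a column
contraction \<open>V\<close> is bounded by the largest of the \<open>T i\<close>, each being tested only on the range of \<open>V i\<close>.
This replaces crude triangle inequalities whenever the number of pieces must not enter.\<close>

lemma op_bounded_compression:
  fixes U V :: "'i \<Rightarrow> (nat \<Rightarrow> complex) \<Rightarrow> nat \<Rightarrow> complex"
  assumes fin: "finite I" and c: "0 \<le> c"
    and form: "\<And>u v. inprod N u (kapply N a v) = (\<Sum>i\<in>I. inprod (k i) (U i u) (kapply (k i) (T i) (V i v)))"
    and U: "\<And>u. (\<Sum>i\<in>I. (vnorm (k i) (U i u))\<^sup>2) \<le> (vnorm N u)\<^sup>2"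
    and V: "\<And>v. (\<Sum>i\<in>I. (vnorm (k i) (V i v))\<^sup>2) \<le> (vnorm N v)\<^sup>2"
    and T: "\<And>i v. i \<in> I \<Longrightarrow> vnorm (k i) (kapply (k i) (T i) (V i v)) \<le> c * vnorm (k i) (V i v)"
  shows "op_bounded N a c"
proof (rule op_bounded_from_form[OF c])
  fix u v
  have "cmod (inprod N u (kapply N a v)) \<le> (\<Sum>i\<in>I. cmod (inprod (k i) (U i u) (kapply (k i) (T i) (V i v))))"
    unfolding form by (rule norm_sum)
  also have "\<dots> \<le> (\<Sum>i\<in>I. c * (\<bar>vnorm (k i) (U i u)\<bar> * \<bar>vnorm (k i) (V i v)\<bar>))"
  proof (rule sum_mono)
    fix i assume i: "i \<in> I"
    have "cmod (inprod (k i) (U i u) (kapply (k i) (T i) (V i v))) \<le> vnorm (k i) (U i u) * vnorm (k i) (kapply (k i) (T i) (V i v))"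
      by (rule Cauchy_Schwarz_inprod)
    also have "\<dots> \<le> vnorm (k i) (U i u) * (c * vnorm (k i) (V i v))" by (intro mult_left_mono T i) simp
    finally show "cmod (inprod (k i) (U i u) (kapply (k i) (T i) (V i v))) \<le> c * (\<bar>vnorm (k i) (U i u)\<bar> * \<bar>vnorm (k i) (V i v)\<bar>)"
      by (simp add: algebra_simps)
  qed
  also have "\<dots> = c * (\<Sum>i\<in>I. \<bar>vnorm (k i) (U i u)\<bar> * \<bar>vnorm (k i) (V i v)\<bar>)" by (simp add: sum_distrib_left)
  also have "\<dots> \<le> c * (L2_set (\<lambda>i. vnorm (k i) (U i u)) I * L2_set (\<lambda>i. vnorm (k i) (V i v)) I)"
    by (intro mult_left_mono L2_set_mult_ineq c)
  also have "\<dots> \<le> c * (vnorm N u * vnorm N v)"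
    using U[of u] V[of v] c
    by (intro mult_left_mono mult_mono) (auto simp: L2_set_def intro!: real_le_lsqrt sum_nonneg)
  finally show "cmod (inprod N u (kapply N a v)) \<le> c * vnorm N u * vnorm N v" by simp
qed

subsection \<open>Hilbert-Schmidt norm\<close>

text \<open>This is the Hilbert-Schmidt norm for the unnormalised trace.\<close>

definition frob :: "nat \<Rightarrow> (nat \<Rightarrow> nat \<Rightarrow> complex) \<Rightarrow> real" where
  "frob N a = L2_set (\<lambda>(p, q). cmod (a p q)) ({..<N} \<times> {..<N})"

lemma frob_sq: "(frob N a)\<^sup>2 = (\<Sum>p<N. \<Sum>q<N. (cmod (a p q))\<^sup>2)"
  by (simp add: frob_def L2_set_def sum_nonneg sum.cartesian_product split_def)

lemma frob_sq_cols: "(frob N a)\<^sup>2 = (\<Sum>q<N. (vnorm N (\<lambda>p. a p q))\<^sup>2)"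
  unfolding frob_sq vnorm_sq by (rule sum.swap)

lemma frob_sq_rows: "(frob N a)\<^sup>2 = (\<Sum>p<N. (vnorm N (a p))\<^sup>2)"
  unfolding frob_sq vnorm_sq ..

lemma frob_nonneg [simp]: "0 \<le> frob N a" by (simp add: frob_def)

lemma frob_triangle: "frob N (\<lambda>p q. a p q + b p q) \<le> frob N a + frob N b"
proof -
  have "frob N (\<lambda>p q. a p q + b p q) \<le> L2_set (\<lambda>x. (case x of (p,q) \<Rightarrow> cmod (a p q)) + (case x of (p,q) \<Rightarrow> cmod (b p q))) ({..<N} \<times> {..<N})"
    unfolding frob_def by (rule L2_set_mono) (auto intro: norm_triangle_ineq)
  also have "\<dots> \<le> frob N a + frob N b" unfolding frob_def by (rule L2_set_triangle_ineq)
  finally show ?thesis .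
qed

lemma frob_cong: "(\<And>p q. p < N \<Longrightarrow> q < N \<Longrightarrow> a p q = b p q) \<Longrightarrow> frob N a = frob N b"
  unfolding frob_def by (rule L2_set_cong) auto

lemma frob_adj: "frob N (adj a) = frob N a"
proof -
  have "(frob N (adj a))\<^sup>2 = (frob N a)\<^sup>2" unfolding frob_sq adj_def by simp (rule sum.swap)
  then show ?thesis by simp
qed

lemma frob_scale: "frob N (\<lambda>p q. z * a p q) = cmod z * frob N a"
proof -
  have "(frob N (\<lambda>p q. z * a p q))\<^sup>2 = (cmod z * frob N a)\<^sup>2"
    by (simp add: frob_sq power_mult_distrib norm_mult sum_distrib_left)
  then show ?thesis by (simp add: power2_eq_iff_nonneg)
qed

lemma frob_kmult_left: "op_bounded N a c \<Longrightarrow> 0 \<le> c \<Longrightarrow> frob N (kmult N a b) \<le> c * frob N b"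
proof -
  assume a: "op_bounded N a c" and c: "0 \<le> c"
  have "(frob N (kmult N a b))\<^sup>2 = (\<Sum>q<N. (vnorm N (kapply N a (\<lambda>p. b p q)))\<^sup>2)" by (simp add: frob_sq_cols kmult_def kapply_def)
  also have "\<dots> \<le> (\<Sum>q<N. (c * vnorm N (\<lambda>p. b p q))\<^sup>2)" using a by (intro sum_mono power_mono) (auto simp: op_bounded_def)
  also have "\<dots> = (c * frob N b)\<^sup>2" unfolding power_mult_distrib frob_sq_cols by (simp add: sum_distrib_left)
  finally show ?thesis by (rule power2_le_imp_le) (use c in simp)
qed

lemma adj_kmult: "adj (kmult N a b) = kmult N (adj b) (adj a)"
  by (simp add: adj_def kmult_def mult.commute)

lemma frob_kmult_right: "op_bounded N b c \<Longrightarrow> 0 \<le> c \<Longrightarrow> frob N (kmult N a b) \<le> c * frob N a"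
  using frob_kmult_left[of N "adj b" c "adj a"] op_bounded_adj[of N b c] frob_adj[of N "kmult N a b"] frob_adj[of N a]
  by (simp add: adj_kmult)

lemma frob_le_op_bounded: "op_bounded N a c \<Longrightarrow> 0 \<le> c \<Longrightarrow> frob N a \<le> c * sqrt N"
proof -
  assume a: "op_bounded N a c" and c: "0 \<le> c"
  have "(vnorm N (\<lambda>p. a p q))\<^sup>2 \<le> c\<^sup>2" if "q < N" for q
    using op_bounded_col[OF a that] by (simp add: power_mono)
  then have "(frob N a)\<^sup>2 \<le> (\<Sum>q<N. c\<^sup>2)" unfolding frob_sq_cols by (intro sum_mono) auto
  also have "\<dots> = (c * sqrt N)\<^sup>2" by (simp add: power_mult_distrib)
  finally show ?thesis by (rule power2_le_imp_le) (use c in simp)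
qed

subsection \<open>Norms and trace of a matrix in terms of its kernel\<close>

lemma ent_mat: "p < N \<Longrightarrow> q < N \<Longrightarrow> ent (Matrix.mat N N f) p q = f (p, q)"
  by (simp add: ent_def)

lemma index_mat_adjoint: "T \<in> carrier_mat N M \<Longrightarrow> i < M \<Longrightarrow> j < N \<Longrightarrow> mat_adjoint T $$ (i, j) = cnj (T $$ (j, i))"
  by (auto simp: mat_adjoint_def mat_of_rows_index)

lemma mat_adjoint_carrier: "T \<in> carrier_mat N M \<Longrightarrow> mat_adjoint T \<in> carrier_mat M N"
  by (auto simp: mat_adjoint_def mat_of_rows_def)

lemma ent_adjoint: "T \<in> carrier_mat N N \<Longrightarrow> p < N \<Longrightarrow> q < N \<Longrightarrow> ent (mat_adjoint T) p q = adj (ent T) p q"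
  by (simp add: ent_def adj_def index_mat_adjoint)

lemma ent_mult: "S \<in> carrier_mat N N \<Longrightarrow> T \<in> carrier_mat N N \<Longrightarrow> p < N \<Longrightarrow> q < N \<Longrightarrow> ent (S * T) p q = kmult N (ent S) (ent T) p q"
  by (auto simp: ent_def kmult_def scalar_prod_def atLeast0LessThan)

lemma ent_add: "T \<in> carrier_mat N N \<Longrightarrow> p < N \<Longrightarrow> q < N \<Longrightarrow> ent (S + T) p q = ent S p q + ent T p q"
  by (auto simp: ent_def)

lemma ent_diff: "T \<in> carrier_mat N N \<Longrightarrow> p < N \<Longrightarrow> q < N \<Longrightarrow> ent (S - T) p q = ent S p q - ent T p q"
  by (auto simp: ent_def)

lemma ent_smult: "T \<in> carrier_mat N N \<Longrightarrow> p < N \<Longrightarrow> q < N \<Longrightarrow> ent (c \<cdot>\<^sub>m T) p q = c * ent T p q"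
  by (auto simp: ent_def)

lemma vec_l2norm_eq: "v \<in> carrier_vec N \<Longrightarrow> vec_l2norm v = vnorm N (vec_index v)"
  by (auto simp: vec_l2norm_def vnorm_def)

lemma vec_l2norm_mult:
  assumes "T \<in> carrier_mat N N" "v \<in> carrier_vec N"
  shows "vec_l2norm (T *\<^sub>v v) = vnorm N (kapply N (ent T) (vec_index v))"
proof -
  have "vec_l2norm (T *\<^sub>v v) = vnorm N (vec_index (T *\<^sub>v v))" using assms by (intro vec_l2norm_eq) auto
  also have "\<dots> = vnorm N (kapply N (ent T) (vec_index v))"
    using assms by (intro vnorm_cong) (auto simp: kapply_def ent_def scalar_prod_def atLeast0LessThan)
  finally show ?thesis .
qed

lemma op_bounded_frob: "op_bounded N a (frob N a)"
proof -
  have "(vnorm N (kapply N a v))\<^sup>2 \<le> (frob N a * vnorm N v)\<^sup>2" for v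
  proof -
    have "(vnorm N (kapply N a v))\<^sup>2 \<le> (\<Sum>p<N. (vnorm N (a p) * vnorm N v)\<^sup>2)"
      unfolding vnorm_sq[of N "kapply N a v"]
    proof (intro sum_mono power_mono)
      fix p assume "p \<in> {..<N}"
      show "cmod (kapply N a v p) \<le> vnorm N (a p) * vnorm N v"
        using Cauchy_Schwarz_inprod[of N "\<lambda>q. cnj (a p q)" v] by (simp add: inprod_def kapply_def vnorm_def)
    qed simp
    also have "\<dots> = (frob N a * vnorm N v)\<^sup>2" unfolding power_mult_distrib frob_sq_rows by (simp add: sum_distrib_right)
    finally show ?thesis .
  qed
  then have "vnorm N (kapply N a v) \<le> frob N a * vnorm N v" for v by (rule power2_le_imp_le) simp
  then show ?thesis by (simp add: op_bounded_def)
qed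

lemma op_norm_le_iff:
  assumes T: "T \<in> carrier_mat N N" and c: "0 \<le> c"
  shows "op_norm T \<le> c \<longleftrightarrow> op_bounded N (ent T) c"
proof -
  let ?B = "{v \<in> carrier_vec (dim_col T). vec_l2norm v \<le> 1}"
  have B: "?B = {v \<in> carrier_vec N. vnorm N (vec_index v) \<le> 1}" using T by (auto simp: vec_l2norm_eq)
  have val: "vec_l2norm (T *\<^sub>v v) = vnorm N (kapply N (ent T) (vec_index v))" if "v \<in> ?B" for v
    using that T by (intro vec_l2norm_mult) auto
  have ne: "0\<^sub>v N \<in> ?B" using T by (auto simp: vec_l2norm_def L2_set_def)
  have le: "vec_l2norm (T *\<^sub>v v) \<le> d" if "op_bounded N (ent T) d" "0 \<le> d" "v \<in> ?B" for d v
  proof -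
    have "vnorm N (kapply N (ent T) (vec_index v)) \<le> d * vnorm N (vec_index v)" using that(1) by (rule op_boundedD)
    also have "\<dots> \<le> d * 1" using that(2,3) unfolding B by (intro mult_left_mono) auto
    finally show ?thesis using val[OF that(3)] by simp
  qed
  show ?thesis
  proof
    assume "op_bounded N (ent T) c"
    then show "op_norm T \<le> c" unfolding op_norm_def using ne le c by (intro cSUP_least) blast+
  next
    assume op: "op_norm T \<le> c"
    have bdd: "bdd_above ((\<lambda>v. vec_l2norm (T *\<^sub>v v)) ` ?B)"
      using le[OF op_bounded_frob] by (intro bdd_aboveI2) auto
    show "op_bounded N (ent T) c" unfolding op_bounded_def
    proof
      fix v
      show "vnorm N (kapply N (ent T) v) \<le> c * vnorm N v"
      proof (cases "vnorm N v = 0")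
        case True
        then have "kapply N (ent T) v = kapply N (ent T) (\<lambda>p. 0)" by (intro kapply_cong) (simp add: vnorm_eq_0)
        then show ?thesis using True by (simp add: kapply_def)
      next
        case False
        then have pos: "vnorm N v > 0" using vnorm_nonneg[of N v] by linarith
        define w where "w = Matrix.vec N (\<lambda>i. complex_of_real (1 / vnorm N v) * v i)"
        have w: "vnorm N (vec_index w) = vnorm N (\<lambda>i. complex_of_real (1 / vnorm N v) * v i)"
          by (rule vnorm_cong) (simp add: w_def)
        have wB: "w \<in> ?B" unfolding B using pos w unfolding vnorm_scale by (simp add: w_def norm_divide)
        have "vec_l2norm (T *\<^sub>v w) \<le> c" using cSUP_upper[OF wB bdd] op by (simp add: op_norm_def)
        moreover have "kapply N (ent T) (vec_index w) = kapply N (ent T) (\<lambda>i. complex_of_real (1 / vnorm N v) * v i)"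
          by (rule kapply_cong) (simp add: w_def)
        ultimately have "cmod (complex_of_real (1 / vnorm N v)) * vnorm N (kapply N (ent T) v) \<le> c"
          using val[OF wB] by (simp only: kapply_scale_right vnorm_scale)
        then show ?thesis using pos by (simp add: norm_divide divide_simps mult.commute)
      qed
    qed
  qed
qed

lemma op_norm_nonneg:
  assumes T: "T \<in> carrier_mat N N"
  shows "0 \<le> op_norm T"
proof -
  let ?B = "{v \<in> carrier_vec (dim_col T). vec_l2norm v \<le> 1}"
  have ne: "0\<^sub>v N \<in> ?B" using T by (auto simp: vec_l2norm_def L2_set_def)
  have "bdd_above ((\<lambda>v. vec_l2norm (T *\<^sub>v v)) ` ?B)"
  proof (rule bdd_aboveI2)
    fix v assume v: "v \<in> ?B"
    then have "vec_l2norm (T *\<^sub>v v) = vnorm N (kapply N (ent T) (vec_index v))" using T by (intro vec_l2norm_mult) auto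
    also have "\<dots> \<le> frob N (ent T) * vnorm N (vec_index v)" using op_bounded_frob by (rule op_boundedD)
    also have "\<dots> \<le> frob N (ent T) * 1" using v T by (intro mult_left_mono) (auto simp: vec_l2norm_eq)
    finally show "vec_l2norm (T *\<^sub>v v) \<le> frob N (ent T)" by simp
  qed
  then have "vec_l2norm (T *\<^sub>v 0\<^sub>v N) \<le> op_norm T" unfolding op_norm_def using ne by (intro cSUP_upper)
  then show ?thesis by (simp add: vec_l2norm_def order_trans[OF L2_set_nonneg])
qed

lemma op_bounded_op_norm: "T \<in> carrier_mat N N \<Longrightarrow> op_bounded N (ent T) (op_norm T)"
  using op_norm_le_iff op_norm_nonneg by blast

lemma mat_tr_eq: "T \<in> carrier_mat N N \<Longrightarrow> mat_tr T = (\<Sum>p<N. ent T p p) / of_nat N"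
  by (auto simp: mat_tr_def ent_def)

lemma hs_norm_eq:
  assumes "T \<in> carrier_mat N N"
  shows "hs_norm T = frob N (ent T) / sqrt N"
proof -
  have c: "mat_adjoint T * T \<in> carrier_mat N N"
    by (rule mult_carrier_mat[OF mat_adjoint_carrier[OF assms] assms])
  have "(\<Sum>p<N. ent (mat_adjoint T * T) p p) = (\<Sum>p<N. \<Sum>r<N. complex_of_real ((cmod (ent T r p))\<^sup>2))"
    using assms mat_adjoint_carrier[OF assms]
    by (intro sum.cong refl) (simp add: ent_mult kmult_def ent_adjoint adj_def complex_norm_square mult.commute flip: of_real_power)
  also have "\<dots> = complex_of_real ((frob N (ent T))\<^sup>2)" unfolding frob_sq by (subst sum.swap) simp
  finally have "mat_tr (mat_adjoint T * T) = complex_of_real ((frob N (ent T))\<^sup>2 / N)" by (simp add: mat_tr_eq[OF c])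
  then show ?thesis by (simp add: hs_norm_def real_sqrt_divide)
qed

section \<open>Orthonormal families\<close>

definition orthonormal :: "nat \<Rightarrow> nat \<Rightarrow> (nat \<Rightarrow> nat \<Rightarrow> complex) \<Rightarrow> bool" where
  "orthonormal N d e \<longleftrightarrow> (\<forall>i<d. \<forall>j<d. inprod N (e i) (e j) = (if i = j then 1 else 0))"

text \<open>Membership in the linear span of the family, expressed through the double orthogonal complement.\<close>

definition spans :: "nat \<Rightarrow> nat \<Rightarrow> (nat \<Rightarrow> nat \<Rightarrow> complex) \<Rightarrow> (nat \<Rightarrow> complex) \<Rightarrow> bool" where
  "spans N d e y \<longleftrightarrow> (\<forall>w. (\<forall>i<d. inprod N (e i) w = 0) \<longrightarrow> inprod N y w = 0)"

definition proj :: "nat \<Rightarrow> nat \<Rightarrow> (nat \<Rightarrow> nat \<Rightarrow> complex) \<Rightarrow> (nat \<Rightarrow> complex) \<Rightarrow> nat \<Rightarrow> complex" where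
  "proj N d e y = (\<lambda>p. \<Sum>i<d. inprod N (e i) y * e i p)"

lemma inprod_proj: "orthonormal N d e \<Longrightarrow> j < d \<Longrightarrow> inprod N (e j) (proj N d e y) = inprod N (e j) y"
  unfolding proj_def inprod_sum_right inprod_scale_right by (simp add: orthonormal_def if_distrib[of "\<lambda>x. _ * x"] cong: if_cong)

lemma inprod_residual: "orthonormal N d e \<Longrightarrow> j < d \<Longrightarrow> inprod N (e j) (\<lambda>p. y p - proj N d e y p) = 0"
  by (simp add: inprod_diff_right inprod_proj)

lemma residual_norm:
  assumes e: "orthonormal N d e"
  shows "(vnorm N y)\<^sup>2 = (vnorm N (\<lambda>p. y p - proj N d e y p))\<^sup>2 + (\<Sum>i<d. (cmod (inprod N (e i) y))\<^sup>2)"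
proof -
  let ?r = "\<lambda>p. y p - proj N d e y p"
  have a: "inprod N (proj N d e y) ?r = 0"
    using inprod_residual[OF e] by (simp add: proj_def[of N d e y] inprod_sum_left inprod_scale_left) (simp add: proj_def)
  have b: "inprod N (proj N d e y) y = complex_of_real (\<Sum>i<d. (cmod (inprod N (e i) y))\<^sup>2)"
    unfolding proj_def inprod_sum_left inprod_scale_left by (simp add: complex_norm_square mult.commute flip: of_real_power)
  have "inprod N y y = inprod N ?r ?r + inprod N (proj N d e y) ?r + inprod N y (proj N d e y)"
    by (simp add: inprod_diff_left inprod_diff_right)
  also have "inprod N y (proj N d e y) = cnj (inprod N (proj N d e y) y)" by (simp add: inprod_cnj)
  finally have "complex_of_real ((vnorm N y)\<^sup>2) = complex_of_real ((vnorm N ?r)\<^sup>2 + (\<Sum>i<d. (cmod (inprod N (e i) y))\<^sup>2))"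
    by (simp add: a b inprod_self)
  then show ?thesis by (simp only: of_real_eq_iff)
qed

lemma Bessel: "orthonormal N d e \<Longrightarrow> (\<Sum>i<d. (cmod (inprod N (e i) y))\<^sup>2) \<le> (vnorm N y)\<^sup>2"
  using residual_norm[of N d e y] by simp

lemma orthonormal_vnorm: "orthonormal N d e \<Longrightarrow> i < d \<Longrightarrow> vnorm N (e i) = 1"
proof -
  assume "orthonormal N d e" "i < d"
  then have "complex_of_real ((vnorm N (e i))\<^sup>2) = complex_of_real 1" unfolding inprod_self[symmetric] by (simp add: orthonormal_def)
  then have "(vnorm N (e i))\<^sup>2 = 1" by (simp only: of_real_eq_iff)
  then show ?thesis using vnorm_nonneg[of N "e i"] by (simp add: power2_eq_1_iff)
qed

lemma inprod_unit_right: "p < N \<Longrightarrow> inprod N u (\<lambda>i. if i = p then 1 else 0) = cnj (u p)"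
  by (simp add: inprod_def if_distrib[of "\<lambda>x. _ * x"] cong: if_cong)

lemma orthonormal_total: "orthonormal N d e \<Longrightarrow> (\<Sum>p<N. \<Sum>i<d. (cmod (e i p))\<^sup>2) = d"
proof -
  assume e: "orthonormal N d e"
  have "(\<Sum>p<N. \<Sum>i<d. (cmod (e i p))\<^sup>2) = (\<Sum>i<d. (vnorm N (e i))\<^sup>2)" unfolding vnorm_sq by (rule sum.swap)
  also have "\<dots> = d" using orthonormal_vnorm[OF e] by simp
  finally show ?thesis .
qed

lemma orthonormal_row_le: "orthonormal N d e \<Longrightarrow> p < N \<Longrightarrow> (\<Sum>i<d. (cmod (e i p))\<^sup>2) \<le> 1"
  using Bessel[of N d e "\<lambda>i. if i = p then 1 else 0"] by (simp add: inprod_unit_right vnorm_unit)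

lemma orthonormal_le: "orthonormal N d e \<Longrightarrow> d \<le> N"
proof -
  assume e: "orthonormal N d e"
  have "real d \<le> (\<Sum>p<N. 1)" unfolding orthonormal_total[OF e, symmetric] using orthonormal_row_le[OF e] by (intro sum_mono) auto
  then show ?thesis by simp
qed

lemma spans_mono: "spans N d e y \<Longrightarrow> d \<le> d' \<Longrightarrow> (\<And>i. i < d \<Longrightarrow> e' i = e i) \<Longrightarrow> spans N d' e' y"
  unfolding spans_def by (metis order_less_le_trans)

lemma orthonormal_Suc:
  assumes e: "orthonormal N d e" and u: "vnorm N u = 1" "\<And>i. i < d \<Longrightarrow> inprod N (e i) u = 0"
  shows "orthonormal N (Suc d) (e(d := u))"
proof -
  have uu: "inprod N u u = 1" by (simp add: inprod_self u)
  have ue: "inprod N u (e i) = 0" if "i < d" for i using u(2)[OF that] inprod_cnj[of N "e i" u] by simp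
  show ?thesis using e u(2) uu ue by (auto simp: orthonormal_def less_Suc_eq)
qed

text \<open>One Gram-Schmidt step.\<close>

lemma extend_to_span:
  assumes e: "orthonormal N d e"
  shows "\<exists>d' e'. orthonormal N d' e' \<and> d \<le> d' \<and> d' \<le> d + 1 \<and> (\<forall>i<d. e' i = e i) \<and> spans N d' e' y"
proof -
  define r where "r = (\<lambda>p. y p - proj N d e y p)"
  have er: "inprod N (e i) r = 0" if "i < d" for i using inprod_residual[OF e that] by (simp add: r_def)
  have y: "y = (\<lambda>p. r p + proj N d e y p)" by (simp add: r_def)
  have yw: "inprod N y w = inprod N r w" if "\<forall>i<d. inprod N (e i) w = 0" for w
  proof -
    have "inprod N r w = inprod N y w - inprod N (proj N d e y) w" by (simp add: r_def inprod_diff_left)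
    moreover have "inprod N (proj N d e y) w = 0" using that by (simp add: proj_def inprod_sum_left inprod_scale_left)
    ultimately show ?thesis by simp
  qed
  show ?thesis
  proof (cases "vnorm N r = 0")
    case True
    then have "inprod N r w = 0" for w by (simp add: vnorm_eq_0 inprod_def)
    then have "spans N d e y" using yw by (simp add: spans_def)
    then show ?thesis using e by (intro exI[of _ d] exI[of _ e]) simp
  next
    case False
    define u where "u = (\<lambda>p. complex_of_real (1 / vnorm N r) * r p)"
    have u1: "vnorm N u = 1" using False vnorm_nonneg[of N r] unfolding u_def vnorm_scale by (simp add: norm_divide)
    have ru: "r = (\<lambda>p. complex_of_real (vnorm N r) * u p)" using False by (simp add: u_def)
    have "orthonormal N (Suc d) (e(d := u))"
      using u1 er by (intro orthonormal_Suc[OF e]) (auto simp: u_def inprod_scale_right simp del: of_real_divide)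
    moreover have "spans N (Suc d) (e(d := u)) y" unfolding spans_def
    proof (intro allI impI)
      fix w assume w: "\<forall>i<Suc d. inprod N ((e(d := u)) i) w = 0"
      then have "inprod N u w = 0" "\<forall>i<d. inprod N (e i) w = 0" by (auto simp: less_Suc_eq)
      then have "inprod N r w = 0" by (subst ru) (simp only: inprod_scale_left, simp)
      then show "inprod N y w = 0" using yw[of w] \<open>\<forall>i<d. inprod N (e i) w = 0\<close> by simp
    qed
    ultimately show ?thesis by (intro exI[of _ "Suc d"] exI[of _ "e(d := u)"]) simp
  qed
qed

lemma extend_to_span_list:
  assumes "orthonormal N d e"
  shows "\<exists>d' e'. orthonormal N d' e' \<and> d \<le> d' \<and> d' \<le> d + length ys \<and> (\<forall>i<d. e' i = e i) \<and> (\<forall>y\<in>set ys. spans N d' e' y)"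
proof (induction ys)
  case Nil then show ?case using assms by (intro exI[of _ d] exI[of _ e]) simp
next
  case (Cons y ys)
  then obtain d1 e1 where 1: "orthonormal N d1 e1" "d \<le> d1" "d1 \<le> d + length ys" "\<forall>i<d. e1 i = e i" "\<forall>y\<in>set ys. spans N d1 e1 y" by blast
  obtain d2 e2 where 2: "orthonormal N d2 e2" "d1 \<le> d2" "d2 \<le> d1 + 1" "\<forall>i<d1. e2 i = e1 i" "spans N d2 e2 y"
    using extend_to_span[OF 1(1)] by blast
  have "\<forall>z\<in>set (y # ys). spans N d2 e2 z" using 1 2 spans_mono[of N d1 e1 _ d2 e2] by auto
  then show ?case using 1 2 by (intro exI[of _ d2] exI[of _ e2]) auto
qed

text \<open>Once the standard basis vectors lie in the span, each row of the family has norm \<open>1\<close>; summing over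
rows shows that the family has \<open>N\<close> members.\<close>

lemma complete_basis:
  assumes "orthonormal N d e"
  shows "\<exists>e'. orthonormal N N e' \<and> (\<forall>i<d. e' i = e i)"
proof -
  let ?u = "\<lambda>p i. if i = p then 1 else 0 :: complex"
  obtain d' e' where 1: "orthonormal N d' e'" "\<forall>i<d. e' i = e i" "\<forall>y\<in>set (map ?u [0..<N]). spans N d' e' y"
    using extend_to_span_list[OF assms, of "map ?u [0..<N]"] by blast
  have row: "(\<Sum>i<d'. (cmod (e' i p))\<^sup>2) = 1" if p: "p < N" for p
  proof -
    let ?r = "\<lambda>i. ?u p i - proj N d' e' (?u p) i"
    have r: "inprod N (e' i) ?r = 0" if "i < d'" for i using inprod_residual[OF 1(1) that] .
    have "cnj (?r q) = 0" if "q < N" for q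
    proof -
      have "spans N d' e' (?u q)" using 1(3) that by auto
      then have "inprod N (?u q) ?r = 0" using r unfolding spans_def by blast
      then have "inprod N ?r (?u q) = 0" using inprod_cnj[of N "?u q" ?r] by simp
      then show ?thesis using inprod_unit_right[OF that, of ?r] by simp
    qed
    then have "vnorm N ?r = 0" by (simp add: vnorm_eq_0)
    then show ?thesis using residual_norm[OF 1(1), of "?u p"] p by (simp add: inprod_unit_right vnorm_unit)
  qed
  have "real d' = N" unfolding orthonormal_total[OF 1(1), symmetric] using row by simp
  then show ?thesis using 1 by auto
qed

lemma orthonormal_rows:
  assumes e: "orthonormal N N e" and p: "p < N" "q < N"
  shows "(\<Sum>i<N. cnj (e i p) * e i q) = (if p = q then 1 else 0)"
proof -
  let ?u = "\<lambda>p i. if i = p then 1 else 0 :: complex"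
  have "(\<Sum>p<N. 1 - (\<Sum>i<N. (cmod (e i p))\<^sup>2)) = 0" using orthonormal_total[OF e] by (simp add: sum_subtractf)
  then have "1 - (\<Sum>i<N. (cmod (e i p))\<^sup>2) = 0"
    using sum_nonneg_eq_0_iff[of "{..<N}" "\<lambda>p. 1 - (\<Sum>i<N. (cmod (e i p))\<^sup>2)"] orthonormal_row_le[OF e] p by auto
  then have "(vnorm N (\<lambda>i. ?u p i - proj N N e (?u p) i))\<^sup>2 = 0"
    using residual_norm[OF e, of "?u p"] p by (simp add: inprod_unit_right vnorm_unit)
  then have "?u p q = proj N N e (?u p) q" using p by (simp add: vnorm_eq_0)
  moreover have "proj N N e (?u p) q = (\<Sum>i<N. cnj (e i p) * e i q)" using p by (simp add: proj_def inprod_unit_right)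
  ultimately show ?thesis by (cases "p = q") auto
qed

lemma expand_basis:
  assumes e: "orthonormal N N e" and q: "q < N"
  shows "v q = (\<Sum>i<N. inprod N (e i) v * e i q)"
proof -
  have "(\<Sum>i<N. inprod N (e i) v * e i q) = (\<Sum>i<N. \<Sum>p<N. v p * (cnj (e i p) * e i q))"
    by (simp add: inprod_def sum_distrib_right sum_distrib_left mult_ac)
  also have "\<dots> = (\<Sum>p<N. \<Sum>i<N. v p * (cnj (e i p) * e i q))" by (rule sum.swap)
  also have "\<dots> = (\<Sum>p<N. v p * (if p = q then 1 else 0))"
    by (intro sum.cong refl) (simp add: orthonormal_rows[OF e _ q] sum_distrib_left[symmetric])
  also have "\<dots> = v q" using q by (simp add: if_distrib[of "\<lambda>x. _ * x"] cong: if_cong)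
  finally show ?thesis by simp
qed

subsection \<open>Maximal orthonormal families of exceptional vectors\<close>

text \<open>Applied to the predicate of being badly behaved, this produces a subspace off which no vector is bad,
and whose dimension can be bounded because it has an orthonormal basis of bad vectors.\<close>

lemma greedy_family:
  "\<exists>d e. orthonormal N d e \<and> (\<forall>i<d. Q (e i)) \<and> (\<forall>v. vnorm N v = 1 \<longrightarrow> (\<forall>i<d. inprod N (e i) v = 0) \<longrightarrow> \<not> Q v)"
proof -
  define D where "D = {d. \<exists>e. orthonormal N d e \<and> (\<forall>i<d. Q (e i))}"
  have "0 \<in> D" by (auto simp: D_def orthonormal_def)
  moreover have "D \<subseteq> {..N}" using orthonormal_le by (auto simp: D_def)
  ultimately have m: "Max D \<in> D" and up: "\<And>d. d \<in> D \<Longrightarrow> d \<le> Max D"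
    using finite_subset[of D "{..N}"] Max_in[of D] Max_ge[of D] by blast+
  then obtain e where e: "orthonormal N (Max D) e" "\<forall>i<Max D. Q (e i)" by (auto simp: D_def)
  have "\<not> Q v" if v: "vnorm N v = 1" "\<forall>i<Max D. inprod N (e i) v = 0" for v
  proof
    assume "Q v"
    then have "\<forall>i<Suc (Max D). Q ((e(Max D := v)) i)" using e(2) by (simp add: less_Suc_eq)
    moreover have "orthonormal N (Suc (Max D)) (e(Max D := v))" using orthonormal_Suc[OF e(1) v(1)] v(2) by blast
    ultimately have "\<exists>e. orthonormal N (Suc (Max D)) e \<and> (\<forall>i<Suc (Max D). Q (e i))" by blast
    then have "Suc (Max D) \<in> D" by (simp only: D_def mem_Collect_eq)
    then show False using up[of "Suc (Max D)"] by simp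
  qed
  then show ?thesis using e by blast
qed

text \<open>Bessel's inequality, applied to each row of the matrix.\<close>

lemma orthonormal_sum_kapply_le_frob:
  assumes e: "orthonormal N d e"
  shows "(\<Sum>i<d. (vnorm N (kapply N a (e i)))\<^sup>2) \<le> (frob N a)\<^sup>2"
proof -
  have "(\<Sum>i<d. (vnorm N (kapply N a (e i)))\<^sup>2) = (\<Sum>p<N. \<Sum>i<d. (cmod (kapply N a (e i) p))\<^sup>2)"
    unfolding vnorm_sq by (rule sum.swap)
  also have "\<dots> \<le> (\<Sum>p<N. (vnorm N (a p))\<^sup>2)"
  proof (rule sum_mono)
    fix p
    have "cmod (kapply N a (e i) p) = cmod (inprod N (e i) (\<lambda>q. cnj (a p q)))" for i
    proof -
      have "kapply N a (e i) p = cnj (inprod N (e i) (\<lambda>q. cnj (a p q)))" by (simp add: kapply_def inprod_def mult.commute)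
      then show ?thesis by simp
    qed
    then have "(\<Sum>i<d. (cmod (kapply N a (e i) p))\<^sup>2) \<le> (vnorm N (\<lambda>q. cnj (a p q)))\<^sup>2" using Bessel[OF e] by simp
    then show "(\<Sum>i<d. (cmod (kapply N a (e i) p))\<^sup>2) \<le> (vnorm N (a p))\<^sup>2" by (simp add: vnorm_def)
  qed
  finally show ?thesis by (simp add: frob_sq_rows)
qed

subsection \<open>Adapted flags and block-tridiagonal form\<close>

text \<open>The dimensions \<open>l m\<close> grow at most geometrically since step \<open>m\<close> adds the images of \<open>l m\<close> vectors
under each matrix of the list.\<close>

lemma flag:
  fixes As :: "(nat \<Rightarrow> nat \<Rightarrow> complex) list"
  assumes "orthonormal N d e"
  shows "\<exists>e' l. orthonormal N (l M) e' \<and> l 0 = d \<and> mono l \<and> (\<forall>m. l (Suc m) \<le> (1 + length As) * l m) \<and> (\<forall>i<d. e' i = e i) \<and>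
     (\<forall>m<M. \<forall>A\<in>set As. \<forall>i<l m. spans N (l (Suc m)) e' (kapply N A (e' i)))"
proof (induction M)
  case 0
  have "mono (\<lambda>m::nat. d)" by (simp add: mono_def)
  then show ?case using assms by (intro exI[of _ e] exI[of _ "\<lambda>m. d"]) auto
next
  case (Suc M)
  then obtain e1 l where 1: "orthonormal N (l M) e1" "l 0 = d" "mono l" "\<forall>m. l (Suc m) \<le> (1 + length As) * l m" "\<forall>i<d. e1 i = e i"
     "\<forall>m<M. \<forall>A\<in>set As. \<forall>i<l m. spans N (l (Suc m)) e1 (kapply N A (e1 i))" by blast
  define ys where "ys = concat (map (\<lambda>A. map (\<lambda>i. kapply N A (e1 i)) [0..<l M]) As)"
  have len: "length ys = length As * l M" unfolding ys_def by (induction As) auto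
  obtain d' e' where 2: "orthonormal N d' e'" "l M \<le> d'" "d' \<le> l M + length ys" "\<forall>i<l M. e' i = e1 i" "\<forall>y\<in>set ys. spans N d' e' y"
    using extend_to_span_list[OF 1(1)] by blast
  define l' where "l' = (\<lambda>m. if m \<le> M then l m else d')"
  have lM: "l m \<le> l M" if "m \<le> M" for m using 1(3) that by (simp add: mono_def)
  have dM: "d \<le> l M" using lM[of 0] 1(2) by simp
  have "mono l'" using 2(2) lM 1(3) by (auto simp: mono_def l'_def intro: order_trans)
  moreover have "l' (Suc m) \<le> (1 + length As) * l' m" for m
  proof -
    consider "m < M" | "m = M" | "m > M" by linarith
    then show ?thesis using 1(4) 2(3) by cases (auto simp: l'_def len)
  qed
  moreover have "spans N (l' (Suc m)) e' (kapply N A (e' i))" if "m < Suc M" "A \<in> set As" "i < l' m" for m A i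
  proof -
    have i: "i < l M" using that lM[of m] by (auto simp: l'_def)
    then have e': "e' i = e1 i" using 2 by auto
    show ?thesis
    proof (cases "m = M")
      case True
      have "kapply N A (e1 i) \<in> set ys" unfolding ys_def set_concat set_map using that(2) i
        by (intro UN_I[of "map (\<lambda>i. kapply N A (e1 i)) [0..<l M]"] imageI) auto
      then show ?thesis using 2 e' True by (auto simp: l'_def)
    next
      case False
      then have m: "m < M" "Suc m \<le> M" using that by auto
      have "spans N (l (Suc m)) e1 (kapply N A (e1 i))" using 1(6) m that by (auto simp: l'_def)
      then have "spans N (l (Suc m)) e' (kapply N A (e1 i))" by (rule spans_mono) (use 2(4) lM[OF m(2)] in auto)
      then show ?thesis using e' m by (simp add: l'_def)
    qed
  qed
  ultimately show ?case using 1 2 dM by (intro exI[of _ e'] exI[of _ l']) (auto simp: l'_def)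
qed

definition conj_basis :: "nat \<Rightarrow> (nat \<Rightarrow> nat \<Rightarrow> complex) \<Rightarrow> (nat \<Rightarrow> nat \<Rightarrow> complex) \<Rightarrow> nat \<Rightarrow> nat \<Rightarrow> complex" where
  "conj_basis N e A = (\<lambda>i j. inprod N (e i) (kapply N A (e j)))"

text \<open>A matrix maps \<open>V\<^sub>m\<close> into \<open>V\<^sub>m\<^sub>+\<^sub>1\<close>, and so does its adjoint; hence it connects only neighbouring layers of the
flag.  The layer \<open>g i\<close> of the basis vector \<open>e i\<close> is the least \<open>m\<close> with \<open>e i \<in> V\<^sub>m\<close>, or \<open>M + 1\<close>.\<close>

lemma block_tridiagonal:
  fixes As :: "(nat \<Rightarrow> nat \<Rightarrow> complex) list"
  assumes bad: "orthonormal N d e0"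
  shows "\<exists>e g. orthonormal N N e \<and> (\<forall>i<d. e i = e0 i) \<and> (\<forall>i. g i = 0 \<longleftrightarrow> i < d) \<and> (\<forall>i. g i \<le> Suc M) \<and>
     card {i. g i \<le> M} \<le> (1 + 2 * length As) ^ M * d \<and> finite {i. g i \<le> M} \<and>
     (\<forall>A\<in>set As. \<forall>i<N. \<forall>j<N. conj_basis N e A i j \<noteq> 0 \<longrightarrow> g i \<le> g j + 1 \<and> g j \<le> g i + 1)"
proof -
  let ?Bs = "As @ map adj As"
  obtain e1 l where 1: "orthonormal N (l M) e1" "l 0 = d" "mono l" "\<forall>m. l (Suc m) \<le> (1 + length ?Bs) * l m" "\<forall>i<d. e1 i = e0 i"
     "\<forall>m<M. \<forall>A\<in>set ?Bs. \<forall>i<l m. spans N (l (Suc m)) e1 (kapply N A (e1 i))"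
    using flag[OF bad, of M ?Bs] by (elim exE conjE) (rule that; assumption)
  obtain e where e: "orthonormal N N e" "\<forall>i<l M. e i = e1 i" using complete_basis[OF 1(1)] by blast
  have lmono: "l m \<le> l m'" if "m \<le> m'" for m m' using 1(3) that by (simp add: mono_def)
  define g where "g = (\<lambda>i. card {m. m \<le> M \<and> l m \<le> i})"
  have g_le: "g i \<le> m \<longleftrightarrow> i < l m" if "m \<le> M" for i m
  proof
    assume "i < l m"
    have "{m'. m' \<le> M \<and> l m' \<le> i} \<subseteq> {..<m}"
    proof
      fix m' assume m': "m' \<in> {m'. m' \<le> M \<and> l m' \<le> i}"
      have "\<not> m \<le> m'" using lmono[of m m'] m' \<open>i < l m\<close> by auto
      then show "m' \<in> {..<m}" by simp
    qed
    then show "g i \<le> m" unfolding g_def using card_mono[of "{..<m}" "{m'. m' \<le> M \<and> l m' \<le> i}"] by simp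
  next
    assume "g i \<le> m"
    show "i < l m"
    proof (rule ccontr)
      assume "\<not> i < l m"
      then have "{..m} \<subseteq> {m'. m' \<le> M \<and> l m' \<le> i}" using that lmono[of _ m] by (fastforce simp: not_less)
      moreover have "finite {m'. m' \<le> M \<and> l m' \<le> i}" by (rule finite_subset[of _ "{..M}"]) auto
      ultimately have "Suc m \<le> g i" unfolding g_def using card_mono[of "{m'. m' \<le> M \<and> l m' \<le> i}" "{..m}"] by simp
      then show False using \<open>g i \<le> m\<close> by simp
    qed
  qed
  have gM: "g i \<le> Suc M" for i
    unfolding g_def using card_mono[of "{..M}" "{m. m \<le> M \<and> l m \<le> i}"] by auto
  have l: "l m \<le> (1 + 2 * length As) ^ m * d" for m
  proof (induction m)
    case (Suc m)
    have "l (Suc m) \<le> (1 + 2 * length As) * l m" using 1(4) by (simp add: mult_2)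
    also have "\<dots> \<le> (1 + 2 * length As) * ((1 + 2 * length As) ^ m * d)" by (rule mult_le_mono2[OF Suc])
    finally show ?case by (simp only: power_Suc mult.assoc)
  qed (simp add: 1(2))
  have band: "g i \<le> g j + 1" if A: "A \<in> set ?Bs" and ij: "i < N" "j < N" "conj_basis N e A i j \<noteq> 0" for A i j
  proof (rule ccontr)
    assume "\<not> g i \<le> g j + 1"
    then have gj: "g j < M" "Suc (g j) < g i" using gM[of i] by auto
    have j: "j < l (g j)" using g_le[of "g j" j] gj by simp
    have jM: "j < l M" using j lmono[of "g j" M] gj by simp
    have "\<not> i < l (Suc (g j))" using g_le[of "Suc (g j)" i] gj by simp
    moreover have "spans N (l (Suc (g j))) e1 (kapply N A (e1 j))" using 1(6) gj(1) A j by blast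
    moreover have "inprod N (e1 i') (e i) = 0" if "i' < l (Suc (g j))" for i'
    proof -
      have "i' < l M" using that lmono[of "Suc (g j)" M] gj by simp
      then have "i' < N" "e1 i' = e i'" using orthonormal_le[OF 1(1)] e(2) by auto
      moreover have "i' \<noteq> i" using that \<open>\<not> i < l (Suc (g j))\<close> by auto
      ultimately show ?thesis using e(1) ij(1) by (simp add: orthonormal_def)
    qed
    ultimately have "inprod N (kapply N A (e1 j)) (e i) = 0" unfolding spans_def by blast
    then have "inprod N (e i) (kapply N A (e j)) = 0" using e(2) jM inprod_cnj[of N "kapply N A (e1 j)" "e i"] by simp
    then show False using ij by (simp add: conj_basis_def)
  qed
  have "g i \<le> g j + 1 \<and> g j \<le> g i + 1" if "A \<in> set As" "i < N" "j < N" "conj_basis N e A i j \<noteq> 0" for A i j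
  proof
    show "g i \<le> g j + 1" using band that by auto
    have "conj_basis N e (adj A) j i = cnj (conj_basis N e A i j)"
      unfolding conj_basis_def inprod_kapply_adj[of N "e j" "adj A"] adj_adj by (simp add: inprod_cnj)
    then show "g j \<le> g i + 1" using band[of "adj A" j i] that by auto
  qed
  moreover have "{i. g i \<le> M} = {..<l M}" using g_le by auto
  moreover have "g i = 0 \<longleftrightarrow> i < d" for i using g_le[of 0 i] 1(2) by simp
  moreover have "d \<le> l M" using lmono[of 0 M] 1(2) by simp
  ultimately show ?thesis using e 1(5) gM l[of M] by (intro exI[of _ e] exI[of _ g]) auto
qed

lemma form_expand: "inprod N u (kapply N a v) = (\<Sum>p<N. \<Sum>q<N. cnj (u p) * (a p q * v q))"
  by (simp add: inprod_def kapply_def sum_distrib_left)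

section \<open>Change of basis\<close>

text \<open>The vector with prescribed coordinates, inverse to taking inner products with the basis.\<close>

definition synth :: "nat \<Rightarrow> (nat \<Rightarrow> nat \<Rightarrow> complex) \<Rightarrow> (nat \<Rightarrow> complex) \<Rightarrow> nat \<Rightarrow> complex" where
  "synth N e w = (\<lambda>p. \<Sum>j<N. w j * e j p)"

lemma inprod_synth: "orthonormal N N e \<Longrightarrow> i < N \<Longrightarrow> inprod N (e i) (synth N e w) = w i"
  unfolding synth_def inprod_sum_right inprod_scale_right by (simp add: orthonormal_def if_distrib[of "\<lambda>x. _ * x"] cong: if_cong)

lemma Parseval: "orthonormal N N e \<Longrightarrow> vnorm N (\<lambda>i. inprod N (e i) y) = vnorm N y"
proof -
  assume e: "orthonormal N N e"
  have "vnorm N (\<lambda>p. y p - proj N N e y p) = 0" using expand_basis[OF e] by (simp add: vnorm_eq_0 proj_def)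
  then have "(vnorm N y)\<^sup>2 = (vnorm N (\<lambda>i. inprod N (e i) y))\<^sup>2" using residual_norm[OF e, of y] by (simp add: vnorm_sq)
  then show ?thesis by simp
qed

lemma vnorm_synth: "orthonormal N N e \<Longrightarrow> vnorm N (synth N e w) = vnorm N w"
  using Parseval[of N e "synth N e w"] vnorm_cong[of N "\<lambda>i. inprod N (e i) (synth N e w)" w] by (simp add: inprod_synth)

lemma kapply_sum: "kapply N A (\<lambda>p. \<Sum>j\<in>J. c j * x j p) = (\<lambda>p. \<Sum>j\<in>J. c j * kapply N A (x j) p)"
proof
  fix p
  have "kapply N A (\<lambda>p. \<Sum>j\<in>J. c j * x j p) p = (\<Sum>q<N. \<Sum>j\<in>J. c j * (A p q * x j q))"
    by (simp add: kapply_def sum_distrib_left mult_ac)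
  also have "\<dots> = (\<Sum>j\<in>J. \<Sum>q<N. c j * (A p q * x j q))" by (rule sum.swap)
  finally show "kapply N A (\<lambda>p. \<Sum>j\<in>J. c j * x j p) p = (\<Sum>j\<in>J. c j * kapply N A (x j) p)" by (simp add: kapply_def sum_distrib_left)
qed

lemma kapply_conj_basis: "kapply N (conj_basis N e A) w = (\<lambda>i. inprod N (e i) (kapply N A (synth N e w)))"
  by (simp add: synth_def kapply_sum inprod_sum_right inprod_scale_right) (simp add: kapply_def conj_basis_def mult.commute)

lemma vnorm_kapply_conj_basis: "orthonormal N N e \<Longrightarrow> vnorm N (kapply N (conj_basis N e A) w) = vnorm N (kapply N A (synth N e w))"
  by (simp add: kapply_conj_basis Parseval)

lemma op_bounded_conj_basis: "orthonormal N N e \<Longrightarrow> op_bounded N A c \<Longrightarrow> op_bounded N (conj_basis N e A) c"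
  unfolding op_bounded_def vnorm_kapply_conj_basis by (metis vnorm_synth)

lemma conj_basis_adj: "conj_basis N e (adj A) = adj (conj_basis N e A)"
  by (intro ext) (simp add: conj_basis_def adj_def[of "\<lambda>i j. inprod N (e i) (kapply N A (e j))"] inprod_kapply_adj[of N _ "adj A"] inprod_cnj)

lemma conj_basis_diff: "conj_basis N e (\<lambda>p q. A p q - B p q) = (\<lambda>p q. conj_basis N e A p q - conj_basis N e B p q)"
  by (simp add: conj_basis_def kapply_diff_left inprod_diff_right)

lemma conj_basis_scale: "conj_basis N e (\<lambda>p q. c * A p q) = (\<lambda>p q. c * conj_basis N e A p q)"
proof -
  have "kapply N (\<lambda>p q. c * A p q) v = (\<lambda>p. c * kapply N A v p)" for v by (simp add: kapply_def sum_distrib_left mult_ac)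
  then show ?thesis by (simp add: conj_basis_def inprod_scale_right)
qed

lemma conj_basis_cong: "(\<And>p q. p < N \<Longrightarrow> q < N \<Longrightarrow> A p q = B p q) \<Longrightarrow> conj_basis N e A = conj_basis N e B"
  by (simp add: conj_basis_def fun_eq_iff form_expand)

lemma conj_basis_kmult:
  assumes e: "orthonormal N N e"
  shows "conj_basis N e (kmult N A B) = kmult N (conj_basis N e A) (conj_basis N e B)"
proof (intro ext)
  fix i j
  have "kapply N A (kapply N B (e j)) = kapply N A (\<lambda>p. \<Sum>k<N. conj_basis N e B k j * e k p)"
    by (rule kapply_cong) (simp add: conj_basis_def flip: expand_basis[OF e])
  then show "conj_basis N e (kmult N A B) i j = kmult N (conj_basis N e A) (conj_basis N e B) i j"
    by (simp add: conj_basis_def[of N e "kmult N A B"] kapply_kmult kapply_sum inprod_sum_right inprod_scale_right)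
       (simp add: kmult_def conj_basis_def mult.commute)
qed

lemma conj_basis_trace:
  assumes e: "orthonormal N N e"
  shows "(\<Sum>i<N. conj_basis N e A i i) = (\<Sum>p<N. A p p)"
proof -
  have "(\<Sum>i<N. conj_basis N e A i i) = (\<Sum>i<N. \<Sum>p<N. \<Sum>q<N. A p q * (cnj (e i p) * e i q))"
    by (simp add: conj_basis_def form_expand mult_ac)
  also have "\<dots> = (\<Sum>p<N. \<Sum>i<N. \<Sum>q<N. A p q * (cnj (e i p) * e i q))" by (rule sum.swap)
  also have "\<dots> = (\<Sum>p<N. \<Sum>q<N. \<Sum>i<N. A p q * (cnj (e i p) * e i q))" by (intro sum.cong refl sum.swap)
  also have "\<dots> = (\<Sum>p<N. \<Sum>q<N. A p q * (if p = q then 1 else 0))"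
    by (intro sum.cong refl) (simp add: orthonormal_rows[OF e] sum_distrib_left[symmetric])
  also have "\<dots> = (\<Sum>p<N. A p p)" by (simp add: if_distrib[of "\<lambda>x. _ * x"] cong: if_cong)
  finally show ?thesis .
qed

section \<open>Patching matrices along a quadratic partition of unity\<close>

text \<open>The matrix \<open>\<Sum> D\<^sub>i X\<^sub>i D\<^sub>i\<close> with \<open>D\<^sub>i\<close> diagonal and its entry at \<open>p\<close> depending only on the layer \<open>g p\<close>.\<close>

definition patch :: "'i set \<Rightarrow> ('i \<Rightarrow> nat \<Rightarrow> real) \<Rightarrow> (nat \<Rightarrow> nat) \<Rightarrow> ('i \<Rightarrow> nat \<Rightarrow> nat \<Rightarrow> complex) \<Rightarrow> nat \<Rightarrow> nat \<Rightarrow> complex" where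
  "patch I c g X = (\<lambda>p q. \<Sum>i\<in>I. of_real (c i (g p)) * X i p q * of_real (c i (g q)))"

text \<open>The factors \<open>D\<^sub>i\<close> form row and column contractions, and \<open>X\<^sub>i\<close> is only applied to vectors supported
where \<open>D\<^sub>i\<close> does not vanish.\<close>

lemma patch_bound:
  assumes fin: "finite I" and C: "0 \<le> C"
    and sq: "\<And>p. p < N \<Longrightarrow> (\<Sum>i\<in>I. (c i (g p))\<^sup>2) \<le> 1"
    and X: "\<And>i v. i \<in> I \<Longrightarrow> (\<And>p. p < N \<Longrightarrow> c i (g p) = 0 \<Longrightarrow> v p = 0) \<Longrightarrow> vnorm N (kapply N (X i) v) \<le> C * vnorm N v"
  shows "op_bounded N (patch I c g X) C"
proof (rule op_bounded_compression[OF fin C, where k = "\<lambda>_. N" and T = X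
      and U = "\<lambda>i u p. of_real (c i (g p)) * u p" and V = "\<lambda>i u p. of_real (c i (g p)) * u p"])
  fix u v :: "nat \<Rightarrow> complex"
  have "inprod N u (kapply N (patch I c g X) v) = (\<Sum>p<N. \<Sum>q<N. \<Sum>i\<in>I. cnj (of_real (c i (g p)) * u p) * (X i p q * (of_real (c i (g q)) * v q)))"
    by (simp add: form_expand patch_def sum_distrib_left sum_distrib_right mult_ac)
  also have "\<dots> = (\<Sum>p<N. \<Sum>i\<in>I. \<Sum>q<N. cnj (of_real (c i (g p)) * u p) * (X i p q * (of_real (c i (g q)) * v q)))"
    by (intro sum.cong refl sum.swap)
  also have "\<dots> = (\<Sum>i\<in>I. \<Sum>p<N. \<Sum>q<N. cnj (of_real (c i (g p)) * u p) * (X i p q * (of_real (c i (g q)) * v q)))"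
    by (rule sum.swap)
  finally show "inprod N u (kapply N (patch I c g X) v) = (\<Sum>i\<in>I. inprod N (\<lambda>p. of_real (c i (g p)) * u p) (kapply N (X i) (\<lambda>p. of_real (c i (g p)) * v p)))"
    by (simp add: form_expand)
  have "(\<Sum>i\<in>I. (vnorm N (\<lambda>p. of_real (c i (g p)) * u p))\<^sup>2) \<le> (vnorm N u)\<^sup>2" for u
  proof -
    have "(\<Sum>i\<in>I. (vnorm N (\<lambda>p. of_real (c i (g p)) * u p))\<^sup>2) = (\<Sum>p<N. \<Sum>i\<in>I. (c i (g p))\<^sup>2 * (cmod (u p))\<^sup>2)"
      unfolding vnorm_sq by (subst sum.swap) (simp add: norm_mult power_mult_distrib)
    also have "\<dots> = (\<Sum>p<N. (\<Sum>i\<in>I. (c i (g p))\<^sup>2) * (cmod (u p))\<^sup>2)" by (simp add: sum_distrib_right)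
    also have "\<dots> \<le> (\<Sum>p<N. 1 * (cmod (u p))\<^sup>2)" using sq by (intro sum_mono mult_right_mono) auto
    finally show ?thesis by (simp add: vnorm_sq)
  qed
  then show "(\<Sum>i\<in>I. (vnorm N (\<lambda>p. of_real (c i (g p)) * u p))\<^sup>2) \<le> (vnorm N u)\<^sup>2"
    "(\<Sum>i\<in>I. (vnorm N (\<lambda>p. of_real (c i (g p)) * v p))\<^sup>2) \<le> (vnorm N v)\<^sup>2" by blast+
qed (rule X, auto)

lemma op_bounded_diag:
  assumes a: "op_bounded N a C" and C: "0 \<le> C" and d: "\<And>p. p < N \<Longrightarrow> \<bar>d p\<bar> \<le> 1" "\<And>p. p < N \<Longrightarrow> \<bar>d' p\<bar> \<le> (1::real)"
  shows "op_bounded N (\<lambda>p q. of_real (d p) * a p q * of_real (d' q)) C"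
proof -
  have sm: "vnorm N (\<lambda>p. of_real (f p) * v p) \<le> vnorm N v" if "\<And>p. p < N \<Longrightarrow> \<bar>f p\<bar> \<le> (1::real)" for f v
    using that by (intro vnorm_mono) (simp add: norm_mult mult_left_le_one_le)
  have "vnorm N (kapply N (\<lambda>p q. of_real (d p) * a p q * of_real (d' q)) v) \<le> C * vnorm N v" for v
  proof -
    have "kapply N (\<lambda>p q. of_real (d p) * a p q * of_real (d' q)) v = (\<lambda>p. of_real (d p) * kapply N a (\<lambda>q. of_real (d' q) * v q) p)"
      by (simp add: kapply_def sum_distrib_left mult_ac)
    then have "vnorm N (kapply N (\<lambda>p q. of_real (d p) * a p q * of_real (d' q)) v) \<le> vnorm N (kapply N a (\<lambda>q. of_real (d' q) * v q))"
      using sm[OF d(1)] by simp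
    also have "\<dots> \<le> C * vnorm N (\<lambda>q. of_real (d' q) * v q)" using a by (rule op_boundedD)
    also have "\<dots> \<le> C * vnorm N v" using sm[OF d(2)] C by (intro mult_left_mono) auto
    finally show ?thesis .
  qed
  then show ?thesis by (simp add: op_bounded_def)
qed

lemma vnorm_restrict:
  "(\<Sum>m\<le>(G::nat). (vnorm N (\<lambda>p. if g p = m + s then u p else 0))\<^sup>2) \<le> (vnorm N u)\<^sup>2"
proof -
  have "(\<Sum>m\<le>G. (vnorm N (\<lambda>p. if g p = m + s then u p else 0))\<^sup>2) = (\<Sum>p<N. \<Sum>m\<le>G. if g p = m + s then (cmod (u p))\<^sup>2 else 0)"
    unfolding vnorm_sq by (subst sum.swap) (intro sum.cong refl, auto)
  also have "\<dots> \<le> (\<Sum>p<N. (cmod (u p))\<^sup>2)"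
  proof (rule sum_mono)
    fix p
    have "(\<Sum>m\<le>G. if g p = m + s then (cmod (u p))\<^sup>2 else 0) \<le> (\<Sum>m\<le>G. if m = g p - s then (cmod (u p))\<^sup>2 else 0)"
      by (rule sum_mono) auto
    also have "\<dots> \<le> (cmod (u p))\<^sup>2" by simp
    finally show "(\<Sum>m\<le>G. if g p = m + s then (cmod (u p))\<^sup>2 else 0) \<le> (cmod (u p))\<^sup>2" .
  qed
  finally show ?thesis by (simp add: vnorm_sq)
qed

text \<open>The blocks on one block diagonal have orthogonal domains and orthogonal ranges, so scaling them
separately costs only the largest factor.\<close>

lemma op_bounded_block_diagonal:
  assumes X: "op_bounded N X C" and C: "0 \<le> C" and L: "\<And>m. \<bar>b m\<bar> \<le> L" and g: "\<And>p. g p \<le> (G::nat)"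
  shows "op_bounded N (\<lambda>p q. if g p + s = g q + t then of_real (b (g p + s)) * X p q else 0) (L * C)"
proof (rule op_bounded_compression[where I = "{..G + s + t}" and k = "\<lambda>_. N" and T = "\<lambda>m p q. of_real (b m) * X p q"
      and U = "\<lambda>m u p. if g p + s = m then u p else 0" and V = "\<lambda>m u p. if g p + t = m then u p else 0"])
  have L0: "0 \<le> L" using L[of 0] by simp
  then show "0 \<le> L * C" using C by simp
  fix u v :: "nat \<Rightarrow> complex"
  let ?f = "\<lambda>p q m. cnj (if g p + s = m then u p else 0) * (of_real (b m) * X p q * (if g q + t = m then v q else 0))"
  have "inprod N u (kapply N (\<lambda>p q. if g p + s = g q + t then of_real (b (g p + s)) * X p q else 0) v) = (\<Sum>p<N. \<Sum>q<N. \<Sum>m\<le>G + s + t. ?f p q m)"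
    unfolding form_expand
  proof (intro sum.cong refl)
    fix p q
    have "(\<Sum>m\<le>G + s + t. ?f p q m) = (\<Sum>m\<le>G + s + t. if m = g p + s then ?f p q (g p + s) else 0)"
      by (intro sum.cong refl) auto
    also have "\<dots> = ?f p q (g p + s)" using g[of p] by simp
    finally show "cnj (u p) * ((if g p + s = g q + t then of_real (b (g p + s)) * X p q else 0) * v q) = (\<Sum>m\<le>G + s + t. ?f p q m)" by simp
  qed
  also have "\<dots> = (\<Sum>p<N. \<Sum>m\<le>G + s + t. \<Sum>q<N. ?f p q m)" by (intro sum.cong refl sum.swap)
  also have "\<dots> = (\<Sum>m\<le>G + s + t. \<Sum>p<N. \<Sum>q<N. ?f p q m)" by (rule sum.swap)
  finally show "inprod N u (kapply N (\<lambda>p q. if g p + s = g q + t then of_real (b (g p + s)) * X p q else 0) v) =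
     (\<Sum>m\<le>G + s + t. inprod N (\<lambda>p. if g p + s = m then u p else 0) (kapply N (\<lambda>p q. of_real (b m) * X p q) (\<lambda>p. if g p + t = m then v p else 0)))"
    unfolding form_expand .
  show "(\<Sum>m\<le>G + s + t. (vnorm N (\<lambda>p. if g p + s = m then u p else 0))\<^sup>2) \<le> (vnorm N u)\<^sup>2"
    using vnorm_restrict[where s=0 and g="\<lambda>p. g p + s"] by simp
  show "(\<Sum>m\<le>G + s + t. (vnorm N (\<lambda>p. if g p + t = m then v p else 0))\<^sup>2) \<le> (vnorm N v)\<^sup>2"
    using vnorm_restrict[where s=0 and g="\<lambda>p. g p + t"] by simp
next
  fix m v
  have "op_bounded N (\<lambda>p q. of_real (b m) * X p q) (L * C)"
    by (rule op_bounded_mono[OF op_bounded_scale[OF X]]) (use L C in \<open>auto intro: mult_right_mono\<close>)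
  then show "vnorm N (kapply N (\<lambda>p q. of_real (b m) * X p q) (\<lambda>p. if g p + t = m then v p else 0)) \<le> L * C * vnorm N (\<lambda>p. if g p + t = m then v p else 0)"
    by (rule op_boundedD)
qed simp

text \<open>The commutator of the diagonal matrix of \<open>c \<circ> g\<close> with \<open>X\<close>.\<close>

definition comm_diag :: "(nat \<Rightarrow> real) \<Rightarrow> (nat \<Rightarrow> nat) \<Rightarrow> (nat \<Rightarrow> nat \<Rightarrow> complex) \<Rightarrow> nat \<Rightarrow> nat \<Rightarrow> complex" where
  "comm_diag c g X = (\<lambda>p q. of_real (c (g p) - c (g q)) * X p q)"

definition banded :: "nat \<Rightarrow> (nat \<Rightarrow> nat) \<Rightarrow> (nat \<Rightarrow> nat \<Rightarrow> complex) \<Rightarrow> bool" where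
  "banded N g X \<longleftrightarrow> (\<forall>p<N. \<forall>q<N. X p q \<noteq> 0 \<longrightarrow> g p \<le> g q + 1 \<and> g q \<le> g p + 1)"

text \<open>The commutator lives on the two block diagonals next to the main one, and there \<open>c\<close> changes by at
most \<open>L\<close>.\<close>

lemma op_bounded_comm_diag:
  assumes X: "op_bounded N X C" "0 \<le> C" "banded N g X" and L: "\<And>m. \<bar>c (Suc m) - c m\<bar> \<le> L" and g: "\<And>p. g p \<le> G"
  shows "op_bounded N (comm_diag c g X) (2 * L * C)"
proof -
  have L': "\<bar>c m - c (m - 1)\<bar> \<le> L" for m
    using L[of "m - 1"] L[of 0] by (cases m) auto
  have 1: "op_bounded N (\<lambda>p q. if g p + 1 = g q + 0 then of_real (c (g p + 1 - 1) - c (g p + 1)) * X p q else 0) (L * C)"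
    by (rule op_bounded_block_diagonal[where b = "\<lambda>m. c (m - 1) - c m", OF X(1,2) _ g]) (use L' in \<open>simp add: abs_minus_commute\<close>)
  have 2: "op_bounded N (\<lambda>p q. if g p + 0 = g q + 1 then of_real (c (g p + 0) - c (g p + 0 - 1)) * X p q else 0) (L * C)"
    by (rule op_bounded_block_diagonal[where b = "\<lambda>m. c m - c (m - 1)", OF X(1,2) _ g]) (rule L')
  show ?thesis
  proof (rule op_bounded_cong[OF op_bounded_mono[OF op_bounded_add[OF 1 2]]])
    fix p q assume pq: "p < N" "q < N"
    consider "X p q = 0" | "g p = g q" | "g q = g p + 1" | "g p = g q + 1"
      using X(3) pq unfolding banded_def by (metis Suc_eq_plus1 le_Suc_eq le_antisym)
    then show "(if g p + 1 = g q + 0 then of_real (c (g p + 1 - 1) - c (g p + 1)) * X p q else 0) +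
       (if g p + 0 = g q + 1 then of_real (c (g p + 0) - c (g p + 0 - 1)) * X p q else 0) = comm_diag c g X p q"
      by cases (auto simp: comm_diag_def)
  qed simp
qed

text \<open>Insert \<open>\<Sum> D\<^sub>j\<^sup>2 = 1\<close> into the patched \<open>Z\<close>.  Up to \<open>(card I)\<^sup>2\<close> commutators with the \<open>D\<^sub>i\<close>, the difference is then
the patch of \<open>Z\<^sub>i - X\<^sub>i Y\<^sub>j\<close> over pairs with weights \<open>D\<^sub>i D\<^sub>j\<close>, whose squares again add up to \<open>1\<close>.
By \<open>patch_bound\<close> the number of pairs does not enter this main term, so \<open>\<epsilon>\<close> is independent of it; it
enters the commutator terms, which are made small by the Lipschitz constant \<open>L\<close> alone.\<close>

lemma patch_mult:
  assumes fin: "finite I" and C: "0 \<le> C" and eps: "0 \<le> \<epsilon>" and L0: "0 \<le> L"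
    and X: "\<And>i. i \<in> I \<Longrightarrow> op_bounded N (X i) C" "\<And>i. i \<in> I \<Longrightarrow> banded N g (X i)"
    and Y: "\<And>i. i \<in> I \<Longrightarrow> op_bounded N (Y i) C" "\<And>i. i \<in> I \<Longrightarrow> banded N g (Y i)"
    and Z: "\<And>i. i \<in> I \<Longrightarrow> op_bounded N (Z i) C" "\<And>i. i \<in> I \<Longrightarrow> banded N g (Z i)"
    and sq: "\<And>p. p < N \<Longrightarrow> (\<Sum>i\<in>I. (c i (g p))\<^sup>2) = 1"
    and c1: "\<And>i m. \<bar>c i m\<bar> \<le> 1"
    and L: "\<And>i m. \<bar>c i (Suc m) - c i m\<bar> \<le> L" and g: "\<And>p. g p \<le> G"
    and near: "\<And>i j v. i \<in> I \<Longrightarrow> j \<in> I \<Longrightarrow> (\<And>p. p < N \<Longrightarrow> c i (g p) * c j (g p) = 0 \<Longrightarrow> v p = 0) \<Longrightarrow>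
         vnorm N (kapply N (\<lambda>p q. Z i p q - kmult N (X i) (Y j) p q) v) \<le> \<epsilon> * vnorm N v"
  shows "op_bounded N (\<lambda>p q. patch I c g Z p q - kmult N (patch I c g X) (patch I c g Y) p q)
           (\<epsilon> + real (card I) ^ 2 * (2 * L * C + 4 * L * C\<^sup>2))"
proof -
  define W where "W = (\<lambda>(i, j) p q. Z i p q - kmult N (X i) (Y j) p q)"
  define cc where "cc = (\<lambda>(i, j) m. c i m * c j m)"
  define R1 where "R1 = (\<lambda>i j p q. of_real (c i (g p) * c j (g p)) * comm_diag (c j) g (Z i) p q * of_real (c i (g q)))"
  define S where "S = (\<lambda>i j p q. kmult N (comm_diag (c j) g (X i)) (\<lambda>r q. of_real 1 * Y j r q * of_real (c i (g q))) p q
       - kmult N (\<lambda>p r. of_real 1 * X i p r * of_real (c j (g r))) (comm_diag (c i) g (Y j)) p q)"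
  define R2 where "R2 = (\<lambda>i j p q. of_real (c i (g p)) * S i j p q * of_real (c j (g q)))"
  have main: "op_bounded N (patch (I \<times> I) cc g W) \<epsilon>"
  proof (rule patch_bound)
    fix p assume p: "p < N"
    have "(\<Sum>i\<in>I \<times> I. (cc i (g p))\<^sup>2) = (\<Sum>i\<in>I. (c i (g p))\<^sup>2) * (\<Sum>i\<in>I. (c i (g p))\<^sup>2)"
      by (simp add: cc_def sum_product sum.cartesian_product split_def power_mult_distrib)
    then show "(\<Sum>i\<in>I \<times> I. (cc i (g p))\<^sup>2) \<le> 1" using sq[OF p] by simp
  next
    fix i and v :: "nat \<Rightarrow> complex" assume "i \<in> I \<times> I" "\<And>p. p < N \<Longrightarrow> cc i (g p) = 0 \<Longrightarrow> v p = 0"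
    then show "vnorm N (kapply N (W i) v) \<le> \<epsilon> * vnorm N v" using near by (cases i) (auto simp: W_def cc_def)
  qed (use fin eps in auto)
  have cc1: "\<bar>c i m * c j m'\<bar> \<le> 1" for i j m m' using c1[of i m] c1[of j m'] by (simp add: abs_mult mult_le_one)
  have cm: "op_bounded N (comm_diag (c j) g A) (2 * L * C)" if "op_bounded N A C" "banded N g A" for j A
    using op_bounded_comm_diag[where c = "c j", OF that(1) C that(2) L g] .
  have R1: "op_bounded N (R1 i j) (2 * L * C)" if "i \<in> I" "j \<in> I" for i j
    unfolding R1_def using C L0 c1 cc1 that
    by (intro op_bounded_diag[where d = "\<lambda>p. c i (g p) * c j (g p)" and d' = "\<lambda>q. c i (g q)"] cm Z) auto
  have R2: "op_bounded N (R2 i j) (4 * L * C\<^sup>2)" if ij: "i \<in> I" "j \<in> I" for i j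
  proof -
    have "op_bounded N (S i j) (2 * L * C * C + C * (2 * L * C))"
      unfolding S_def using C L0 c1 ij
      by (intro op_bounded_diff op_bounded_kmult cm
          op_bounded_diag[where d = "\<lambda>p. 1" and d' = "\<lambda>q. c i (g q)"] op_bounded_diag[where d = "\<lambda>p. 1" and d' = "\<lambda>q. c j (g q)"] X Y) auto
    then have "op_bounded N (S i j) (4 * L * C\<^sup>2)" by (simp add: power2_eq_square algebra_simps)
    then show ?thesis unfolding R2_def using C L0 c1
      by (intro op_bounded_diag[where d = "\<lambda>p. c i (g p)" and d' = "\<lambda>q. c j (g q)"]) auto
  qed
  have R: "op_bounded N (\<lambda>p q. \<Sum>x\<in>I \<times> I. R1 (fst x) (snd x) p q + R2 (fst x) (snd x) p q) (\<Sum>x\<in>I \<times> I. 2 * L * C + 4 * L * C\<^sup>2)"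
    using fin R1 R2 by (intro op_bounded_sum op_bounded_add) auto
  have cst: "(\<Sum>x\<in>I \<times> I. 2 * L * C + 4 * L * C\<^sup>2) = real (card I) ^ 2 * (2 * L * C + 4 * L * C\<^sup>2)"
    by (simp add: card_cartesian_product power2_eq_square)
  show ?thesis
  proof (rule op_bounded_cong[OF op_bounded_add[OF main R, unfolded cst]])
    fix p q assume pq: "p < N" "q < N"
    have piece: "of_real (c i (g p)) * Z i p q * of_real (c i (g q)) * of_real ((c j (g p))\<^sup>2)
         - (\<Sum>r<N. of_real (c i (g p)) * X i p r * of_real (c i (g r)) * (of_real (c j (g r)) * Y j r q * of_real (c j (g q))))
       = of_real (cc (i,j) (g p)) * W (i,j) p q * of_real (cc (i,j) (g q)) + (R1 i j p q + R2 i j p q)" for i j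
    proof -
      define a where "a = complex_of_real (c i (g p))"
      define b where "b = complex_of_real (c j (g p))"
      define a' where "a' = complex_of_real (c i (g q))"
      define b' where "b' = complex_of_real (c j (g q))"
      have s: "S i j p q = (\<Sum>r<N. X i p r * Y j r q * (b * a' - of_real (c j (g r)) * of_real (c i (g r))))"
        unfolding S_def kmult_def comm_diag_def sum_subtractf[symmetric] a'_def b_def
        by (intro sum.cong refl) (simp add: left_diff_distrib right_diff_distrib mult_ac)
      have e1: "a * b * kmult N (X i) (Y j) p q * (a' * b') - a * S i j p q * b' = (\<Sum>r<N. a * X i p r * of_real (c i (g r)) * (of_real (c j (g r)) * Y j r q * b'))"
        unfolding s kmult_def sum_distrib_left sum_distrib_right sum_subtractf[symmetric]
        by (intro sum.cong refl) (simp add: left_diff_distrib right_diff_distrib mult_ac)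
      have e2: "a * Z i p q * a' * b\<^sup>2 = a * b * Z i p q * (a' * b') + R1 i j p q"
        by (simp add: R1_def comm_diag_def a_def b_def a'_def b'_def algebra_simps power2_eq_square)
      show ?thesis
        unfolding cc_def W_def R2_def split_conv of_real_mult of_real_power a_def[symmetric] b_def[symmetric] a'_def[symmetric] b'_def[symmetric]
          e1[symmetric] e2
        by (simp add: left_diff_distrib right_diff_distrib mult_ac)
    qed
    have "patch I c g Z p q = (\<Sum>i\<in>I. \<Sum>j\<in>I. of_real (c i (g p)) * Z i p q * of_real (c i (g q)) * of_real ((c j (g p))\<^sup>2))"
    proof -
      have "(\<Sum>j\<in>I. of_real (c i (g p)) * Z i p q * of_real (c i (g q)) * of_real ((c j (g p))\<^sup>2)) =
         of_real (c i (g p)) * Z i p q * of_real (c i (g q)) * complex_of_real (\<Sum>j\<in>I. (c j (g p))\<^sup>2)" for i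
        by (simp add: sum_distrib_left)
      then show ?thesis using sq[OF pq(1)] by (simp add: patch_def)
    qed
    moreover have "kmult N (patch I c g X) (patch I c g Y) p q =
      (\<Sum>i\<in>I. \<Sum>j\<in>I. \<Sum>r<N. of_real (c i (g p)) * X i p r * of_real (c i (g r)) * (of_real (c j (g r)) * Y j r q * of_real (c j (g q))))"
    proof -
      have "kmult N (patch I c g X) (patch I c g Y) p q = (\<Sum>r<N. \<Sum>i\<in>I. \<Sum>j\<in>I. of_real (c i (g p)) * X i p r * of_real (c i (g r)) * (of_real (c j (g r)) * Y j r q * of_real (c j (g q))))"
        by (simp add: kmult_def patch_def sum_product)
      also have "\<dots> = (\<Sum>i\<in>I. \<Sum>r<N. \<Sum>j\<in>I. of_real (c i (g p)) * X i p r * of_real (c i (g r)) * (of_real (c j (g r)) * Y j r q * of_real (c j (g q))))"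
        by (rule sum.swap)
      also have "\<dots> = (\<Sum>i\<in>I. \<Sum>j\<in>I. \<Sum>r<N. of_real (c i (g p)) * X i p r * of_real (c i (g r)) * (of_real (c j (g r)) * Y j r q * of_real (c j (g q))))"
        by (intro sum.cong refl sum.swap)
      finally show ?thesis .
    qed
    ultimately have "patch I c g Z p q - kmult N (patch I c g X) (patch I c g Y) p q =
       (\<Sum>i\<in>I. \<Sum>j\<in>I. of_real (cc (i,j) (g p)) * W (i,j) p q * of_real (cc (i,j) (g q)) + (R1 i j p q + R2 i j p q))"
      unfolding piece[symmetric] sum_subtractf by simp
    then show "patch (I \<times> I) cc g W p q + (\<Sum>x\<in>I \<times> I. R1 (fst x) (snd x) p q + R2 (fst x) (snd x) p q) =
       patch I c g Z p q - kmult N (patch I c g X) (patch I c g Y) p q"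
      by (simp add: patch_def sum.cartesian_product split_def sum.distrib)
  qed
qed

text \<open>Where only \<open>D\<^sub>k = 1\<close> is present the diagonal entries agree; the other diagonal positions are few.\<close>

lemma patch_trace:
  assumes fin: "finite I" and C: "0 \<le> C" and X: "\<And>i. i \<in> I \<Longrightarrow> op_bounded N (X i) C" and k: "k \<in> I"
    and sq: "\<And>p. p < N \<Longrightarrow> (\<Sum>i\<in>I. (c i (g p))\<^sup>2) = 1"
    and top: "\<And>p i. p < N \<Longrightarrow> \<not> g p \<le> M \<Longrightarrow> i \<in> I \<Longrightarrow> c i (g p) = (if i = k then 1 else 0)"
    and card: "finite {p. g p \<le> M}" "card {p. g p \<le> M} \<le> D"
  shows "cmod ((\<Sum>p<N. patch I c g X p p) - (\<Sum>p<N. X k p p)) \<le> 2 * C * real D"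
proof -
  have b: "cmod (patch I c g X p p - X k p p) \<le> (if g p \<le> M then 2 * C else 0)" if p: "p < N" for p
  proof (cases "g p \<le> M")
    case True
    have "cmod (patch I c g X p p) \<le> (\<Sum>i\<in>I. cmod (of_real (c i (g p)) * X i p p * of_real (c i (g p))))"
      unfolding patch_def by (rule norm_sum)
    also have "\<dots> \<le> (\<Sum>i\<in>I. (c i (g p))\<^sup>2 * C)"
    proof (rule sum_mono)
      fix i assume "i \<in> I"
      then have "cmod (X i p p) \<le> C" using op_bounded_entry X p by blast
      then have "(c i (g p))\<^sup>2 * cmod (X i p p) \<le> (c i (g p))\<^sup>2 * C" by (intro mult_left_mono) auto
      then show "cmod (of_real (c i (g p)) * X i p p * of_real (c i (g p))) \<le> (c i (g p))\<^sup>2 * C"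
        by (simp add: norm_mult power2_eq_square mult_ac flip: abs_mult)
    qed
    also have "\<dots> = C" using sq[OF p] by (simp flip: sum_distrib_right)
    finally have "cmod (patch I c g X p p) \<le> C" .
    moreover have "cmod (X k p p) \<le> C" using op_bounded_entry X k p by blast
    ultimately show ?thesis using True norm_triangle_ineq4[of "patch I c g X p p" "X k p p"] by simp
  next
    case False
    have "patch I c g X p p = (\<Sum>i\<in>I. if i = k then X k p p else 0)"
      unfolding patch_def using top[OF p False] by (intro sum.cong) auto
    then show ?thesis using False fin k by simp
  qed
  have "cmod ((\<Sum>p<N. patch I c g X p p) - (\<Sum>p<N. X k p p)) \<le> (\<Sum>p<N. cmod (patch I c g X p p - X k p p))"
    unfolding sum_subtractf[symmetric] by (rule norm_sum)
  also have "\<dots> \<le> (\<Sum>p<N. if g p \<le> M then 2 * C else 0)" by (rule sum_mono) (use b in auto)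
  also have "\<dots> = 2 * C * real (card {p \<in> {..<N}. g p \<le> M})"
    by (subst sum.inter_filter[symmetric]) auto
  also have "card {p \<in> {..<N}. g p \<le> M} \<le> card {p. g p \<le> M}" by (rule card_mono[OF card(1)]) auto
  then have "2 * C * real (card {p \<in> {..<N}. g p \<le> M}) \<le> 2 * C * real D"
    using card(2) C by (intro mult_left_mono) auto
  finally show ?thesis .
qed

subsection \<open>Tent functions with squares summing to one\<close>

text \<open>On the interval of length \<open>P\<close> between the peaks of two consecutive tents these are a cosine and the
complementary sine, so that the squares add up to \<open>1\<close>.\<close>

definition tent :: "nat \<Rightarrow> nat \<Rightarrow> nat \<Rightarrow> real" where
  "tent P i m = cos (pi / 2 * min 1 \<bar>real m / real P - real i\<bar>)"

lemma cos_Lipschitz: "\<bar>cos x - cos y\<bar> \<le> \<bar>x - y\<bar>" for x y :: real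
proof -
  have "\<bar>cos x - cos y\<bar> = 2 * (\<bar>sin ((x + y) / 2)\<bar> * \<bar>sin ((y - x) / 2)\<bar>)" by (simp add: cos_diff_cos abs_mult)
  also have "\<dots> \<le> 2 * (1 * \<bar>(y - x) / 2\<bar>)" by (intro mult_left_mono mult_mono abs_sin_le_one abs_sin_x_le_abs_x) auto
  finally show ?thesis by simp
qed

lemma tent_abs_le: "\<bar>tent P i m\<bar> \<le> 1" by (simp add: tent_def)

lemma tent_Lipschitz: "P > 0 \<Longrightarrow> \<bar>tent P i (Suc m) - tent P i m\<bar> \<le> 2 / real P"
proof -
  assume P: "P > 0"
  define a b where "a = \<bar>real (Suc m) / real P - real i\<bar>" and "b = \<bar>real m / real P - real i\<bar>"
  have "\<bar>a - b\<bar> \<le> \<bar>real (Suc m) / real P - real m / real P\<bar>" unfolding a_def b_def by linarith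
  also have "\<dots> = 1 / real P" using P by (simp add: diff_divide_distrib[symmetric])
  finally have "\<bar>min 1 a - min 1 b\<bar> \<le> 1 / real P" by linarith
  then have "pi / 2 * \<bar>min 1 a - min 1 b\<bar> \<le> 2 * (1 / real P)" using pi_less_4 by (intro mult_mono) auto
  moreover have "\<bar>tent P i (Suc m) - tent P i m\<bar> \<le> \<bar>pi / 2 * min 1 a - pi / 2 * min 1 b\<bar>"
    unfolding tent_def a_def b_def by (rule cos_Lipschitz)
  moreover have "\<bar>pi / 2 * min 1 a - pi / 2 * min 1 b\<bar> = pi / 2 * \<bar>min 1 a - min 1 b\<bar>"
    unfolding right_diff_distrib[symmetric] by (simp add: abs_mult)
  ultimately show ?thesis by simp
qed

lemma tent_zero: "1 \<le> \<bar>real m / real P - real i\<bar> \<Longrightarrow> tent P i m = 0"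
  by (simp add: tent_def)

lemma tent_disjoint: "tent P i m * tent P j m = 0" if "i + 2 \<le> j"
proof -
  have "1 \<le> \<bar>real m / real P - real i\<bar> \<or> 1 \<le> \<bar>real m / real P - real j\<bar>" using that by linarith
  then show ?thesis using tent_zero by auto
qed

lemma tent_start: "i > 0 \<Longrightarrow> tent P i 0 = 0"
  by (rule tent_zero) simp

lemma tent_end: "P > 0 \<Longrightarrow> i \<le> K \<Longrightarrow> tent P i (K * P) = (if i = K then 1 else 0)"
  by (auto simp: tent_def)

lemma tent_square_sum:
  assumes P: "P > 0" and m: "m \<le> K * P"
  shows "(\<Sum>i\<le>K. (tent P i m)\<^sup>2) = 1"
proof (cases "m = K * P")
  case True
  then have "(\<Sum>i\<le>K. (tent P i m)\<^sup>2) = (\<Sum>i\<le>K. if i = K then 1 else 0)" using tent_end[OF P] by (intro sum.cong) auto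
  then show ?thesis by simp
next
  case False
  define i where "i = m div P"
  define f where "f = real (m mod P) / real P"
  have i: "i < K" using False m P by (simp add: i_def less_mult_imp_div_less)
  have mf: "real m / real P = real i + f"
  proof -
    have "real m = real (i * P + m mod P)" by (simp add: i_def)
    then show ?thesis using P by (simp add: f_def field_simps)
  qed
  have f: "0 \<le> f" "f < 1" using P by (auto simp: f_def)
  have z: "tent P j m = 0" if "j \<notin> {i, Suc i}" for j
  proof (rule tent_zero)
    have "j < i \<or> j > Suc i" using that by auto
    then show "1 \<le> \<bar>real m / real P - real j\<bar>" unfolding mf using f by (auto simp: abs_if)
  qed
  have "(\<Sum>j\<le>K. (tent P j m)\<^sup>2) = (\<Sum>j\<in>{i, Suc i}. (tent P j m)\<^sup>2)"
    using i z by (intro sum.mono_neutral_right) auto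
  also have "\<dots> = (cos (pi / 2 * f))\<^sup>2 + (cos (pi / 2 * (1 - f)))\<^sup>2"
    unfolding tent_def mf using f by (simp add: abs_if)
  also have "cos (pi / 2 * (1 - f)) = sin (pi / 2 * f)"
    unfolding right_diff_distrib cos_diff by simp
  finally show ?thesis by simp
qed

section \<open>Matrix representations and completely positive maps\<close>

definition mat_rep :: "nat \<Rightarrow> ('a::cstar_algebra \<Rightarrow> complex mat) \<Rightarrow> bool" where
  "mat_rep N f \<longleftrightarrow> (\<forall>a. f a \<in> carrier_mat N N) \<and> (\<forall>a b. f (a + b) = f a + f b) \<and>
     (\<forall>c a. f (c *\<^sub>C a) = c \<cdot>\<^sub>m f a) \<and> (\<forall>a b. f (a * b) = f a * f b) \<and> (\<forall>a. f (star a) = mat_adjoint (f a))"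

text \<open>With \<open>1 - a\<^sup>* a = (1 - y)\<^sup>2\<close> for \<open>\<parallel>a\<parallel> < 1\<close>, the vector \<open>v - f(y) v\<close> has squared norm \<open>\<parallel>v\<parallel>\<^sup>2 - \<parallel>f(a) v\<parallel>\<^sup>2\<close>.\<close>

lemma mat_rep_contractive:
  assumes f: "mat_rep N f"
  shows "op_norm (f a) \<le> norm a"
proof -
  have carr: "f a \<in> carrier_mat N N" for a using f by (simp add: mat_rep_def)
  have unit: "op_bounded N (ent (f a)) 1" if a: "norm a < 1" for a
  proof -
    define h where "h = star a * a"
    have "norm h < 1" using a by (simp add: h_def cstar_identity power_less_one_iff)
    moreover have "star h = h" by (simp add: h_def star_mult star_star)
    ultimately obtain y where y: "star y = y" "y + y = h + y * y" using cstar_sqrt_one_minus by blast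
    let ?A = "ent (f a)" and ?H = "ent (f h)" and ?Y = "ent (f y)"
    have H: "?H p q = kmult N (adj ?A) ?A p q" if "p < N" "q < N" for p q
    proof -
      have "f h = mat_adjoint (f a) * f a" using f by (simp add: h_def mat_rep_def)
      then have "?H p q = kmult N (ent (mat_adjoint (f a))) ?A p q"
        using that carr mat_adjoint_carrier[OF carr] by (simp add: ent_mult)
      then show ?thesis using that by (simp add: kmult_def ent_adjoint[OF carr])
    qed
    have Ysa: "adj ?Y p q = ?Y p q" if "p < N" "q < N" for p q
      using f y(1) that carr ent_adjoint[of "f y" N p q] by (metis mat_rep_def)
    have Y2: "?Y p q + ?Y p q = ?H p q + kmult N ?Y ?Y p q" if "p < N" "q < N" for p q
    proof -
      have "f y + f y = f h + f y * f y" using f y(2) by (metis mat_rep_def)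
      then have "ent (f y + f y) p q = ent (f h + f y * f y) p q" by simp
      then show ?thesis using that carr[of y] carr[of h] mult_carrier_mat[OF carr[of y] carr[of y]]
        by (simp add: ent_add[where N = N] ent_mult[where N = N])
    qed
    have "(vnorm N (kapply N ?A v))\<^sup>2 \<le> (1 * vnorm N v)\<^sup>2" for v
    proof -
      have 1: "(vnorm N (kapply N ?A v))\<^sup>2 = Re (inprod N v (kapply N ?H v))"
        unfolding vnorm_kapply_sq by (simp add: form_expand H)
      have 2: "(vnorm N (kapply N ?Y v))\<^sup>2 = Re (inprod N v (kapply N (kmult N ?Y ?Y) v))"
        unfolding vnorm_kapply_sq by (simp add: form_expand kmult_def Ysa)
      have "inprod N v (kapply N ?Y v) + inprod N v (kapply N ?Y v) = inprod N v (kapply N (\<lambda>p q. ?Y p q + ?Y p q) v)"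
        by (simp only: kapply_add_left inprod_add_right)
      also have "\<dots> = inprod N v (kapply N (\<lambda>p q. ?H p q + kmult N ?Y ?Y p q) v)"
        unfolding form_expand by (intro sum.cong refl) (simp only: Y2 lessThan_iff)
      also have "\<dots> = inprod N v (kapply N ?H v) + inprod N v (kapply N (kmult N ?Y ?Y) v)" by (simp only: kapply_add_left inprod_add_right)
      finally have 3: "2 * Re (inprod N v (kapply N ?Y v)) = (vnorm N (kapply N ?A v))\<^sup>2 + (vnorm N (kapply N ?Y v))\<^sup>2"
        unfolding 1 2 by (metis mult_2 plus_complex.sel(1))
      let ?d = "\<lambda>p. v p - kapply N ?Y v p"
      have c: "complex_of_real ((vnorm N ?d)\<^sup>2) = complex_of_real ((vnorm N v)\<^sup>2) - inprod N v (kapply N ?Y v)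
          - (cnj (inprod N v (kapply N ?Y v)) - complex_of_real ((vnorm N (kapply N ?Y v))\<^sup>2))"
        unfolding inprod_self[symmetric] inprod_cnj by (simp only: inprod_diff_left inprod_diff_right)
      have "(vnorm N ?d)\<^sup>2 = (vnorm N v)\<^sup>2 - 2 * Re (inprod N v (kapply N ?Y v)) + (vnorm N (kapply N ?Y v))\<^sup>2"
        using arg_cong[OF c, of Re] by (simp del: of_real_power)
      then have "(vnorm N ?d)\<^sup>2 = (vnorm N v)\<^sup>2 - (vnorm N (kapply N ?A v))\<^sup>2" using 3 by simp
      then show ?thesis using zero_le_power2[of "vnorm N ?d"] by simp
    qed
    then have "vnorm N (kapply N ?A v) \<le> 1 * vnorm N v" for v by (rule power2_le_imp_le) simp
    then show ?thesis by (simp add: op_bounded_def)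
  qed
  have "op_bounded N (ent (f a)) (norm a + e)" if e: "e > 0" for e
  proof -
    define t where "t = norm a + e"
    have t: "t > 0" "norm a < t" using e by (auto simp: t_def add_nonneg_pos)
    have "op_bounded N (ent (f ((1/t) *\<^sub>R a))) 1" using t by (intro unit) auto
    moreover have "f ((1/t) *\<^sub>R a) = complex_of_real (1/t) \<cdot>\<^sub>m f a"
      using f by (metis mat_rep_def scaleC_of_real)
    ultimately have "op_bounded N (ent (complex_of_real (1/t) \<cdot>\<^sub>m f a)) 1" by simp
    then have "op_bounded N (\<lambda>p q. complex_of_real t * ent (complex_of_real (1/t) \<cdot>\<^sub>m f a) p q) (cmod (complex_of_real t) * 1)"
      by (rule op_bounded_scale)
    then have "op_bounded N (ent (f a)) (cmod (complex_of_real t) * 1)"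
      by (rule op_bounded_cong) (use t ent_smult[OF carr[of a]] in simp)
    then show ?thesis using t by (simp add: t_def del: of_real_add)
  qed
  then have "op_norm (f a) \<le> norm a + e" if "e > 0" for e using op_norm_le_iff[OF carr[of a], of "norm a + e"] that by simp
  then show ?thesis by (rule field_le_epsilon)
qed

subsection \<open>Complete positivity\<close>

text \<open>A Gram matrix of vectors of any length is \<open>X\<^sup>* X\<close> with \<open>X\<close> square: take the coordinates of the \<open>n\<close>
vectors in an orthonormal family of at most \<open>n\<close> members spanning them.  This makes positivity stable
under sums and compressions.\<close>

lemma gram_positive:
  assumes R: "finite R" and P: "P \<in> carrier_mat n n"
    and ent: "\<And>p q. p < n \<Longrightarrow> q < n \<Longrightarrow> P $$ (p, q) = (\<Sum>r\<in>R. cnj (Y r p) * Y r q)"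
  shows "complex_mat_positive n P"
proof -
  define D where "D = card R"
  obtain h where h: "bij_betw h {..<D} R" using ex_bij_betw_nat_finite[OF R] by (auto simp: D_def atLeast0LessThan)
  define y where "y = (\<lambda>q r. Y (h r) q)"
  have Pip: "P $$ (p, q) = inprod D (y p) (y q)" if "p < n" "q < n" for p q
    unfolding ent[OF that] inprod_def y_def by (rule sum.reindex_bij_betw[OF h, symmetric])
  have "orthonormal D 0 (\<lambda>_ _. 0)" by (simp add: orthonormal_def)
  from extend_to_span_list[OF this, of "map y [0..<n]"]
  obtain d e where e: "orthonormal D d e" "d \<le> n" "\<And>q. q < n \<Longrightarrow> spans D d e (y q)" by auto
  define X where "X = Matrix.mat n n (\<lambda>(i, q). if i < d then inprod D (e i) (y q) else 0)"
  have X: "X \<in> carrier_mat n n" by (simp add: X_def)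
  have "P = mat_adjoint X * X"
  proof (rule eq_matI)
    fix p q assume "p < dim_row (mat_adjoint X * X)" "q < dim_col (mat_adjoint X * X)"
    then have pq: "p < n" "q < n" using X mat_adjoint_carrier[OF X] by auto
    have "(mat_adjoint X * X) $$ (p, q) = (\<Sum>i<n. cnj (X $$ (i, p)) * X $$ (i, q))"
      using pq X mat_adjoint_carrier[OF X] by (auto simp: scalar_prod_def atLeast0LessThan index_mat_adjoint[OF X])
    also have "\<dots> = (\<Sum>i<n. if i < d then cnj (inprod D (e i) (y p)) * inprod D (e i) (y q) else 0)"
      using pq by (intro sum.cong) (auto simp: X_def)
    also have "\<dots> = (\<Sum>i<d. cnj (inprod D (e i) (y p)) * inprod D (e i) (y q))"
      using e(2) by (intro sum.mono_neutral_cong_right) auto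
    also have "\<dots> = inprod D (y p) (proj D d e (y q))"
      unfolding proj_def inprod_sum_right inprod_scale_right by (simp add: inprod_cnj mult.commute)
    also have "\<dots> = inprod D (y p) (y q)"
    proof -
      have "inprod D (y p) (\<lambda>r. y q r - proj D d e (y q) r) = 0"
        using e(3)[OF pq(1)] inprod_residual[OF e(1)] unfolding spans_def by blast
      then show ?thesis by (simp add: inprod_diff_right)
    qed
    finally show "P $$ (p, q) = (mat_adjoint X * X) $$ (p, q)" using Pip[OF pq] by simp
  qed (use X mat_adjoint_carrier[OF X] P in auto)
  then show ?thesis using X by (auto simp: complex_mat_positive_def)
qed

lemma positive_gram:
  assumes "complex_mat_positive n P"
  shows "\<exists>Y. \<forall>p<n. \<forall>q<n. P $$ (p, q) = (\<Sum>r<n. cnj (Y r p) * Y r q)"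
proof -
  obtain X where X: "X \<in> carrier_mat n n" "P = mat_adjoint X * X" using assms by (auto simp: complex_mat_positive_def)
  have "P $$ (p, q) = (\<Sum>r<n. cnj (X $$ (r, p)) * X $$ (r, q))" if "p < n" "q < n" for p q
    using that X mat_adjoint_carrier[OF X(1)] by (auto simp: scalar_prod_def atLeast0LessThan index_mat_adjoint[OF X(1)])
  then show ?thesis by (intro exI[of _ "\<lambda>r p. X $$ (r, p)"]) simp
qed

lemma amplification_carrier: "mat_amplification m N f P \<in> carrier_mat (m * N) (m * N)"
  by (simp add: mat_amplification_def)

lemma div_lt_mult: "p < m * N \<Longrightarrow> p div N < (m::nat) \<and> p mod N < N"
  by (metis less_mult_imp_div_less mod_less_divisor mult_0_right neq0_conv not_less0)

lemma mat_rep_ccp: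
  assumes f: "mat_rep N f"
  shows "ccp_map N f"
  unfolding ccp_map_def
proof (intro conjI allI impI)
  have carr: "f a \<in> carrier_mat N N" for a using f by (simp add: mat_rep_def)
  show "op_norm (f a) \<le> norm a" for a by (rule mat_rep_contractive[OF f])
  fix m and P :: "'a mat" assume "cstar_mat_positive m P"
  then obtain X where X: "X \<in> carrier_mat m m" "P = map_mat star (transpose_mat X) * X" by (auto simp: cstar_mat_positive_def)
  have P: "P $$ (x, y) = (\<Sum>z<m. star (X $$ (z, x)) * X $$ (z, y))" if "x < m" "y < m" for x y
    using that X by (auto simp: scalar_prod_def atLeast0LessThan)
  have f0: "f 0 $$ (i, j) = 0" if "i < N" "j < N" for i j
  proof -
    have "f 0 $$ (i, j) = (f 0 + f 0) $$ (i, j)" using f by (metis add_0 mat_rep_def)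
    then show ?thesis using that carr[of 0] by simp
  qed
  have fsum: "f (\<Sum>z\<in>S. g z) $$ (i, j) = (\<Sum>z\<in>S. f (g z) $$ (i, j))" if "finite S" "i < N" "j < N" for S :: "nat set" and g i j
    using that(1)
  proof (induction S rule: finite_induct)
    case (insert x S)
    have "f (g x + sum g S) = f (g x) + f (sum g S)" using f by (simp add: mat_rep_def)
    then show ?case using insert that carr[of "sum g S"] by simp
  qed (simp add: f0 that)
  let ?Z = "\<lambda>(z, r) p. f (X $$ (z, p div N)) $$ (r, p mod N)"
  show "complex_mat_positive (m * N) (mat_amplification m N f P)"
  proof (rule gram_positive[where R = "{..<m} \<times> {..<N}" and Y = ?Z])
    fix p q assume pq: "p < m * N" "q < m * N"
    note d = div_lt_mult[OF pq(1)] div_lt_mult[OF pq(2)]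
    have "mat_amplification m N f P $$ (p, q) = f (P $$ (p div N, q div N)) $$ (p mod N, q mod N)"
      using pq by (simp add: mat_amplification_def)
    also have "\<dots> = (\<Sum>z<m. f (star (X $$ (z, p div N)) * X $$ (z, q div N)) $$ (p mod N, q mod N))"
      using d by (simp add: P fsum)
    also have "\<dots> = (\<Sum>z<m. \<Sum>r<N. cnj (f (X $$ (z, p div N)) $$ (r, p mod N)) * f (X $$ (z, q div N)) $$ (r, q mod N))"
    proof (intro sum.cong refl)
      fix z
      have "f (star (X $$ (z, p div N)) * X $$ (z, q div N)) = mat_adjoint (f (X $$ (z, p div N))) * f (X $$ (z, q div N))"
        using f by (simp add: mat_rep_def)
      then show "f (star (X $$ (z, p div N)) * X $$ (z, q div N)) $$ (p mod N, q mod N) =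
          (\<Sum>r<N. cnj (f (X $$ (z, p div N)) $$ (r, p mod N)) * f (X $$ (z, q div N)) $$ (r, q mod N))"
        using d carr[of "X $$ (z, p div N)"] carr[of "X $$ (z, q div N)"] mat_adjoint_carrier[OF carr[of "X $$ (z, p div N)"]]
        by (auto simp: scalar_prod_def atLeast0LessThan index_mat_adjoint[OF carr])
    qed
    finally show "mat_amplification m N f P $$ (p, q) = (\<Sum>r\<in>{..<m} \<times> {..<N}. cnj (?Z r p) * ?Z r q)"
      by (simp add: sum.cartesian_product split_def)
  qed (simp_all add: amplification_carrier)
qed (use f in \<open>auto simp: mat_rep_def\<close>)

text \<open>Sums \<open>\<Sum> W\<^sub>i\<^sup>* f\<^sub>i W\<^sub>i\<close> are completely positive because the Gram vectors of the summands, compressed by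
\<open>W\<^sub>i\<close>, can be put side by side.\<close>

lemma ccp_combine:
  fixes F :: "'a::cstar_algebra \<Rightarrow> complex mat"
  assumes I: "finite I" and f: "\<And>i. i \<in> I \<Longrightarrow> ccp_map (k i) (f i)"
    and carr: "\<And>a. F a \<in> carrier_mat N N"
    and ent: "\<And>a p q. p < N \<Longrightarrow> q < N \<Longrightarrow>
      F a $$ (p, q) = (\<Sum>i\<in>I. \<Sum>r<k i. \<Sum>s<k i. cnj (W i r p) * f i a $$ (r, s) * W i s q)"
    and norm: "\<And>a. op_norm (F a) \<le> norm a"
  shows "ccp_map N F"
  unfolding ccp_map_def
proof (intro conjI allI impI)
  have fc: "f i a \<in> carrier_mat (k i) (k i)" if "i \<in> I" for i a using f[OF that] by (simp add: ccp_map_def)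
  fix a b :: 'a and c
  show "F (a + b) = F a + F b"
  proof (rule eq_matI)
    fix p q assume "p < dim_row (F a + F b)" "q < dim_col (F a + F b)"
    then have pq: "p < N" "q < N" using carr[of b] by auto
    have "F (a + b) $$ (p, q) = (\<Sum>i\<in>I. \<Sum>r<k i. \<Sum>s<k i. cnj (W i r p) * f i a $$ (r, s) * W i s q + cnj (W i r p) * f i b $$ (r, s) * W i s q)"
      unfolding ent[OF pq]
    proof (intro sum.cong refl)
      fix i r s assume i: "i \<in> I" "r \<in> {..<k i}" "s \<in> {..<k i}"
      have "f i (a + b) = f i a + f i b" using f[OF i(1)] by (simp add: ccp_map_def)
      then show "cnj (W i r p) * f i (a + b) $$ (r, s) * W i s q = cnj (W i r p) * f i a $$ (r, s) * W i s q + cnj (W i r p) * f i b $$ (r, s) * W i s q"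
        using i fc[OF i(1), of b] by (simp add: algebra_simps)
    qed
    then show "F (a + b) $$ (p, q) = (F a + F b) $$ (p, q)" using pq carr[of b] by (simp add: ent sum.distrib)
  qed (use carr[of "a + b"] carr[of b] in auto)
  show "F (c *\<^sub>C a) = c \<cdot>\<^sub>m F a"
  proof (rule eq_matI)
    fix p q assume "p < dim_row (c \<cdot>\<^sub>m F a)" "q < dim_col (c \<cdot>\<^sub>m F a)"
    then have pq: "p < N" "q < N" using carr[of a] by auto
    have "F (c *\<^sub>C a) $$ (p, q) = (\<Sum>i\<in>I. \<Sum>r<k i. \<Sum>s<k i. c * (cnj (W i r p) * f i a $$ (r, s) * W i s q))"
      unfolding ent[OF pq]
    proof (intro sum.cong refl)
      fix i r s assume i: "i \<in> I" "r \<in> {..<k i}" "s \<in> {..<k i}"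
      have "f i (c *\<^sub>C a) = c \<cdot>\<^sub>m f i a" using f[OF i(1)] by (simp add: ccp_map_def)
      then show "cnj (W i r p) * f i (c *\<^sub>C a) $$ (r, s) * W i s q = c * (cnj (W i r p) * f i a $$ (r, s) * W i s q)"
        using i fc[OF i(1), of a] by (simp add: algebra_simps)
    qed
    then show "F (c *\<^sub>C a) $$ (p, q) = (c \<cdot>\<^sub>m F a) $$ (p, q)" using pq carr[of a] by (simp add: ent sum_distrib_left)
  qed (use carr[of "c *\<^sub>C a"] carr[of a] in auto)
next
  fix m and P :: "'a mat" assume P: "cstar_mat_positive m P"
  have "\<forall>i\<in>I. \<exists>Y. \<forall>p<m * k i. \<forall>q<m * k i. mat_amplification m (k i) (f i) P $$ (p, q) = (\<Sum>t<m * k i. cnj (Y t p) * Y t q)"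
  proof
    fix i assume "i \<in> I"
    then have "complex_mat_positive (m * k i) (mat_amplification m (k i) (f i) P)" using f P by (simp add: ccp_map_def)
    then show "\<exists>Y. \<forall>p<m * k i. \<forall>q<m * k i. mat_amplification m (k i) (f i) P $$ (p, q) = (\<Sum>t<m * k i. cnj (Y t p) * Y t q)"
      by (rule positive_gram)
  qed
  from bchoice[OF this] obtain Y where Y: "\<And>i p q. i \<in> I \<Longrightarrow> p < m * k i \<Longrightarrow> q < m * k i \<Longrightarrow>
      mat_amplification m (k i) (f i) P $$ (p, q) = (\<Sum>t<m * k i. cnj (Y i t p) * Y i t q)" by blast
  have amp: "f i (P $$ (x, y)) $$ (r, s) = (\<Sum>t<m * k i. cnj (Y i t (x * k i + r)) * Y i t (y * k i + s))"
    if "i \<in> I" "x < m" "y < m" "r < k i" "s < k i" for i x y r s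
  proof -
    have lt: "x * k i + r < m * k i" if "x < m" "r < k i" for x r
    proof -
      have "x * k i + r < (x + 1) * k i" using that by simp
      also have "\<dots> \<le> m * k i" using that by (intro mult_le_mono1) auto
      finally show ?thesis .
    qed
    note b = lt[OF that(2,4)] lt[OF that(3,5)]
    show ?thesis using Y[OF that(1) b] b that by (simp add: mat_amplification_def)
  qed
  let ?Z = "\<lambda>(i, t) p. \<Sum>s<k i. W i s (p mod N) * Y i t ((p div N) * k i + s)"
  show "complex_mat_positive (m * N) (mat_amplification m N F P)"
  proof (rule gram_positive[where R = "SIGMA i:I. {..<m * k i}" and Y = ?Z])
    fix p q assume pq: "p < m * N" "q < m * N"
    note d = div_lt_mult[OF pq(1)] div_lt_mult[OF pq(2)]
    have "mat_amplification m N F P $$ (p, q) = F (P $$ (p div N, q div N)) $$ (p mod N, q mod N)"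
      using pq by (simp add: mat_amplification_def)
    also have "\<dots> = (\<Sum>i\<in>I. \<Sum>r<k i. \<Sum>s<k i. cnj (W i r (p mod N)) * f i (P $$ (p div N, q div N)) $$ (r, s) * W i s (q mod N))"
      using d by (simp add: ent)
    also have "\<dots> = (\<Sum>i\<in>I. \<Sum>t<m * k i. cnj (?Z (i, t) p) * ?Z (i, t) q)"
    proof (rule sum.cong[OF refl])
      fix i assume i: "i \<in> I"
      let ?T = "\<lambda>r s t. (cnj (W i r (p mod N)) * cnj (Y i t (p div N * k i + r))) * (W i s (q mod N) * Y i t (q div N * k i + s))"
      have "(\<Sum>r<k i. \<Sum>s<k i. cnj (W i r (p mod N)) * f i (P $$ (p div N, q div N)) $$ (r, s) * W i s (q mod N)) =
        (\<Sum>r<k i. \<Sum>s<k i. \<Sum>t<m * k i. ?T r s t)"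
        using amp[OF i] d by (intro sum.cong refl) (simp add: sum_distrib_left sum_distrib_right mult_ac)
      also have "\<dots> = (\<Sum>r<k i. \<Sum>t<m * k i. \<Sum>s<k i. ?T r s t)" by (intro sum.cong refl sum.swap)
      also have "\<dots> = (\<Sum>t<m * k i. \<Sum>r<k i. \<Sum>s<k i. ?T r s t)" by (rule sum.swap)
      also have "\<dots> = (\<Sum>t<m * k i. cnj (?Z (i, t) p) * ?Z (i, t) q)" by (simp add: sum_product)
      finally show "(\<Sum>r<k i. \<Sum>s<k i. cnj (W i r (p mod N)) * f i (P $$ (p div N, q div N)) $$ (r, s) * W i s (q mod N)) =
         (\<Sum>t<m * k i. cnj (?Z (i, t) p) * ?Z (i, t) q)" .
    qed
    also have "\<dots> = (\<Sum>r\<in>(SIGMA i:I. {..<m * k i}). cnj (?Z r p) * ?Z r q)"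
      using I by (simp add: sum.Sigma split_def)
    finally show "mat_amplification m N F P $$ (p, q) = (\<Sum>r\<in>(SIGMA i:I. {..<m * k i}). cnj (?Z r p) * ?Z r q)" .
  qed (use I in \<open>simp_all add: amplification_carrier\<close>)
qed (use carr norm in auto)

lemma ccp_comp_star_hom:
  fixes f :: "'a::cstar_algebra \<Rightarrow> complex mat" and h :: "'b::cstar_algebra \<Rightarrow> 'a"
  assumes f: "ccp_map k f" and h: "star_hom cstar_alg cstar_alg h"
  shows "ccp_map k (f \<circ> h)"
  unfolding ccp_map_def
proof (intro conjI allI impI)
  note H = star_homD[OF h]
  show "op_norm ((f \<circ> h) a) \<le> norm a" for a
    using f star_hom_contractive[OF h, of a] by (auto simp: ccp_map_def intro: order_trans)
  fix m and P :: "'b mat" assume "cstar_mat_positive m P"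
  then obtain X where X: "X \<in> carrier_mat m m" "P = map_mat star (transpose_mat X) * X" by (auto simp: cstar_mat_positive_def)
  have h0: "h 0 = 0" using H(1)[of 0 0] by simp
  have hs: "h (sum g S) = (\<Sum>z\<in>S. h (g z))" for g :: "nat \<Rightarrow> 'b" and S
    by (induction S rule: infinite_finite_induct) (auto simp: h0 H)
  have "map_mat h P = map_mat star (transpose_mat (map_mat h X)) * map_mat h X"
    using X by (intro eq_matI) (auto simp: scalar_prod_def hs H)
  then have "cstar_mat_positive m (map_mat h P)" using X unfolding cstar_mat_positive_def
    by (intro bexI[of _ "map_mat h X"]) auto
  moreover have "mat_amplification m k f (map_mat h P) = mat_amplification m k (f \<circ> h) P"
    using X div_lt_mult by (intro eq_matI) (auto simp: mat_amplification_def)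
  ultimately show "complex_mat_positive (m * k) (mat_amplification m k (f \<circ> h) P)" using f by (metis ccp_map_def)
qed (use f star_homD[OF h] in \<open>auto simp: ccp_map_def\<close>)

text \<open>Positivity of the \<open>2 \<times> 2\<close> matrix \<open>X\<^sup>* X\<close> with \<open>X\<close> having the row \<open>(x, y)\<close> makes the amplified matrix
Hermitian, which gives the claim for products \<open>x\<^sup>* y\<close>; products are dense.\<close>

lemma ccp_star:
  fixes f :: "'a::cstar_algebra \<Rightarrow> complex mat"
  assumes f: "ccp_map k f"
  shows "f (star a) = mat_adjoint (f a)"
proof -
  have carr: "f a \<in> carrier_mat k k" for a using f by (simp add: ccp_map_def)
  have fadd: "f (a + b) = f a + f b" for a b using f by (simp add: ccp_map_def)
  have fsc: "f (c *\<^sub>C a) = c \<cdot>\<^sub>m f a" for c a using f by (simp add: ccp_map_def)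
  have prod: "f (star x * y) $$ (r, s) = cnj (f (star y * x) $$ (s, r))" if rs: "r < k" "s < k" for x y r s
  proof -
    define X where "X = Matrix.mat 2 2 (\<lambda>(i::nat, j::nat). if i = 0 then (if j = 0 then x else y) else 0)"
    define P where "P = map_mat star (transpose_mat X) * X"
    have "cstar_mat_positive 2 P" unfolding cstar_mat_positive_def P_def by (rule bexI[of _ X]) (auto simp: X_def)
    then have "complex_mat_positive (2 * k) (mat_amplification 2 k f P)" using f by (simp add: ccp_map_def)
    then obtain Y where Y: "\<And>p q. p < 2 * k \<Longrightarrow> q < 2 * k \<Longrightarrow> mat_amplification 2 k f P $$ (p, q) = (\<Sum>t<2 * k. cnj (Y t p) * Y t q)"
      using positive_gram by blast
    have P: "P $$ (0, 1) = star x * y" "P $$ (1, 0) = star y * x"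
      by (simp_all add: P_def X_def scalar_prod_def numeral_2_eq_2)
    have "mat_amplification 2 k f P $$ (r, k + s) = f (star x * y) $$ (r, s)"
      using rs P by (simp add: mat_amplification_def)
    moreover have "mat_amplification 2 k f P $$ (k + s, r) = f (star y * x) $$ (s, r)"
      using rs P by (simp add: mat_amplification_def)
    moreover have "mat_amplification 2 k f P $$ (r, k + s) = cnj (mat_amplification 2 k f P $$ (k + s, r))"
      using rs Y[of r "k + s"] Y[of "k + s" r] by (simp add: mult.commute)
    ultimately show ?thesis by simp
  qed
  have ent: "f a $$ (r, s) = cnj (f (star a) $$ (s, r))" if rs: "r < k" "s < k" for r s a
  proof -
    define g where "g = (\<lambda>a. f a $$ (r, s) - cnj (f (star a) $$ (s, r)))"
    have bnd: "cmod (f a $$ (i, j)) \<le> norm a" if "i < k" "j < k" for a i j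
    proof -
      have "op_bounded k (ent (f a)) (norm a)" using f op_norm_le_iff[OF carr] by (simp add: ccp_map_def)
      then show ?thesis using op_bounded_entry that by (fastforce simp: ent_def)
    qed
    have "g a = 0"
    proof (rule bounded_functional_vanishing_on_products)
      show "g (x + y) = g x + g y" for x y
        using rs carr[of y] carr[of "star y"] by (simp add: g_def star_add fadd)
      show "g (c *\<^sub>C x) = c * g x" for c x
        using rs carr[of x] carr[of "star x"] by (simp add: g_def star_scaleC fsc algebra_simps)
      show "cmod (g x) \<le> 2 * norm x" for x
        using bnd[OF rs, of x] bnd[OF rs(2,1), of "star x"] norm_triangle_ineq4[of "f x $$ (r, s)" "cnj (f (star x) $$ (s, r))"]
        by (simp add: g_def norm_star)
      show "g (x * y) = 0" for x y using prod[OF rs, of "star x" y] by (simp add: g_def star_mult star_star)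
    qed
    then show ?thesis by (simp add: g_def)
  qed
  show ?thesis
  proof (rule eq_matI)
    fix i j assume "i < dim_row (mat_adjoint (f a))" "j < dim_col (mat_adjoint (f a))"
    then have "i < k" "j < k" using mat_adjoint_carrier[OF carr[of a]] by auto
    then show "f (star a) $$ (i, j) = mat_adjoint (f a) $$ (i, j)" using ent[of j i a] by (simp add: index_mat_adjoint[OF carr])
  qed (use carr[of "star a"] mat_adjoint_carrier[OF carr[of a]] in auto)
qed

section \<open>Amplification to a prescribed matrix size\<close>

text \<open>A block-diagonal matrix with \<open>c\<close> copies of \<open>T\<close>, filled up by zeros to the size \<open>N\<close>.\<close>

definition blk :: "nat \<Rightarrow> nat \<Rightarrow> nat \<Rightarrow> complex mat \<Rightarrow> complex mat" where
  "blk N k c T = Matrix.mat N N (\<lambda>(p, q). if p div k = q div k \<and> p div k < c then T $$ (p mod k, q mod k) else 0)"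

lemma blk_carrier [simp]: "blk N k c T \<in> carrier_mat N N" by (simp add: blk_def)

lemma ent_blk: "p < N \<Longrightarrow> q < N \<Longrightarrow>
    ent (blk N k c T) p q = (if p div k = q div k \<and> p div k < c then ent T (p mod k) (q mod k) else 0)"
  by (simp add: blk_def ent_def)

lemma sum_add_range: "(\<Sum>p<m + k. f p) = (\<Sum>p<m. f p) + (\<Sum>p<k. f (m + p))" for f :: "nat \<Rightarrow> 'x::comm_monoid_add"
  by (induction k) (auto simp: add.assoc)

lemma sum_blocks: "(\<Sum>p<c * k. f p) = (\<Sum>i<c. \<Sum>r<k. f (i * k + r))" for f :: "nat \<Rightarrow> 'x::comm_monoid_add"
proof (induction c)
  case (Suc c)
  have "(\<Sum>p<Suc c * k. f p) = (\<Sum>p<c * k + k. f p)" by (simp add: add.commute)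
  then show ?case by (simp add: sum_add_range Suc)
qed simp

lemma sum_blocks_le:
  fixes f :: "nat \<Rightarrow> 'x::comm_monoid_add"
  assumes "c * k \<le> N" "\<And>p. c * k \<le> p \<Longrightarrow> p < N \<Longrightarrow> f p = 0"
  shows "(\<Sum>p<N. f p) = (\<Sum>i<c. \<Sum>r<k. f (i * k + r))"
proof -
  have "(\<Sum>p<N. f p) = (\<Sum>p<c * k. f p)" using assms by (intro sum.mono_neutral_right) auto
  then show ?thesis by (simp add: sum_blocks)
qed

lemma div_ge: "0 < k \<Longrightarrow> c * k \<le> p \<Longrightarrow> \<not> p div k < (c::nat)"
  by (metis div_le_mono nonzero_mult_div_cancel_right not_gr_zero not_less)

context
  fixes N k c :: nat
  assumes k: "0 < k" and ck: "c * k \<le> N"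
begin

lemma block_index: "i < c \<Longrightarrow> r < k \<Longrightarrow> i * k + r < N"
proof -
  assume "i < c" "r < k"
  then have "i * k + r < (i + 1) * k" by simp
  also have "\<dots> \<le> c * k" using \<open>i < c\<close> by (intro mult_le_mono1) auto
  finally show ?thesis using ck by simp
qed

lemma blk_mult:
  assumes "S \<in> carrier_mat k k" "T \<in> carrier_mat k k"
  shows "blk N k c (S * T) = blk N k c S * blk N k c T"
proof (rule eq_matI)
  fix p q assume "p < dim_row (blk N k c S * blk N k c T)" "q < dim_col (blk N k c S * blk N k c T)"
  then have pq: "p < N" "q < N" by (auto simp: blk_def)
  have "(blk N k c S * blk N k c T) $$ (p, q) = (\<Sum>r<N. ent (blk N k c S) p r * ent (blk N k c T) r q)"
    using pq ent_mult[of "blk N k c S" N "blk N k c T" p q] by (simp add: ent_def kmult_def)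
  also have "\<dots> = (\<Sum>i<c. \<Sum>r<k. ent (blk N k c S) p (i * k + r) * ent (blk N k c T) (i * k + r) q)"
    by (rule sum_blocks_le[OF ck]) (use pq div_ge[OF k] in \<open>auto simp: ent_blk\<close>)
  also have "\<dots> = (\<Sum>i<c. \<Sum>r<k. if i = p div k then (if p div k = q div k then ent S (p mod k) r * ent T r (q mod k) else 0) else 0)"
    using pq block_index by (intro sum.cong refl) (auto simp: ent_blk)
  also have "\<dots> = (\<Sum>i<c. if i = p div k then (\<Sum>r<k. if p div k = q div k then ent S (p mod k) r * ent T r (q mod k) else 0) else 0)"
    by (intro sum.cong) auto
  also have "\<dots> = (if p div k = q div k \<and> p div k < c then (\<Sum>r<k. ent S (p mod k) r * ent T r (q mod k)) else 0)"
    by auto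
  also have "\<dots> = blk N k c (S * T) $$ (p, q)"
    using pq k ent_mult[OF assms, of "p mod k" "q mod k"] by (auto simp: blk_def ent_def kmult_def)
  finally show "blk N k c (S * T) $$ (p, q) = (blk N k c S * blk N k c T) $$ (p, q)" ..
qed (auto simp: blk_def)

lemma blk_diff: "S \<in> carrier_mat k k \<Longrightarrow> T \<in> carrier_mat k k \<Longrightarrow> blk N k c (S - T) = blk N k c S - blk N k c T"
  using k by (intro eq_matI) (auto simp: blk_def)

lemma blk_smult: "T \<in> carrier_mat k k \<Longrightarrow> blk N k c (z \<cdot>\<^sub>m T) = z \<cdot>\<^sub>m blk N k c T"
  using k by (intro eq_matI) (auto simp: blk_def)

lemma blk_adjoint: "T \<in> carrier_mat k k \<Longrightarrow> blk N k c (mat_adjoint T) = mat_adjoint (blk N k c T)"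
  using k index_mat_adjoint[of T k k] index_mat_adjoint[OF blk_carrier, of _ N _ k c T] mat_adjoint_carrier[OF blk_carrier, of N k c T]
  by (intro eq_matI) (auto simp: blk_def)

lemma blk_form:
  "inprod N u (kapply N (ent (blk N k c T)) v) = (\<Sum>i<c. inprod k (\<lambda>r. u (i * k + r)) (kapply k (ent T) (\<lambda>r. v (i * k + r))))"
proof -
  have "inprod N u (kapply N (ent (blk N k c T)) v) = (\<Sum>i<c. \<Sum>r<k. \<Sum>q<N. cnj (u (i * k + r)) * (ent (blk N k c T) (i * k + r) q * v q))"
    unfolding form_expand by (rule sum_blocks_le[OF ck]) (use div_ge[OF k] in \<open>auto simp: ent_blk\<close>)
  also have "\<dots> = (\<Sum>i<c. \<Sum>r<k. \<Sum>s<k. cnj (u (i * k + r)) * (ent T r s * v (i * k + s)))"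
  proof (rule sum.cong[OF refl], rule sum.cong[OF refl])
    fix i r assume ir: "i \<in> {..<c}" "r \<in> {..<k}"
    have "(\<Sum>q<N. cnj (u (i * k + r)) * (ent (blk N k c T) (i * k + r) q * v q)) =
       (\<Sum>j<c. \<Sum>s<k. cnj (u (i * k + r)) * (ent (blk N k c T) (i * k + r) (j * k + s) * v (j * k + s)))"
      by (rule sum_blocks_le[OF ck]) (use ir div_ge[OF k] block_index in \<open>auto simp: ent_blk\<close>)
    also have "\<dots> = (\<Sum>j<c. \<Sum>s<k. if j = i then cnj (u (i * k + r)) * (ent T r s * v (i * k + s)) else 0)"
      using ir block_index by (intro sum.cong refl) (auto simp: ent_blk)
    also have "\<dots> = (\<Sum>j<c. if j = i then (\<Sum>s<k. cnj (u (i * k + r)) * (ent T r s * v (i * k + s))) else 0)"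
      by (intro sum.cong) auto
    also have "\<dots> = (\<Sum>s<k. cnj (u (i * k + r)) * (ent T r s * v (i * k + s)))" using ir by simp
    finally show "(\<Sum>q<N. cnj (u (i * k + r)) * (ent (blk N k c T) (i * k + r) q * v q)) = (\<Sum>s<k. cnj (u (i * k + r)) * (ent T r s * v (i * k + s)))" .
  qed
  finally show ?thesis by (simp add: form_expand)
qed

lemma op_norm_blk:
  assumes T: "T \<in> carrier_mat k k"
  shows "op_norm (blk N k c T) \<le> op_norm T"
proof -
  have sub: "(\<Sum>i<c. (vnorm k (\<lambda>r. u (i * k + r)))\<^sup>2) \<le> (vnorm N u)\<^sup>2" for u
  proof -
    have "(\<Sum>i<c. (vnorm k (\<lambda>r. u (i * k + r)))\<^sup>2) = (\<Sum>p<c * k. (cmod (u p))\<^sup>2)" by (simp add: vnorm_sq sum_blocks)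
    also have "\<dots> \<le> (vnorm N u)\<^sup>2" unfolding vnorm_sq using ck by (intro sum_mono2) auto
    finally show ?thesis .
  qed
  have "op_bounded N (ent (blk N k c T)) (op_norm T)"
    by (rule op_bounded_compression[where I = "{..<c}" and k = "\<lambda>_. k" and T = "\<lambda>_. ent T" and U = "\<lambda>i u r. u (i * k + r)" and V = "\<lambda>i u r. u (i * k + r)"])
       (use blk_form sub op_bounded_op_norm[OF T] op_norm_nonneg[OF T] in \<open>auto simp: op_bounded_def\<close>)
  then show ?thesis by (simp add: op_norm_le_iff[OF blk_carrier op_norm_nonneg[OF T]])
qed

lemma frob_blk:
  shows "(frob N (ent (blk N k c T)))\<^sup>2 = real c * (frob k (ent T))\<^sup>2"
proof -
  have "(frob N (ent (blk N k c T)))\<^sup>2 = (\<Sum>i<c. \<Sum>r<k. \<Sum>q<N. (cmod (ent (blk N k c T) (i * k + r) q))\<^sup>2)"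
    unfolding frob_sq by (rule sum_blocks_le[OF ck]) (use div_ge[OF k] in \<open>auto simp: ent_blk\<close>)
  also have "\<dots> = (\<Sum>i<c. \<Sum>r<k. \<Sum>s<k. (cmod (ent T r s))\<^sup>2)"
  proof (rule sum.cong[OF refl], rule sum.cong[OF refl])
    fix i r assume ir: "i \<in> {..<c}" "r \<in> {..<k}"
    have "(\<Sum>q<N. (cmod (ent (blk N k c T) (i * k + r) q))\<^sup>2) = (\<Sum>j<c. \<Sum>s<k. (cmod (ent (blk N k c T) (i * k + r) (j * k + s)))\<^sup>2)"
      by (rule sum_blocks_le[OF ck]) (use ir div_ge[OF k] block_index in \<open>auto simp: ent_blk\<close>)
    also have "\<dots> = (\<Sum>j<c. \<Sum>s<k. if j = i then (cmod (ent T r s))\<^sup>2 else 0)"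
      using ir block_index by (intro sum.cong refl) (auto simp: ent_blk)
    also have "\<dots> = (\<Sum>j<c. if j = i then (\<Sum>s<k. (cmod (ent T r s))\<^sup>2) else 0)"
      by (intro sum.cong) auto
    also have "\<dots> = (\<Sum>s<k. (cmod (ent T r s))\<^sup>2)" using ir by simp
    finally show "(\<Sum>q<N. (cmod (ent (blk N k c T) (i * k + r) q))\<^sup>2) = (\<Sum>s<k. (cmod (ent T r s))\<^sup>2)" .
  qed
  finally show ?thesis by (simp add: frob_sq)
qed

lemma hs_norm_blk:
  assumes T: "T \<in> carrier_mat k k"
  shows "hs_norm (blk N k c T) \<le> hs_norm T"
proof (cases "N = 0")
  case True
  then show ?thesis by (simp add: hs_norm_eq[OF T] hs_norm_eq[OF blk_carrier])
next
  case False
  have "(hs_norm (blk N k c T))\<^sup>2 = real c * (frob k (ent T))\<^sup>2 / real N"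
    by (simp add: hs_norm_eq[OF blk_carrier] power_divide frob_blk)
  also have "\<dots> \<le> (frob k (ent T))\<^sup>2 / real k"
  proof -
    have "real c * real k \<le> real N" using ck by (metis of_nat_le_iff of_nat_mult)
    then have "real c * real k * (frob k (ent T))\<^sup>2 \<le> real N * (frob k (ent T))\<^sup>2" by (intro mult_right_mono) auto
    then show ?thesis using k False by (simp add: divide_simps mult_ac)
  qed
  also have "\<dots> = (hs_norm T)\<^sup>2" by (simp add: hs_norm_eq[OF T] power_divide)
  finally show ?thesis by (rule power2_le_imp_le) (simp add: hs_norm_eq[OF T])
qed

lemma mat_tr_blk:
  assumes T: "T \<in> carrier_mat k k"
  shows "mat_tr (blk N k c T) = of_real (real (c * k) / real N) * mat_tr T"
proof -
  have "(\<Sum>p<N. ent (blk N k c T) p p) = (\<Sum>i<c. \<Sum>r<k. ent (blk N k c T) (i * k + r) (i * k + r))"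
    by (rule sum_blocks_le[OF ck]) (use div_ge[OF k] in \<open>auto simp: ent_blk\<close>)
  also have "\<dots> = (\<Sum>i<c. \<Sum>r<k. ent T r r)" using block_index by (intro sum.cong refl) (auto simp: ent_blk)
  finally have "(\<Sum>p<N. ent (blk N k c T) p p) = of_nat c * (\<Sum>r<k. ent T r r)" by simp
  then show ?thesis using k by (simp add: mat_tr_eq[OF T] mat_tr_eq[OF blk_carrier])
qed

end

text \<open>The amplification in the form \<open>\<Sum> W\<^sub>i\<^sup>* T W\<^sub>i\<close> to which \<open>ccp_combine\<close> applies.\<close>

lemma blk_entry_sum:
  assumes k: "0 < k" and ck: "c * k \<le> N" and pq: "p < N" "q < N"
  shows "blk N k c T $$ (p, q) = (\<Sum>i<c. \<Sum>r<k. \<Sum>s<k. cnj (if p = i * k + r then 1 else 0) * T $$ (r, s) * (if q = i * k + s then 1 else 0))"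
proof -
  have d: "p = i * k + r \<longleftrightarrow> i = p div k \<and> r = p mod k" if "r < k" for i r p :: nat
    using that by (auto simp: div_mult_mod_eq)
  have "(\<Sum>i<c. \<Sum>r<k. \<Sum>s<k. cnj (if p = i * k + r then 1 else 0) * T $$ (r, s) * (if q = i * k + s then 1 else 0)) =
    (\<Sum>i<c. \<Sum>r<k. \<Sum>s<k. if s = q mod k then (if r = p mod k then (if i = p div k \<and> i = q div k then T $$ (r, s) else 0) else 0) else 0)"
    by (intro sum.cong refl) (auto simp: d)
  also have "\<dots> = (\<Sum>i<c. if i = p div k then (if p div k = q div k then T $$ (p mod k, q mod k) else 0) else 0)"
    using k by (intro sum.cong refl) auto
  also have "\<dots> = blk N k c T $$ (p, q)" using pq by (auto simp: blk_def)
  finally show ?thesis ..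
qed

subsection \<open>Comparison of trace, Hilbert-Schmidt norm and operator norm\<close>

lemma hs_norm_nonneg: "T \<in> carrier_mat N N \<Longrightarrow> 0 \<le> hs_norm T"
  by (simp add: hs_norm_eq)

lemma mat_tr_le_hs:
  assumes T: "T \<in> carrier_mat N N"
  shows "cmod (mat_tr T) \<le> hs_norm T"
proof (cases "N = 0")
  case False
  have "cmod (\<Sum>p<N. ent T p p) \<le> (\<Sum>p<N. \<bar>1\<bar> * \<bar>cmod (ent T p p)\<bar>)" by (simp add: norm_sum)
  also have "\<dots> \<le> L2_set (\<lambda>_. 1) {..<N} * L2_set (\<lambda>p. cmod (ent T p p)) {..<N}" by (rule L2_set_mult_ineq)
  also have "\<dots> \<le> sqrt N * frob N (ent T)"
  proof (intro mult_mono)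
    have "(L2_set (\<lambda>p. cmod (ent T p p)) {..<N})\<^sup>2 \<le> (frob N (ent T))\<^sup>2"
      unfolding frob_sq L2_set_def by (simp add: sum_nonneg) (intro sum_mono member_le_sum, auto)
    then show "L2_set (\<lambda>p. cmod (ent T p p)) {..<N} \<le> frob N (ent T)" by (rule power2_le_imp_le) simp
  qed (auto simp: L2_set_def intro: sum_nonneg)
  finally have "cmod (\<Sum>p<N. ent T p p) / N \<le> sqrt N * frob N (ent T) / N" by (simp add: divide_right_mono)
  also have "\<dots> = frob N (ent T) / sqrt N" using False by (simp add: field_simps flip: real_sqrt_mult)
  finally show ?thesis by (simp add: mat_tr_eq[OF T] hs_norm_eq[OF T] norm_divide)
qed (simp add: mat_tr_eq[OF T] hs_norm_eq[OF T])

lemma hs_le_op: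
  assumes T: "T \<in> carrier_mat N N" and N: "0 < N"
  shows "hs_norm T \<le> op_norm T"
  using frob_le_op_bounded[OF op_bounded_op_norm[OF T] op_norm_nonneg[OF T]] N by (simp add: hs_norm_eq[OF T] divide_le_eq)

section \<open>Asymptotic homomorphisms and their liftings\<close>

text \<open>Kernel \<open>n\<close> of the sequence has size \<open>Suc n\<close>.\<close>

definition hs_null :: "nat filter \<Rightarrow> (nat \<Rightarrow> nat \<Rightarrow> nat \<Rightarrow> complex) \<Rightarrow> bool" where
  "hs_null F T \<longleftrightarrow> ((\<lambda>n. frob (Suc n) (T n) / sqrt (Suc n)) \<longlongrightarrow> 0) F"

lemma hs_null_bound:
  assumes "hs_null F S" "\<And>n. frob (Suc n) (T n) \<le> C * frob (Suc n) (S n)"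
  shows "hs_null F T"
  unfolding hs_null_def
proof (rule tendsto_sandwich[OF _ _ tendsto_const])
  show "((\<lambda>n. C * (frob (Suc n) (S n) / sqrt (Suc n))) \<longlongrightarrow> 0) F"
    using tendsto_mult_left_zero[OF assms(1)[unfolded hs_null_def], of C] by (simp add: mult.commute)
  show "\<forall>\<^sub>F n in F. frob (Suc n) (T n) / sqrt (Suc n) \<le> C * (frob (Suc n) (S n) / sqrt (Suc n))"
    using assms(2) by (intro always_eventually allI) (simp add: divide_right_mono)
qed auto

lemma hs_null_add:
  assumes "hs_null F S" "hs_null F T"
  shows "hs_null F (\<lambda>n p q. S n p q + T n p q)"
  unfolding hs_null_def
proof (rule tendsto_sandwich[OF _ _ tendsto_const tendsto_add_zero[OF assms[unfolded hs_null_def]]])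
  show "\<forall>\<^sub>F n in F. frob (Suc n) (\<lambda>p q. S n p q + T n p q) / sqrt (Suc n)
      \<le> frob (Suc n) (S n) / sqrt (Suc n) + frob (Suc n) (T n) / sqrt (Suc n)"
    unfolding add_divide_distrib[symmetric]
    by (intro always_eventually allI divide_right_mono frob_triangle) simp
qed auto

lemma hs_null_cong: "hs_null F S \<Longrightarrow> (\<And>n p q. p < Suc n \<Longrightarrow> q < Suc n \<Longrightarrow> T n p q = S n p q) \<Longrightarrow> hs_null F T"
proof -
  assume S: "hs_null F S" and e: "\<And>n p q. p < Suc n \<Longrightarrow> q < Suc n \<Longrightarrow> T n p q = S n p q"
  have "frob (Suc n) (T n) = frob (Suc n) (S n)" for n by (rule frob_cong) (rule e)
  then show ?thesis using S by (simp add: hs_null_def)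
qed

lemma hs_null_scale: "hs_null F S \<Longrightarrow> hs_null F (\<lambda>n p q. c * S n p q)"
  by (erule hs_null_bound[where C = "cmod c"]) (simp add: frob_scale)

lemma hs_null_diff: "hs_null F S \<Longrightarrow> hs_null F T \<Longrightarrow> hs_null F (\<lambda>n p q. S n p q - T n p q)"
  using hs_null_add[OF _ hs_null_scale[of F T "-1"], of S] by simp

lemma hs_null_zero: "hs_null F (\<lambda>n p q. 0)"
  by (simp add: hs_null_def frob_def L2_set_def)

lemma hs_null_adj: "hs_null F S \<Longrightarrow> hs_null F (\<lambda>n. adj (S n))"
  by (erule hs_null_bound[where C = 1]) (simp add: frob_adj)

lemma hs_null_kmult_left: "hs_null F S \<Longrightarrow> (\<And>n. op_bounded (Suc n) (A n) C) \<Longrightarrow> 0 \<le> C \<Longrightarrow> hs_null F (\<lambda>n. kmult (Suc n) (A n) (S n))"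
  by (erule hs_null_bound[where C = C]) (simp add: frob_kmult_left)

lemma hs_null_kmult_right: "hs_null F S \<Longrightarrow> (\<And>n. op_bounded (Suc n) (A n) C) \<Longrightarrow> 0 \<le> C \<Longrightarrow> hs_null F (\<lambda>n. kmult (Suc n) (S n) (A n))"
  by (erule hs_null_bound[where C = C]) (simp add: frob_kmult_right)

lemma hs_null_iff_hs_norm:
  "(\<And>n. T n \<in> carrier_mat (Suc n) (Suc n)) \<Longrightarrow> hs_null F (\<lambda>n. ent (T n)) \<longleftrightarrow> ((\<lambda>n. hs_norm (T n)) \<longlongrightarrow> 0) F"
proof -
  assume c: "\<And>n. T n \<in> carrier_mat (Suc n) (Suc n)"
  show ?thesis unfolding hs_null_def hs_norm_eq[OF c] ..
qed

lemma kmult_diff_left: "kmult N (\<lambda>p q. a p q - b p q) c = (\<lambda>p q. kmult N a c p q - kmult N b c p q)"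
  by (simp add: kmult_def left_diff_distrib sum_subtractf)

lemma kmult_diff_right: "kmult N c (\<lambda>p q. a p q - b p q) = (\<lambda>p q. kmult N c a p q - kmult N c b p q)"
  by (simp add: kmult_def right_diff_distrib sum_subtractf)

lemma kmult_cong: "(\<And>p q. p < N \<Longrightarrow> q < N \<Longrightarrow> a p q = a' p q) \<Longrightarrow> (\<And>p q. p < N \<Longrightarrow> q < N \<Longrightarrow> b p q = b' p q) \<Longrightarrow>
   p < N \<Longrightarrow> q < N \<Longrightarrow> kmult N a b p q = kmult N a' b' p q"
  by (simp add: kmult_def)

subsection \<open>The algebra of matrix sequences\<close>

lemma matseq_carrier_iff:
  "T \<in> carrier matseq_alg \<longleftrightarrow> (\<forall>n. T n \<in> carrier_mat (Suc n) (Suc n)) \<and> (\<exists>C\<ge>0. \<forall>n. op_bounded (Suc n) (ent (T n)) C)"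
proof
  assume T: "T \<in> carrier matseq_alg"
  then have c: "T n \<in> carrier_mat (Suc n) (Suc n)" for n by (simp add: matseq_alg_def)
  obtain C where C: "\<And>n. op_norm (T n) \<le> C" using T by (auto simp: matseq_alg_def bdd_above_def)
  have "0 \<le> C" using op_norm_nonneg[OF c] C order_trans by blast
  moreover have "op_bounded (Suc n) (ent (T n)) C" for n using op_bounded_mono[OF op_bounded_op_norm[OF c] C] .
  ultimately show "(\<forall>n. T n \<in> carrier_mat (Suc n) (Suc n)) \<and> (\<exists>C\<ge>0. \<forall>n. op_bounded (Suc n) (ent (T n)) C)" using c by blast
next
  assume T: "(\<forall>n. T n \<in> carrier_mat (Suc n) (Suc n)) \<and> (\<exists>C\<ge>0. \<forall>n. op_bounded (Suc n) (ent (T n)) C)"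
  then obtain C where C: "C \<ge> 0" "\<And>n. op_bounded (Suc n) (ent (T n)) C" by blast
  then have "op_norm (T n) \<le> C" for n using T op_norm_le_iff by blast
  then show "T \<in> carrier matseq_alg" using T by (auto simp: matseq_alg_def bdd_above_def)
qed

lemma matseq_closed:
  assumes S: "S \<in> carrier matseq_alg" and T: "T \<in> carrier matseq_alg"
  shows "(\<lambda>n. S n + T n) \<in> carrier matseq_alg" "(\<lambda>n. S n - T n) \<in> carrier matseq_alg"
    "(\<lambda>n. c \<cdot>\<^sub>m T n) \<in> carrier matseq_alg" "(\<lambda>n. S n * T n) \<in> carrier matseq_alg" "(\<lambda>n. mat_adjoint (T n)) \<in> carrier matseq_alg"
proof -
  obtain C where C: "C \<ge> 0" "\<And>n. op_bounded (Suc n) (ent (S n)) C" and Sc: "\<And>n. S n \<in> carrier_mat (Suc n) (Suc n)"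
    using S by (auto simp: matseq_carrier_iff)
  obtain D where D: "D \<ge> 0" "\<And>n. op_bounded (Suc n) (ent (T n)) D" and Tc: "\<And>n. T n \<in> carrier_mat (Suc n) (Suc n)"
    using T by (auto simp: matseq_carrier_iff)
  have "op_bounded (Suc n) (ent (S n + T n)) (C + D)" for n
    by (rule op_bounded_cong[OF op_bounded_add[OF C(2) D(2)]]) (simp add: ent_add[OF Tc])
  then show "(\<lambda>n. S n + T n) \<in> carrier matseq_alg" unfolding matseq_carrier_iff using Sc Tc C D
    by (intro conjI exI[of _ "C + D"]) auto
  have "op_bounded (Suc n) (ent (S n - T n)) (C + D)" for n
    by (rule op_bounded_cong[OF op_bounded_diff[OF C(2) D(2)]]) (simp add: ent_diff[OF Tc])
  then show "(\<lambda>n. S n - T n) \<in> carrier matseq_alg" unfolding matseq_carrier_iff using Sc Tc C D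
    by (intro conjI exI[of _ "C + D"]) (auto intro: minus_carrier_mat)
  have "op_bounded (Suc n) (ent (c \<cdot>\<^sub>m T n)) (cmod c * D)" for n
    by (rule op_bounded_cong[OF op_bounded_scale[OF D(2)]]) (simp add: ent_smult[OF Tc])
  then show "(\<lambda>n. c \<cdot>\<^sub>m T n) \<in> carrier matseq_alg" unfolding matseq_carrier_iff using Tc D
    by (intro conjI exI[of _ "cmod c * D"]) auto
  have "op_bounded (Suc n) (ent (S n * T n)) (C * D)" for n
    by (rule op_bounded_cong[OF op_bounded_kmult[OF C(2) D(2) C(1)]]) (simp add: ent_mult[OF Sc Tc])
  then show "(\<lambda>n. S n * T n) \<in> carrier matseq_alg" unfolding matseq_carrier_iff using Sc Tc C D
    by (intro conjI exI[of _ "C * D"]) (auto intro: mult_carrier_mat)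
  have "op_bounded (Suc n) (ent (mat_adjoint (T n))) D" for n
    by (rule op_bounded_cong[OF op_bounded_adj[OF D(2) D(1)]]) (simp add: ent_adjoint[OF Tc])
  then show "(\<lambda>n. mat_adjoint (T n)) \<in> carrier matseq_alg" unfolding matseq_carrier_iff using mat_adjoint_carrier[OF Tc] D
    by (intro conjI exI[of _ D]) auto
qed

lemma matseq_rel_iff:
  "(S, T) \<in> matseq_rel \<omega> \<longleftrightarrow> S \<in> carrier matseq_alg \<and> T \<in> carrier matseq_alg \<and> hs_null \<omega> (\<lambda>n p q. ent (S n) p q - ent (T n) p q)"
proof (cases "S \<in> carrier matseq_alg \<and> T \<in> carrier matseq_alg")
  case True
  then have c: "(\<lambda>n. S n - T n) \<in> carrier matseq_alg" by (simp add: matseq_closed)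
  then have c': "\<And>n. S n - T n \<in> carrier_mat (Suc n) (Suc n)" and Tc: "\<And>n. T n \<in> carrier_mat (Suc n) (Suc n)"
    using True by (auto simp: matseq_carrier_iff)
  have "(S, T) \<in> matseq_rel \<omega> \<longleftrightarrow> hs_null \<omega> (\<lambda>n. ent (S n - T n))"
    using True c by (simp add: matseq_rel_def matseq_null_def hs_null_iff_hs_norm[OF c'])
  also have "\<dots> \<longleftrightarrow> hs_null \<omega> (\<lambda>n p q. ent (S n) p q - ent (T n) p q)"
    using ent_diff[OF Tc] by (auto elim!: hs_null_cong)
  finally show ?thesis using True by simp
qed (auto simp: matseq_rel_def)

lemma matseq_rel_equiv: "equiv (carrier matseq_alg) (matseq_rel \<omega>)"
proof (rule equivI)
  show "matseq_rel \<omega> \<subseteq> carrier matseq_alg \<times> carrier matseq_alg" by (auto simp: matseq_rel_iff)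
  show "refl_on (carrier matseq_alg) (matseq_rel \<omega>)"
    by (auto simp: refl_on_def matseq_rel_iff hs_null_zero)
  show "sym (matseq_rel \<omega>)"
  proof (rule symI)
    fix S T assume "(S, T) \<in> matseq_rel \<omega>"
    then show "(T, S) \<in> matseq_rel \<omega>" using hs_null_scale[of \<omega> "\<lambda>n p q. ent (S n) p q - ent (T n) p q" "-1"]
      by (simp add: matseq_rel_iff)
  qed
  show "trans (matseq_rel \<omega>)"
  proof (rule transI)
    fix S T U assume "(S, T) \<in> matseq_rel \<omega>" "(T, U) \<in> matseq_rel \<omega>"
    then show "(S, U) \<in> matseq_rel \<omega>"
      using hs_null_add[of \<omega> "\<lambda>n p q. ent (S n) p q - ent (T n) p q" "\<lambda>n p q. ent (T n) p q - ent (U n) p q"]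
      by (simp add: matseq_rel_iff)
  qed
qed

lemma matseq_rel_ops:
  assumes S: "(S, S') \<in> matseq_rel \<omega>" and T: "(T, T') \<in> matseq_rel \<omega>"
  shows "((\<lambda>n. S n + T n), (\<lambda>n. S' n + T' n)) \<in> matseq_rel \<omega>"
    "((\<lambda>n. c \<cdot>\<^sub>m T n), (\<lambda>n. c \<cdot>\<^sub>m T' n)) \<in> matseq_rel \<omega>"
    "((\<lambda>n. S n * T n), (\<lambda>n. S' n * T' n)) \<in> matseq_rel \<omega>"
    "((\<lambda>n. mat_adjoint (T n)), (\<lambda>n. mat_adjoint (T' n))) \<in> matseq_rel \<omega>"
proof -
  have m: "S \<in> carrier matseq_alg" "S' \<in> carrier matseq_alg" "T \<in> carrier matseq_alg" "T' \<in> carrier matseq_alg"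
    using assms by (auto simp: matseq_rel_iff)
  then have c: "\<And>n. S n \<in> carrier_mat (Suc n) (Suc n)" "\<And>n. S' n \<in> carrier_mat (Suc n) (Suc n)"
    "\<And>n. T n \<in> carrier_mat (Suc n) (Suc n)" "\<And>n. T' n \<in> carrier_mat (Suc n) (Suc n)"
    by (auto simp: matseq_carrier_iff)
  note cl = matseq_closed[OF m(1,3)] matseq_closed[OF m(2,4)]
  let ?S = "\<lambda>n p q. ent (S n) p q - ent (S' n) p q" and ?T = "\<lambda>n p q. ent (T n) p q - ent (T' n) p q"
  have n: "hs_null \<omega> ?S" "hs_null \<omega> ?T" using assms by (auto simp: matseq_rel_iff)
  show "((\<lambda>n. S n + T n), (\<lambda>n. S' n + T' n)) \<in> matseq_rel \<omega>"
    unfolding matseq_rel_iff using cl hs_null_cong[OF hs_null_add[OF n]] by (auto simp: ent_add[OF c(3)] ent_add[OF c(4)])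
  show "((\<lambda>n. c \<cdot>\<^sub>m T n), (\<lambda>n. c \<cdot>\<^sub>m T' n)) \<in> matseq_rel \<omega>"
    unfolding matseq_rel_iff using cl hs_null_cong[OF hs_null_scale[OF n(2), of c]]
    by (auto simp: ent_smult[OF c(3)] ent_smult[OF c(4)] right_diff_distrib)
  show "((\<lambda>n. mat_adjoint (T n)), (\<lambda>n. mat_adjoint (T' n))) \<in> matseq_rel \<omega>"
    unfolding matseq_rel_iff using cl hs_null_cong[OF hs_null_adj[OF n(2)]]
    by (auto simp: ent_adjoint[OF c(3)] ent_adjoint[OF c(4)] adj_def)
  obtain C where C: "C \<ge> 0" "\<And>n. op_bounded (Suc n) (ent (S n)) C" using m(1) by (auto simp: matseq_carrier_iff)
  obtain D where D: "D \<ge> 0" "\<And>n. op_bounded (Suc n) (ent (T' n)) D" using m(4) by (auto simp: matseq_carrier_iff)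
  have "hs_null \<omega> (\<lambda>n p q. kmult (Suc n) (ent (S n)) (?T n) p q + kmult (Suc n) (?S n) (ent (T' n)) p q)"
    by (intro hs_null_add hs_null_kmult_left[OF n(2) C(2,1)] hs_null_kmult_right[OF n(1) D(2,1)])
  then have "hs_null \<omega> (\<lambda>n p q. ent (S n * T n) p q - ent (S' n * T' n) p q)"
    by (rule hs_null_cong) (simp add: ent_mult[OF c(1,3)] ent_mult[OF c(2,4)] kmult_diff_left kmult_diff_right)
  then show "((\<lambda>n. S n * T n), (\<lambda>n. S' n * T' n)) \<in> matseq_rel \<omega>" unfolding matseq_rel_iff using cl by auto
qed

text \<open>The operations respect the relation, so the unions over representatives collapse.\<close>

lemma matseq_class_ops:
  assumes S: "S \<in> carrier matseq_alg" and T: "T \<in> carrier matseq_alg"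
  shows "sa_add (matseq_quot_alg \<omega>) (matseq_rel \<omega> `` {S}) (matseq_rel \<omega> `` {T}) = matseq_rel \<omega> `` {\<lambda>n. S n + T n}"
    "sa_scale (matseq_quot_alg \<omega>) c (matseq_rel \<omega> `` {T}) = matseq_rel \<omega> `` {\<lambda>n. c \<cdot>\<^sub>m T n}"
    "sa_mult (matseq_quot_alg \<omega>) (matseq_rel \<omega> `` {S}) (matseq_rel \<omega> `` {T}) = matseq_rel \<omega> `` {\<lambda>n. S n * T n}"
    "sa_star (matseq_quot_alg \<omega>) (matseq_rel \<omega> `` {T}) = matseq_rel \<omega> `` {\<lambda>n. mat_adjoint (T n)}"
proof -
  note eq = equiv_class_eq[OF matseq_rel_equiv, symmetric]
  have r: "(S, S) \<in> matseq_rel \<omega>" "(T, T) \<in> matseq_rel \<omega>" using S T by (auto simp: matseq_rel_iff hs_null_zero)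
  have un: "(\<Union>x\<in>A. f x) = c" if "a \<in> A" "\<And>x. x \<in> A \<Longrightarrow> f x = c" for A :: "(nat \<Rightarrow> complex mat) set" and a f and c :: "(nat \<Rightarrow> complex mat) set"
    using that by auto
  show "sa_add (matseq_quot_alg \<omega>) (matseq_rel \<omega> `` {S}) (matseq_rel \<omega> `` {T}) = matseq_rel \<omega> `` {\<lambda>n. S n + T n}"
    unfolding matseq_quot_alg_def matseq_alg_def star_alg.simps
    by (rule un[of S], use r in simp, rule un[of T], use r in simp, rule eq, rule matseq_rel_ops) auto
  show "sa_scale (matseq_quot_alg \<omega>) c (matseq_rel \<omega> `` {T}) = matseq_rel \<omega> `` {\<lambda>n. c \<cdot>\<^sub>m T n}"
    unfolding matseq_quot_alg_def matseq_alg_def star_alg.simps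
    by (rule un[of T], use r in simp, rule eq, rule matseq_rel_ops) (use r in auto)
  show "sa_mult (matseq_quot_alg \<omega>) (matseq_rel \<omega> `` {S}) (matseq_rel \<omega> `` {T}) = matseq_rel \<omega> `` {\<lambda>n. S n * T n}"
    unfolding matseq_quot_alg_def matseq_alg_def star_alg.simps
    by (rule un[of S], use r in simp, rule un[of T], use r in simp, rule eq, rule matseq_rel_ops) auto
  show "sa_star (matseq_quot_alg \<omega>) (matseq_rel \<omega> `` {T}) = matseq_rel \<omega> `` {\<lambda>n. mat_adjoint (T n)}"
    unfolding matseq_quot_alg_def matseq_alg_def star_alg.simps
    by (rule un[of T], use r in simp, rule eq, rule matseq_rel_ops) (use r in auto)
qed

subsection \<open>Lifting through Hilbert-Schmidt stability\<close>

text \<open>The filter is the ultrafilter in the end; the maps are first obtained for \<^term>\<open>sequentially\<close>.\<close>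

locale asymp_hom =
  fixes F :: "nat filter" and \<phi> :: "nat \<Rightarrow> 'a::cstar_algebra \<Rightarrow> complex mat"
  assumes carr: "\<And>n a. \<phi> n a \<in> carrier_mat (Suc n) (Suc n)"
    and mult: "\<And>a b. ((\<lambda>n. hs_norm (\<phi> n (a * b) - \<phi> n a * \<phi> n b)) \<longlongrightarrow> 0) F"
    and lin: "\<And>c d a b. ((\<lambda>n. hs_norm (\<phi> n (c *\<^sub>C a + d *\<^sub>C b) - c \<cdot>\<^sub>m \<phi> n a - d \<cdot>\<^sub>m \<phi> n b)) \<longlongrightarrow> 0) F"
    and star: "\<And>a. ((\<lambda>n. hs_norm (\<phi> n (star a) - mat_adjoint (\<phi> n a))) \<longlongrightarrow> 0) F"
    and bdd: "\<And>a. bdd_above (range (\<lambda>n. op_norm (\<phi> n a)))"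
begin

abbreviation X :: "'a \<Rightarrow> nat \<Rightarrow> nat \<Rightarrow> nat \<Rightarrow> complex" where "X a n \<equiv> ent (\<phi> n a)"

lemma in_matseq: "(\<lambda>n. \<phi> n a) \<in> carrier matseq_alg"
  using carr bdd by (simp add: matseq_alg_def)

lemma bound: "\<exists>C\<ge>0. \<forall>n. op_bounded (Suc n) (X a n) C"
  using in_matseq[of a] by (simp add: matseq_carrier_iff)

lemma hs_null_mult: "hs_null F (\<lambda>n p q. X (a * b) n p q - kmult (Suc n) (X a n) (X b n) p q)"
proof -
  have c: "\<phi> n a * \<phi> n b \<in> carrier_mat (Suc n) (Suc n)" for n using mult_carrier_mat[OF carr carr] .
  have "hs_null F (\<lambda>n. ent (\<phi> n (a * b) - \<phi> n a * \<phi> n b))"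
    using mult by (subst hs_null_iff_hs_norm) (auto intro: minus_carrier_mat[OF c])
  then show ?thesis by (rule hs_null_cong) (simp add: ent_diff[OF c] ent_mult[OF carr carr])
qed

lemma hs_null_star: "hs_null F (\<lambda>n p q. X (star a) n p q - adj (X a n) p q)"
proof -
  have c: "mat_adjoint (\<phi> n a) \<in> carrier_mat (Suc n) (Suc n)" for n using mat_adjoint_carrier[OF carr] .
  have "hs_null F (\<lambda>n. ent (\<phi> n (star a) - mat_adjoint (\<phi> n a)))"
    using star by (subst hs_null_iff_hs_norm) (auto intro: minus_carrier_mat[OF c])
  then show ?thesis by (rule hs_null_cong) (simp add: ent_diff[OF c] ent_adjoint[OF carr])
qed

lemma hs_null_lin: "hs_null F (\<lambda>n p q. X (c *\<^sub>C a + d *\<^sub>C b) n p q - c * X a n p q - d * X b n p q)"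
proof -
  have ca: "c \<cdot>\<^sub>m \<phi> n a \<in> carrier_mat (Suc n) (Suc n)" for n using carr by simp
  have cb: "d \<cdot>\<^sub>m \<phi> n b \<in> carrier_mat (Suc n) (Suc n)" for n using carr by simp
  have "hs_null F (\<lambda>n. ent (\<phi> n (c *\<^sub>C a + d *\<^sub>C b) - c \<cdot>\<^sub>m \<phi> n a - d \<cdot>\<^sub>m \<phi> n b))"
    using lin by (subst hs_null_iff_hs_norm) (auto intro: minus_carrier_mat[OF cb])
  then show ?thesis by (rule hs_null_cong) (simp add: ent_diff[OF ca] ent_diff[OF cb] ent_smult[OF carr])
qed

lemma hs_null_diff_lin: "hs_null F (\<lambda>n p q. X (a - b) n p q - (X a n p q - X b n p q))"
  using hs_null_lin[of 1 a "-1" b] by (simp add: scaleC_one scaleC_minus_one algebra_simps)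

text \<open>The classes of \<open>\<phi> n a\<close> form a homomorphism into the quotient by the null sequences exactly because the
errors of \<open>\<phi>\<close> are null.\<close>

lemma lift_hom:
  assumes "hilbert_schmidt_stable F TYPE('a)"
  shows "\<exists>\<psi>. (\<forall>n. mat_rep (Suc n) (\<psi> n)) \<and> (\<forall>a. hs_null F (\<lambda>n p q. ent (\<psi> n a) p q - X a n p q))"
proof -
  define \<pi> where "\<pi> = (\<lambda>a. matseq_rel F `` {\<lambda>n. \<phi> n a})"
  note eq = equiv_class_eq[OF matseq_rel_equiv]
  note cl = matseq_closed[OF in_matseq in_matseq]
  have m: "c \<cdot>\<^sub>m \<phi> n a \<in> carrier_mat (Suc n) (Suc n)" for c n a using carr by simp
  have "star_hom cstar_alg (matseq_quot_alg F) \<pi>"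
    unfolding star_hom_def
  proof (intro conjI allI ballI)
    have "\<pi> a \<in> carrier (matseq_quot_alg F)" for a
      using in_matseq quotientI[of _ "carrier matseq_alg" "matseq_rel F"] by (simp add: matseq_quot_alg_def \<pi>_def)
    then show "\<pi> \<in> carrier cstar_alg \<rightarrow> carrier (matseq_quot_alg F)" by auto
  next
    fix a b :: 'a
    have "hs_null F (\<lambda>n p q. X (a + b) n p q - ent (\<phi> n a + \<phi> n b) p q)"
      by (rule hs_null_cong[OF hs_null_lin[of 1 a 1 b]]) (simp add: scaleC_one ent_add[OF carr])
    then show "\<pi> (sa_add cstar_alg a b) = sa_add (matseq_quot_alg F) (\<pi> a) (\<pi> b)"
      unfolding \<pi>_def matseq_class_ops[OF in_matseq in_matseq] using in_matseq cl
      by (intro eq) (simp add: matseq_rel_iff cstar_alg_def)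
    have "hs_null F (\<lambda>n p q. X (a * b) n p q - ent (\<phi> n a * \<phi> n b) p q)"
      by (rule hs_null_cong[OF hs_null_mult[of a b]]) (simp add: ent_mult[OF carr carr])
    then show "\<pi> (sa_mult cstar_alg a b) = sa_mult (matseq_quot_alg F) (\<pi> a) (\<pi> b)"
      unfolding \<pi>_def matseq_class_ops[OF in_matseq in_matseq] using in_matseq cl
      by (intro eq) (simp add: matseq_rel_iff cstar_alg_def)
  next
    fix c and a :: 'a
    have "hs_null F (\<lambda>n p q. X (c *\<^sub>C a) n p q - ent (c \<cdot>\<^sub>m \<phi> n a) p q)"
      by (rule hs_null_cong[OF hs_null_lin[of c a 0 a]]) (simp add: scaleC_zero_left ent_smult[OF carr])
    then show "\<pi> (sa_scale cstar_alg c a) = sa_scale (matseq_quot_alg F) c (\<pi> a)"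
      unfolding \<pi>_def matseq_class_ops[OF in_matseq in_matseq] using in_matseq cl
      by (intro eq) (simp add: matseq_rel_iff cstar_alg_def)
  next
    fix a :: 'a
    have "hs_null F (\<lambda>n p q. X (star a) n p q - ent (mat_adjoint (\<phi> n a)) p q)"
      by (rule hs_null_cong[OF hs_null_star[of a]]) (simp add: ent_adjoint[OF carr])
    then show "\<pi> (sa_star cstar_alg a) = sa_star (matseq_quot_alg F) (\<pi> a)"
      unfolding \<pi>_def matseq_class_ops[OF in_matseq in_matseq] using in_matseq cl
      by (intro eq) (simp add: matseq_rel_iff cstar_alg_def)
  qed
  then obtain \<psi> :: "'a \<Rightarrow> nat \<Rightarrow> complex mat" where \<psi>: "star_hom cstar_alg matseq_alg \<psi>" "\<And>b. \<pi> b = matseq_rel F `` {\<psi> b}"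
    using assms unfolding hilbert_schmidt_stable_def by blast
  have mem: "\<psi> b \<in> carrier matseq_alg" for b using \<psi>(1) by (auto simp: star_hom_def cstar_alg_def)
  have "mat_rep (Suc n) (\<lambda>b. \<psi> b n)" for n
    using \<psi>(1) mem by (auto simp: mat_rep_def star_hom_def cstar_alg_def matseq_alg_def)
  moreover have "hs_null F (\<lambda>n p q. ent (\<psi> b n) p q - X b n p q)" for b
  proof -
    have "(\<psi> b, \<lambda>n. \<phi> n b) \<in> matseq_rel F"
      using eq_equiv_class[OF _ matseq_rel_equiv, of F "\<psi> b" "\<lambda>n. \<phi> n b"] \<psi>(2)[of b] in_matseq by (simp add: \<pi>_def)
    then show ?thesis by (simp add: matseq_rel_iff)
  qed
  ultimately show ?thesis by (intro exI[of _ "\<lambda>n b. \<psi> b n"]) simp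
qed

end

section \<open>Essential operator bounds from moments\<close>

text \<open>The norm of \<open>Z n\<close> is asymptotically at most \<open>c\<close> off subspaces whose dimension is a vanishing
proportion of \<open>Suc n\<close>, phrased so that it bounds the families of \<open>greedy_family\<close>.\<close>

definition ess_bounded :: "nat filter \<Rightarrow> (nat \<Rightarrow> nat \<Rightarrow> nat \<Rightarrow> complex) \<Rightarrow> real \<Rightarrow> bool" where
  "ess_bounded F Z c \<longleftrightarrow> (\<forall>t>c. \<forall>\<eta>>0. \<forall>\<^sub>F n in F. \<forall>d e. orthonormal (Suc n) d e \<longrightarrow>
     (\<forall>i<d. vnorm (Suc n) (kapply (Suc n) (Z n) (e i)) > t) \<longrightarrow> real d \<le> \<eta> * real (Suc n))"

lemma orthonormal_large_count:
  assumes e: "orthonormal N d e" and big: "\<And>i. i < d \<Longrightarrow> t \<le> vnorm N (kapply N a (e i))" and t: "0 \<le> t"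
  shows "real d * t\<^sup>2 \<le> (frob N a)\<^sup>2"
proof -
  have "real d * t\<^sup>2 = (\<Sum>i<d. t\<^sup>2)" by simp
  also have "\<dots> \<le> (\<Sum>i<d. (vnorm N (kapply N a (e i)))\<^sup>2)" using big t by (intro sum_mono power_mono) auto
  also have "\<dots> \<le> (frob N a)\<^sup>2" by (rule orthonormal_sum_kapply_le_frob[OF e])
  finally show ?thesis .
qed

lemma hs_null_ess_bounded:
  assumes "hs_null F Z"
  shows "ess_bounded F Z 0"
  unfolding ess_bounded_def
proof (intro allI impI)
  fix t \<eta> :: real assume t: "t > 0" and \<eta>: "\<eta> > 0"
  have "\<forall>\<^sub>F n in F. frob (Suc n) (Z n) / sqrt (Suc n) < t * sqrt \<eta>"
    using assms t \<eta> unfolding hs_null_def by (intro order_tendstoD) auto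
  then show "\<forall>\<^sub>F n in F. \<forall>d e. orthonormal (Suc n) d e \<longrightarrow> (\<forall>i<d. vnorm (Suc n) (kapply (Suc n) (Z n) (e i)) > t) \<longrightarrow> real d \<le> \<eta> * real (Suc n)"
  proof (eventually_elim, intro allI impI)
    fix n d e assume h: "frob (Suc n) (Z n) / sqrt (Suc n) < t * sqrt \<eta>" and e: "orthonormal (Suc n) d e"
      and big: "\<forall>i<d. vnorm (Suc n) (kapply (Suc n) (Z n) (e i)) > t"
    have "real d * t\<^sup>2 \<le> (frob (Suc n) (Z n))\<^sup>2" using e big t by (intro orthonormal_large_count) (auto intro: less_imp_le)
    also have "\<dots> \<le> (t * sqrt \<eta> * sqrt (Suc n))\<^sup>2" using h by (intro power_mono) (auto simp: divide_less_eq)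
    also have "\<dots> = \<eta> * real (Suc n) * t\<^sup>2" using \<eta> by (simp add: power_mult_distrib)
    finally show "real d \<le> \<eta> * real (Suc n)" using t by simp
  qed
qed

text \<open>The positive matrix \<open>(x\<^sup>* x)\<close> raised to the power \<open>2\<^sup>k\<close>; repeated squaring is all that the moment
argument needs.\<close>

fun hpow :: "nat \<Rightarrow> (nat \<Rightarrow> nat \<Rightarrow> complex) \<Rightarrow> nat \<Rightarrow> nat \<Rightarrow> nat \<Rightarrow> complex" where
  "hpow N x 0 = kmult N (adj x) x"
| "hpow N x (Suc k) = kmult N (hpow N x k) (hpow N x k)"

lemma hpow_adj: "adj (hpow N x k) = hpow N x k"
  by (induction k) (auto simp: adj_kmult)

text \<open>Jensen's inequality for the powers of \<open>x\<^sup>* x\<close>, in the form of the Cauchy-Schwarz inequality iterated.\<close>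

lemma hpow_lower:
  assumes u: "vnorm N u = 1"
  shows "vnorm N (kapply N x u) ^ (2 ^ Suc k) \<le> vnorm N (kapply N (hpow N x k) u)"
proof (induction k)
  case 0
  have "(vnorm N (kapply N x u))\<^sup>2 \<le> cmod (inprod N u (kapply N (kmult N (adj x) x) u))" unfolding vnorm_kapply_sq by (rule complex_Re_le_cmod)
  also have "\<dots> \<le> vnorm N (kapply N (kmult N (adj x) x) u)" using Cauchy_Schwarz_inprod[of N u] u by (metis mult_1)
  finally show ?case by simp
next
  case (Suc k)
  let ?H = "hpow N x k"
  have "vnorm N (kapply N x u) ^ (2 ^ Suc (Suc k)) = (vnorm N (kapply N x u) ^ (2 ^ Suc k))\<^sup>2" by (simp flip: power_mult add: mult.commute)
  also have "\<dots> \<le> (vnorm N (kapply N ?H u))\<^sup>2" using Suc by (intro power_mono) auto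
  also have "\<dots> \<le> cmod (inprod N u (kapply N (kmult N ?H ?H) u))"
    using vnorm_kapply_sq[of N ?H u] complex_Re_le_cmod by (simp add: hpow_adj)
  also have "\<dots> \<le> vnorm N (kapply N (kmult N ?H ?H) u)" using Cauchy_Schwarz_inprod[of N u] u by (metis mult_1)
  finally show ?case by simp
qed

primrec spow :: "'a::cstar_algebra \<Rightarrow> nat \<Rightarrow> 'a" where
  "spow x 0 = star x * x"
| "spow x (Suc k) = spow x k * spow x k"

lemma norm_spow: "norm (spow x k) \<le> norm x ^ (2 ^ Suc k)"
proof (induction k)
  case 0 then show ?case by (simp add: cstar_identity)
next
  case (Suc k)
  have "norm (spow x (Suc k)) \<le> norm (spow x k) * norm (spow x k)" by (simp add: norm_mult_ineq)
  also have "\<dots> \<le> norm x ^ (2 ^ Suc k) * norm x ^ (2 ^ Suc k)" using Suc by (intro mult_mono) auto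
  also have "\<dots> = norm x ^ (2 ^ Suc (Suc k))" by (simp flip: power_add)
  finally show ?case .
qed

locale asymp_trace_hom = asymp_hom +
  fixes \<tau> :: "'a \<Rightarrow> complex"
  assumes tr: "\<And>a. ((\<lambda>n. mat_tr (\<phi> n a)) \<longlongrightarrow> \<tau> a) F" and tau: "cstar_trace \<tau>"
begin

lemma hs_null_hpow: "hs_null F (\<lambda>n p q. hpow (Suc n) (X x n) k p q - X (spow x k) n p q) \<and> (\<exists>C\<ge>0. \<forall>n. op_bounded (Suc n) (hpow (Suc n) (X x n) k) C)"
proof (induction k)
  case 0
  obtain C where C: "C \<ge> 0" "\<And>n. op_bounded (Suc n) (X x n) C" using bound by blast
  have "hs_null F (\<lambda>n p q. - kmult (Suc n) (\<lambda>p q. X (star x) n p q - adj (X x n) p q) (X x n) p q - (X (star x * x) n p q - kmult (Suc n) (X (star x) n) (X x n) p q))"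
    using hs_null_diff[OF hs_null_scale[OF hs_null_kmult_right[OF hs_null_star C(2,1)], of "-1"] hs_null_mult] by simp
  then have "hs_null F (\<lambda>n p q. hpow (Suc n) (X x n) 0 p q - X (spow x 0) n p q)"
    by (rule hs_null_cong) (simp add: kmult_diff_left)
  moreover have "op_bounded (Suc n) (hpow (Suc n) (X x n) 0) (C * C)" for n using op_bounded_kmult[OF op_bounded_adj[OF C(2,1)] C(2,1)] by simp
  ultimately show ?case using C by (intro conjI exI[of _ "C * C"]) auto
next
  case (Suc k)
  let ?H = "\<lambda>n. hpow (Suc n) (X x n) k" and ?y = "spow x k"
  obtain D where D: "D \<ge> 0" "\<And>n. op_bounded (Suc n) (?H n) D" using Suc by blast
  obtain C where C: "C \<ge> 0" "\<And>n. op_bounded (Suc n) (X ?y n) C" using bound by blast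
  have n: "hs_null F (\<lambda>n p q. ?H n p q - X ?y n p q)" using Suc by blast
  have "hs_null F (\<lambda>n p q. kmult (Suc n) (\<lambda>p q. ?H n p q - X ?y n p q) (?H n) p q + kmult (Suc n) (X ?y n) (\<lambda>p q. ?H n p q - X ?y n p q) p q
      - (X (?y * ?y) n p q - kmult (Suc n) (X ?y n) (X ?y n) p q))"
    by (intro hs_null_diff hs_null_add hs_null_kmult_right[OF n D(2,1)] hs_null_kmult_left[OF n C(2,1)] hs_null_mult)
  then have "hs_null F (\<lambda>n p q. hpow (Suc n) (X x n) (Suc k) p q - X (spow x (Suc k)) n p q)"
    by (rule hs_null_cong) (simp add: kmult_diff_left kmult_diff_right)
  moreover have "op_bounded (Suc n) (hpow (Suc n) (X x n) (Suc k)) (D * D)" for n using op_bounded_kmult[OF D(2) D(2) D(1)] by simp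
  ultimately show ?case using D by (intro conjI exI[of _ "D * D"]) auto
qed

lemma hs_null_trace: "hs_null F T \<Longrightarrow> ((\<lambda>n. (\<Sum>p<Suc n. T n p p) / of_nat (Suc n)) \<longlongrightarrow> 0) F"
proof (rule tendsto_norm_zero_cancel, rule tendsto_sandwich[OF _ _ tendsto_const])
  assume n: "hs_null F T"
  show "((\<lambda>n. frob (Suc n) (T n) / sqrt (Suc n)) \<longlongrightarrow> 0) F" using n by (simp add: hs_null_def)
  show "\<forall>\<^sub>F n in F. cmod ((\<Sum>p<Suc n. T n p p) / of_nat (Suc n)) \<le> frob (Suc n) (T n) / sqrt (Suc n)"
  proof (intro always_eventually allI)
    fix n
    let ?M = "Matrix.mat (Suc n) (Suc n) (\<lambda>(p, q). T n p q)"
    have c: "?M \<in> carrier_mat (Suc n) (Suc n)" by simp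
    have e: "ent ?M p q = T n p q" if "p < Suc n" "q < Suc n" for p q using that by (simp add: ent_mat)
    have "mat_tr ?M = (\<Sum>p<Suc n. T n p p) / of_nat (Suc n)" unfolding mat_tr_eq[OF c]
      by (intro arg_cong2[where f = "(/)"] sum.cong refl) (use e in auto)
    moreover have "hs_norm ?M = frob (Suc n) (T n) / sqrt (Suc n)" unfolding hs_norm_eq[OF c] using frob_cong[OF e] by simp
    ultimately show "cmod ((\<Sum>p<Suc n. T n p p) / of_nat (Suc n)) \<le> frob (Suc n) (T n) / sqrt (Suc n)"
      using mat_tr_le_hs[OF c] by simp
  qed
qed auto

lemma trace_kmult_adj: "(\<Sum>p<N. kmult N (adj a) a p p) = of_real ((frob N a)\<^sup>2)"
  by (simp add: kmult_def adj_def frob_sq_cols vnorm_sq complex_norm_square mult.commute flip: of_real_power)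

lemma hs_limit: "((\<lambda>n. (frob (Suc n) (X y n))\<^sup>2 / real (Suc n)) \<longlongrightarrow> Re (\<tau> (star y * y))) F"
proof -
  obtain C where C: "C \<ge> 0" "\<And>n. op_bounded (Suc n) (X y n) C" using bound by blast
  have "hs_null F (\<lambda>n p q. X (star y * y) n p q - kmult (Suc n) (X (star y) n) (X y n) p q + kmult (Suc n) (\<lambda>p q. X (star y) n p q - adj (X y n) p q) (X y n) p q)"
    by (intro hs_null_add hs_null_mult hs_null_kmult_right[OF hs_null_star C(2,1)])
  then have "hs_null F (\<lambda>n p q. X (star y * y) n p q - kmult (Suc n) (adj (X y n)) (X y n) p q)"
    by (rule hs_null_cong) (simp add: kmult_diff_left)
  from tendsto_diff[OF tr[of "star y * y"] hs_null_trace[OF this]]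
  have "((\<lambda>n. complex_of_real ((frob (Suc n) (X y n))\<^sup>2 / real (Suc n))) \<longlongrightarrow> \<tau> (star y * y)) F"
    unfolding mat_tr_eq[OF carr] sum_subtractf trace_kmult_adj by (simp add: diff_divide_distrib del: of_nat_Suc sum.lessThan_Suc)
  from tendsto_Re[OF this] show ?thesis by simp
qed

text \<open>If \<open>d\<close> orthonormal vectors are stretched by more than \<open>t > \<parallel>x\<parallel>\<close>, then \<open>d t\<^sup>2\<^sup>m\<close> is at most the trace of
\<open>(\<phi>\<^sub>n(x)\<^sup>* \<phi>\<^sub>n(x))\<^sup>m\<close>, which is about \<open>n \<tau>((x\<^sup>* x)\<^sup>m) \<le> n \<parallel>x\<parallel>\<^sup>2\<^sup>m\<close>.  So \<open>d / n\<close> is at most about \<open>(\<parallel>x\<parallel> / t)\<^sup>2\<^sup>m\<close>, for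
every power \<open>m\<close> of \<open>2\<close>.\<close>

lemma ess_bounded_norm: "ess_bounded F (X x) (norm x)"
  unfolding ess_bounded_def
proof (intro allI impI)
  fix t \<eta> :: real assume t: "t > norm x" and \<eta>: "\<eta> > 0"
  have t0: "t > 0" using t norm_ge_zero[of x] by linarith
  have "(\<lambda>m. (norm x / t) ^ m) \<longlonglongrightarrow> 0" using t t0 by (intro LIMSEQ_power_zero) simp
  then have "\<forall>\<^sub>F m in sequentially. (norm x / t) ^ m < \<eta>" using \<eta> by (rule order_tendstoD)
  then obtain M where M: "\<And>m. m \<ge> M \<Longrightarrow> (norm x / t) ^ m < \<eta>" by (auto simp: eventually_sequentially)
  let ?k = M and ?m = "2 ^ Suc (Suc M) :: nat"
  have "M \<le> ?m" using less_exp[of "Suc (Suc M)"] by linarith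
  then have "(norm x / t) ^ ?m < \<eta>" by (rule M)
  then have lt: "norm x ^ ?m < \<eta> * t ^ ?m" using t0 by (simp add: power_divide divide_less_eq)
  let ?y = "spow x ?k"
  let ?H = "\<lambda>n. hpow (Suc n) (X x n) ?k"
  have "cmod (\<tau> (star ?y * ?y)) \<le> norm (star ?y * ?y)" using tau unfolding cstar_trace_def by blast
  then have "Re (\<tau> (star ?y * ?y)) \<le> norm (star ?y * ?y)"
    using complex_Re_le_cmod order_trans by blast
  also have "\<dots> = (norm ?y)\<^sup>2" by (rule cstar_identity)
  also have "\<dots> \<le> (norm x ^ (2 ^ Suc ?k))\<^sup>2" using norm_spow by (intro power_mono) auto
  also have "\<dots> = norm x ^ ?m" by (simp flip: power_mult add: mult.commute)
  finally have "Re (\<tau> (star ?y * ?y)) < \<eta> * t ^ ?m" using lt by simp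
  moreover have "((\<lambda>n. (frob (Suc n) (?H n))\<^sup>2 / real (Suc n)) \<longlongrightarrow> Re (\<tau> (star ?y * ?y))) F"
  proof -
    let ?s = "\<lambda>T n. frob (Suc n) (T n) / sqrt (Suc n)"
    have n: "hs_null F (\<lambda>n p q. ?H n p q - X ?y n p q)" using hs_null_hpow by blast
    have n1: "((\<lambda>n. ?s ?H n - ?s (X ?y) n) \<longlongrightarrow> 0) F"
    proof (rule tendsto_norm_zero_cancel, rule tendsto_sandwich[OF _ _ tendsto_const n[unfolded hs_null_def]])
      show "\<forall>\<^sub>F n in F. norm (?s ?H n - ?s (X ?y) n) \<le> frob (Suc n) (\<lambda>p q. ?H n p q - X ?y n p q) / sqrt (Suc n)"
      proof (intro always_eventually allI)
        fix n
        let ?d = "\<lambda>p q. ?H n p q - X ?y n p q"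
        have "frob (Suc n) (?H n) \<le> frob (Suc n) ?d + frob (Suc n) (X ?y n)" using frob_triangle[of "Suc n" ?d "X ?y n"] by simp
        moreover have "frob (Suc n) (X ?y n) \<le> frob (Suc n) (\<lambda>p q. (-1) * ?d p q) + frob (Suc n) (?H n)"
          using frob_triangle[of "Suc n" "\<lambda>p q. (-1) * ?d p q" "?H n"] by simp
        ultimately have "\<bar>frob (Suc n) (?H n) - frob (Suc n) (X ?y n)\<bar> \<le> frob (Suc n) ?d" unfolding frob_scale by simp
        then show "norm (?s ?H n - ?s (X ?y) n) \<le> frob (Suc n) ?d / sqrt (Suc n)"
          by (simp add: divide_right_mono abs_divide flip: diff_divide_distrib)
      qed
    qed auto
    have n2: "((\<lambda>n. ?s (X ?y) n) \<longlongrightarrow> sqrt (Re (\<tau> (star ?y * ?y)))) F"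
      using tendsto_real_sqrt[OF hs_limit[of ?y]] by (simp add: real_sqrt_divide)
    have "((\<lambda>n. ?s ?H n) \<longlongrightarrow> sqrt (Re (\<tau> (star ?y * ?y)))) F"
      using tendsto_add[OF n1 n2] by simp
    from tendsto_power[OF this, of 2] have "((\<lambda>n. (frob (Suc n) (?H n))\<^sup>2 / real (Suc n)) \<longlongrightarrow> (sqrt (Re (\<tau> (star ?y * ?y))))\<^sup>2) F"
      by (simp add: power_divide)
    moreover have "0 \<le> Re (\<tau> (star ?y * ?y))" using tau by (auto simp: cstar_trace_def complex_nonneg_Reals_iff)
    ultimately show ?thesis by simp
  qed
  ultimately have "\<forall>\<^sub>F n in F. (frob (Suc n) (?H n))\<^sup>2 / real (Suc n) < \<eta> * t ^ ?m" using order_tendstoD(2) by blast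
  then show "\<forall>\<^sub>F n in F. \<forall>d e. orthonormal (Suc n) d e \<longrightarrow> (\<forall>i<d. vnorm (Suc n) (kapply (Suc n) (X x n) (e i)) > t) \<longrightarrow> real d \<le> \<eta> * real (Suc n)"
  proof (eventually_elim, intro allI impI)
    fix n d e assume h: "(frob (Suc n) (?H n))\<^sup>2 / real (Suc n) < \<eta> * t ^ ?m" and e: "orthonormal (Suc n) d e"
      and big: "\<forall>i<d. vnorm (Suc n) (kapply (Suc n) (X x n) (e i)) > t"
    have "real d * (t ^ (2 ^ Suc ?k))\<^sup>2 \<le> (frob (Suc n) (?H n))\<^sup>2"
    proof (rule orthonormal_large_count[OF e])
      fix i assume i: "i < d"
      have "t ^ (2 ^ Suc ?k) \<le> vnorm (Suc n) (kapply (Suc n) (X x n) (e i)) ^ (2 ^ Suc ?k)" using big i t0 by (intro power_mono) (auto intro: less_imp_le)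
      also have "\<dots> \<le> vnorm (Suc n) (kapply (Suc n) (?H n) (e i))" by (rule hpow_lower[OF orthonormal_vnorm[OF e i]])
      finally show "t ^ (2 ^ Suc ?k) \<le> vnorm (Suc n) (kapply (Suc n) (?H n) (e i))" .
    qed (use t0 in auto)
    also have "\<dots> \<le> \<eta> * t ^ ?m * real (Suc n)" using h by (simp add: divide_less_eq del: of_nat_Suc power_Suc)
    also have "(t ^ (2 ^ Suc ?k))\<^sup>2 = t ^ ?m" by (simp flip: power_mult add: mult.commute)
    finally have "real d * t ^ ?m \<le> (\<eta> * real (Suc n)) * t ^ ?m" by (simp only: mult_ac)
    then show "real d \<le> \<eta> * real (Suc n)" using t0 by (simp del: of_nat_Suc power_Suc)
  qed
qed

end

section \<open>Approximation of a trace in all matrix sizes\<close>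

text \<open>The condition makes size \<open>k (j n)\<close> negligible against \<open>n\<close>.\<close>

lemma slow_index:
  fixes k :: "nat \<Rightarrow> nat"
  shows "\<exists>j. filterlim j at_top sequentially \<and> (\<forall>n. j n * k (j n) \<le> n)"
proof -
  define A where "A = (\<lambda>n. {j. j \<le> n \<and> (\<forall>i\<le>j. i * k i \<le> n)})"
  define j where "j = (\<lambda>n. Max (A n))"
  have fin: "finite (A n)" for n unfolding A_def by simp
  have "0 \<in> A n" for n by (simp add: A_def)
  then have mem: "j n \<in> A n" for n unfolding j_def using fin Max_in by blast
  have "filterlim j at_top sequentially"
    unfolding filterlim_at_top
  proof
    fix Z
    have "\<forall>n\<ge>Z + (\<Sum>i\<le>Z. i * k i). Z \<le> j n"
    proof (intro allI impI)
      fix n assume n: "Z + (\<Sum>i\<le>Z. i * k i) \<le> n"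
      have "i * k i \<le> n" if "i \<le> Z" for i
        using member_le_sum[of i "{..Z}" "\<lambda>i. i * k i"] that n by simp
      then have "Z \<in> A n" using n by (simp add: A_def)
      then show "Z \<le> j n" unfolding j_def using fin Max_ge by blast
    qed
    then show "\<forall>\<^sub>F n in sequentially. Z \<le> j n" by (auto simp: eventually_sequentially)
  qed
  then show ?thesis using mem by (intro exI[of _ j]) (auto simp: A_def)
qed

lemma abs_ratio_minus_one: "x \<le> y \<Longrightarrow> 0 < y \<Longrightarrow> \<bar>x / y - 1\<bar> = (y - x) / y" for x y :: real
  by (simp add: abs_if field_simps)

text \<open>In size \<open>Suc n\<close> as many copies as fit of \<open>\<phi> (j n)\<close> are used, with \<open>j\<close> so slow that the proportion of
the zero corner tends to \<open>0\<close>; then neither Hilbert-Schmidt errors nor the trace are affected in the limit.\<close>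

lemma resize:
  fixes \<phi> :: "nat \<Rightarrow> 'a::cstar_algebra \<Rightarrow> complex mat"
  assumes kmult: "matrix_maps k \<phi>" and mult: "asymp_mult hs_norm \<phi>" and lin: "asymp_linear hs_norm \<phi>"
    and star: "asymp_star hs_norm \<phi>" and bdd: "\<And>a. bdd_above (range (\<lambda>n. op_norm (\<phi> n a)))"
    and app: "approximates_trace \<phi> \<tau>" and tau: "cstar_trace \<tau>"
  shows "\<exists>\<phi>'. asymp_trace_hom sequentially \<phi>' \<tau> \<and> ((\<forall>n. ccp_map (k n) (\<phi> n)) \<longrightarrow> (\<forall>n. ccp_map (Suc n) (\<phi>' n)))"
proof -
  obtain j where j: "filterlim j at_top sequentially" "\<And>n. j n * k (j n) \<le> n" using slow_index[of k] by blast
  have kpos: "0 < k n" and carr: "\<phi> n a \<in> carrier_mat (k n) (k n)" for n a using kmult by (auto simp: matrix_maps_def Suc_le_eq)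
  define c where "c = (\<lambda>n. Suc n div k (j n))"
  have ck: "c n * k (j n) \<le> Suc n" for n by (simp add: c_def)
  define \<phi>' where "\<phi>' = (\<lambda>n a. blk (Suc n) (k (j n)) (c n) (\<phi> (j n) a))"
  have carr': "\<phi>' n a \<in> carrier_mat (Suc n) (Suc n)" for n a by (simp add: \<phi>'_def)
  have op: "op_norm (\<phi>' n a) \<le> op_norm (\<phi> (j n) a)" for n a
    unfolding \<phi>'_def by (rule op_norm_blk[OF kpos ck carr])
  have squeeze: "((\<lambda>n. hs_norm (S n)) \<longlonglongrightarrow> 0)"
    if "(\<lambda>n. hs_norm (T n)) \<longlonglongrightarrow> 0" "\<And>n. T n \<in> carrier_mat (k n) (k n)"
      "\<And>n. S n = blk (Suc n) (k (j n)) (c n) (T (j n))" for S T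
  proof (rule tendsto_sandwich[OF _ _ tendsto_const])
    show "(\<lambda>n. hs_norm (T (j n))) \<longlonglongrightarrow> 0" using filterlim_compose[OF that(1) j(1)] .
    show "\<forall>\<^sub>F n in sequentially. hs_norm (S n) \<le> hs_norm (T (j n))"
      unfolding that(3) using hs_norm_blk[OF kpos ck that(2)] by simp
    show "\<forall>\<^sub>F n in sequentially. 0 \<le> hs_norm (S n)"
      unfolding that(3) using hs_norm_nonneg[OF blk_carrier] by simp
  qed
  have "asymp_trace_hom sequentially \<phi>' \<tau>"
  proof
    show "\<phi>' n a \<in> carrier_mat (Suc n) (Suc n)" for n a by (rule carr')
    show "(\<lambda>n. hs_norm (\<phi>' n (a * b) - \<phi>' n a * \<phi>' n b)) \<longlonglongrightarrow> 0" for a b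
    proof (rule squeeze[where T = "\<lambda>n. \<phi> n (a * b) - \<phi> n a * \<phi> n b"])
      show "(\<lambda>n. hs_norm (\<phi> n (a * b) - \<phi> n a * \<phi> n b)) \<longlonglongrightarrow> 0" using mult by (simp add: asymp_mult_def)
      have m: "\<phi> n a * \<phi> n b \<in> carrier_mat (k n) (k n)" for n by (rule mult_carrier_mat[OF carr carr])
      show "\<phi> n (a * b) - \<phi> n a * \<phi> n b \<in> carrier_mat (k n) (k n)" for n by (rule minus_carrier_mat[OF m])
      show "\<phi>' n (a * b) - \<phi>' n a * \<phi>' n b = blk (Suc n) (k (j n)) (c n) (\<phi> (j n) (a * b) - \<phi> (j n) a * \<phi> (j n) b)" for n
        by (simp add: \<phi>'_def blk_diff[OF kpos ck carr m] blk_mult[OF kpos ck carr carr])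
    qed
    show "(\<lambda>n. hs_norm (\<phi>' n (x *\<^sub>C a + y *\<^sub>C b) - x \<cdot>\<^sub>m \<phi>' n a - y \<cdot>\<^sub>m \<phi>' n b)) \<longlonglongrightarrow> 0" for x y a b
    proof (rule squeeze[where T = "\<lambda>n. \<phi> n (x *\<^sub>C a + y *\<^sub>C b) - x \<cdot>\<^sub>m \<phi> n a - y \<cdot>\<^sub>m \<phi> n b"])
      show "(\<lambda>n. hs_norm (\<phi> n (x *\<^sub>C a + y *\<^sub>C b) - x \<cdot>\<^sub>m \<phi> n a - y \<cdot>\<^sub>m \<phi> n b)) \<longlonglongrightarrow> 0" using lin by (simp add: asymp_linear_def)
      have m: "z \<cdot>\<^sub>m \<phi> n a \<in> carrier_mat (k n) (k n)" for n z a using carr by simp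
      show "\<phi> n (x *\<^sub>C a + y *\<^sub>C b) - x \<cdot>\<^sub>m \<phi> n a - y \<cdot>\<^sub>m \<phi> n b \<in> carrier_mat (k n) (k n)" for n by (rule minus_carrier_mat[OF m])
      show "\<phi>' n (x *\<^sub>C a + y *\<^sub>C b) - x \<cdot>\<^sub>m \<phi>' n a - y \<cdot>\<^sub>m \<phi>' n b = blk (Suc n) (k (j n)) (c n) (\<phi> (j n) (x *\<^sub>C a + y *\<^sub>C b) - x \<cdot>\<^sub>m \<phi> (j n) a - y \<cdot>\<^sub>m \<phi> (j n) b)" for n
        by (simp add: \<phi>'_def blk_diff[OF kpos ck minus_carrier_mat[OF m] m] blk_diff[OF kpos ck carr m] blk_smult[OF kpos ck carr])
    qed
    show "(\<lambda>n. hs_norm (\<phi>' n (star a) - mat_adjoint (\<phi>' n a))) \<longlonglongrightarrow> 0" for a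
    proof (rule squeeze[where T = "\<lambda>n. \<phi> n (star a) - mat_adjoint (\<phi> n a)"])
      show "(\<lambda>n. hs_norm (\<phi> n (star a) - mat_adjoint (\<phi> n a))) \<longlonglongrightarrow> 0" using star by (simp add: asymp_star_def)
      have m: "mat_adjoint (\<phi> n a) \<in> carrier_mat (k n) (k n)" for n by (rule mat_adjoint_carrier[OF carr])
      show "\<phi> n (star a) - mat_adjoint (\<phi> n a) \<in> carrier_mat (k n) (k n)" for n by (rule minus_carrier_mat[OF m])
      show "\<phi>' n (star a) - mat_adjoint (\<phi>' n a) = blk (Suc n) (k (j n)) (c n) (\<phi> (j n) (star a) - mat_adjoint (\<phi> (j n) a))" for n
        by (simp add: \<phi>'_def blk_diff[OF kpos ck carr m] blk_adjoint[OF kpos ck carr])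
    qed
    fix a
    obtain C where C: "\<And>n. op_norm (\<phi> n a) \<le> C" using bdd[of a] by (auto simp: bdd_above_def)
    show "bdd_above (range (\<lambda>n. op_norm (\<phi>' n a)))" by (intro bdd_aboveI2[where M = C]) (rule order_trans[OF op C])
    have trC: "cmod (mat_tr (\<phi> n a)) \<le> C" for n
      by (rule order_trans[OF mat_tr_le_hs[OF carr] order_trans[OF hs_le_op[OF carr kpos] C]])
    have C0: "0 \<le> C" by (rule order_trans[OF norm_ge_zero trC[of 0]])
    have lim0: "(\<lambda>n. mat_tr (\<phi> n a)) \<longlonglongrightarrow> \<tau> a"
    proof -
      have "(\<lambda>n. \<tau> a - mat_tr (\<phi> n a)) \<longlonglongrightarrow> 0" using app by (simp add: approximates_trace_def tendsto_norm_zero_iff)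
      from tendsto_diff[OF tendsto_const[of "\<tau> a"] this] show ?thesis by simp
    qed
    have "(\<lambda>n. mat_tr (\<phi>' n a) - mat_tr (\<phi> (j n) a)) \<longlonglongrightarrow> 0"
    proof (rule tendsto_norm_zero_cancel, rule tendsto_sandwich[OF _ _ tendsto_const])
      have "(\<lambda>n. inverse (real (j n))) \<longlonglongrightarrow> 0" using filterlim_compose[OF lim_inverse_n j(1)] .
      from tendsto_mult_left_zero[OF this, of C] show "(\<lambda>n. C * inverse (real (j n))) \<longlonglongrightarrow> 0" by (simp add: mult.commute)
      have "\<forall>\<^sub>F n in sequentially. 1 \<le> j n" using j(1) by (auto simp: filterlim_at_top)
      then show "\<forall>\<^sub>F n in sequentially. norm (mat_tr (\<phi>' n a) - mat_tr (\<phi> (j n) a)) \<le> C * inverse (real (j n))"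
      proof eventually_elim
        case (elim n)
        let ?r = "real (c n * k (j n)) / real (Suc n)"
        have "mat_tr (\<phi>' n a) - mat_tr (\<phi> (j n) a) = of_real (?r - 1) * mat_tr (\<phi> (j n) a)"
          by (simp add: \<phi>'_def mat_tr_blk[OF kpos ck carr] left_diff_distrib del: of_nat_Suc)
        then have "norm (mat_tr (\<phi>' n a) - mat_tr (\<phi> (j n) a)) = \<bar>?r - 1\<bar> * cmod (mat_tr (\<phi> (j n) a))"
          by (simp only: norm_mult norm_of_real)
        also have "\<dots> \<le> inverse (real (j n)) * C"
        proof (intro mult_mono trC)
          have le: "real (c n * k (j n)) \<le> real (Suc n)" using ck by (simp only: of_nat_le_iff)
          have "Suc n = c n * k (j n) + Suc n mod k (j n)" by (simp add: c_def)
          moreover have "Suc n mod k (j n) < k (j n)" using kpos by simp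
          ultimately have "Suc n - c n * k (j n) \<le> k (j n)" by linarith
          then have "Suc n \<le> c n * k (j n) + k (j n)" by linarith
          then have "real (Suc n) \<le> real (c n * k (j n) + k (j n))" by (simp only: of_nat_le_iff)
          then have "real (Suc n) - real (c n * k (j n)) \<le> real (k (j n))" by simp
          then have "j n * (real (Suc n) - real (c n * k (j n))) \<le> real (j n * k (j n))" by (simp add: mult_left_mono)
          also have "\<dots> \<le> real (Suc n)" using j(2)[of n] by (simp only: of_nat_le_iff)
          finally have h: "real (j n) * (real (Suc n) - real (c n * k (j n))) \<le> real (Suc n)" .
          have "\<bar>?r - 1\<bar> = (real (Suc n) - real (c n * k (j n))) / real (Suc n)" using abs_ratio_minus_one[OF le] by (simp del: of_nat_Suc)
          also have "\<dots> \<le> inverse (real (j n))" using h elim by (simp add: field_simps)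
          finally show "\<bar>?r - 1\<bar> \<le> inverse (real (j n))" .
        qed auto
        finally show ?case by (simp add: mult.commute)
      qed
    qed auto
    from tendsto_add[OF this filterlim_compose[OF lim0 j(1)]] show "(\<lambda>n. mat_tr (\<phi>' n a)) \<longlonglongrightarrow> \<tau> a" by simp
  qed (rule tau)
  moreover have "ccp_map (Suc n) (\<phi>' n)" if ccp: "\<forall>n. ccp_map (k n) (\<phi> n)" for n
  proof (rule ccp_combine[where I = "{..<c n}" and k = "\<lambda>_. k (j n)" and f = "\<lambda>_. \<phi> (j n)" and W = "\<lambda>i r p. if p = i * k (j n) + r then 1 else 0"])
    show "\<phi>' n a $$ (p, q) = (\<Sum>i<c n. \<Sum>r<k (j n). \<Sum>s<k (j n). cnj (if p = i * k (j n) + r then 1 else 0) * \<phi> (j n) a $$ (r, s) *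
         (if q = i * k (j n) + s then 1 else 0))" if "p < Suc n" "q < Suc n" for a p q
      unfolding \<phi>'_def by (rule blk_entry_sum[OF kpos ck that])
    show "op_norm (\<phi>' n a) \<le> norm a" for a using op[of n a] ccp by (auto simp: ccp_map_def intro: order_trans)
  qed (use ccp carr' in auto)
  ultimately show ?thesis by blast
qed

lemma nontrivial_ultrafilter_le: "nontrivial_ultrafilter \<omega> \<Longrightarrow> \<omega> \<le> sequentially"
proof (rule filter_leI)
  fix P assume w: "nontrivial_ultrafilter \<omega>" and "eventually P sequentially"
  then obtain m where m: "\<And>n. n \<ge> m \<Longrightarrow> P n" by (auto simp: eventually_sequentially)
  have "\<forall>\<^sub>F n in \<omega>. \<forall>i\<in>{..<m}. n \<noteq> i" using w by (intro eventually_ball_finite) (auto simp: nontrivial_ultrafilter_def)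
  then show "eventually P \<omega>" by eventually_elim (use m in \<open>auto simp: not_less[symmetric]\<close>)
qed

lemma asymp_trace_hom_mono:
  assumes "asymp_trace_hom F \<phi> \<tau>" "G \<le> F"
  shows "asymp_trace_hom G \<phi> \<tau>"
proof -
  interpret asymp_trace_hom F \<phi> \<tau> by (rule assms)
  note t = tendsto_mono[OF assms(2)]
  show ?thesis by unfold_locales (use carr bdd tau in \<open>auto intro: t mult lin star tr\<close>)
qed

section \<open>Exceptional subspaces of small dimension\<close>

lemma orthonormal_cover_count:
  assumes e: "orthonormal N d e" and J: "finite J" and cov: "\<And>i. i < d \<Longrightarrow> \<exists>j\<in>J. Q j (e i)"
    and cnt: "\<And>j d' e'. j \<in> J \<Longrightarrow> orthonormal N d' e' \<Longrightarrow> (\<And>i. i < d' \<Longrightarrow> Q j (e' i)) \<Longrightarrow> real d' \<le> r"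
  shows "real d \<le> real (card J) * r"
proof -
  define S where "S = (\<lambda>j. {i. i < d \<and> Q j (e i)})"
  have fin: "finite (S j)" for j by (simp add: S_def)
  have cS: "real (card (S j)) \<le> r" if j: "j \<in> J" for j
  proof -
    obtain h where h: "bij_betw h {..<card (S j)} (S j)" using ex_bij_betw_nat_finite[OF fin] by (auto simp: atLeast0LessThan)
    have hS: "h i \<in> S j" if "i < card (S j)" for i using h that by (auto simp: bij_betw_def)
    have inj: "h i = h i' \<longleftrightarrow> i = i'" if "i < card (S j)" "i' < card (S j)" for i i'
      using h that by (auto simp: bij_betw_def inj_on_def)
    show ?thesis
    proof (rule cnt[OF j])
      show "orthonormal N (card (S j)) (\<lambda>i. e (h i))" using e hS inj by (auto simp: orthonormal_def S_def)
      show "Q j (e (h i))" if "i < card (S j)" for i using hS[OF that] by (simp add: S_def)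
    qed
  qed
  have "{..<d} \<subseteq> (\<Union>j\<in>J. S j)" using cov by (auto simp: S_def)
  then have "d \<le> card (\<Union>j\<in>J. S j)" using card_mono[of "\<Union>j\<in>J. S j" "{..<d}"] J fin by simp
  also have "\<dots> \<le> (\<Sum>j\<in>J. card (S j))" by (rule card_UN_le[OF J])
  finally have "real d \<le> (\<Sum>j\<in>J. real (card (S j)))" by (metis of_nat_le_iff of_nat_sum)
  also have "\<dots> \<le> (\<Sum>j\<in>J. r)" using cS by (rule sum_mono)
  finally show ?thesis by simp
qed

text \<open>A vector stretched by the perturbed sequence is stretched by the original one or by the
perturbation, and there are few vectors of either sort.\<close>

lemma ess_bounded_perturb:
  assumes Z: "ess_bounded F Z c" and n: "hs_null F (\<lambda>n p q. Z' n p q - Z n p q)"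
  shows "ess_bounded F Z' c"
  unfolding ess_bounded_def
proof (intro allI impI)
  fix t \<eta> :: real assume t: "t > c" and \<eta>: "\<eta> > 0"
  define s where "s = (t - c) / 2"
  have s: "s > 0" "t = (c + s) + s" "c + s > c" using t by (auto simp: s_def field_simps)
  let ?D = "\<lambda>n p q. Z' n p q - Z n p q"
  have "\<forall>\<^sub>F n in F. \<forall>d e. orthonormal (Suc n) d e \<longrightarrow> (\<forall>i<d. vnorm (Suc n) (kapply (Suc n) (Z n) (e i)) > c + s) \<longrightarrow> real d \<le> (\<eta>/2) * real (Suc n)"
    using Z s(3) \<eta> half_gt_zero unfolding ess_bounded_def by blast
  moreover have "\<forall>\<^sub>F n in F. \<forall>d e. orthonormal (Suc n) d e \<longrightarrow> (\<forall>i<d. vnorm (Suc n) (kapply (Suc n) (?D n) (e i)) > s) \<longrightarrow> real d \<le> (\<eta>/2) * real (Suc n)"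
    using hs_null_ess_bounded[OF n] s(1) \<eta> half_gt_zero unfolding ess_bounded_def by blast
  ultimately show "\<forall>\<^sub>F n in F. \<forall>d e. orthonormal (Suc n) d e \<longrightarrow> (\<forall>i<d. vnorm (Suc n) (kapply (Suc n) (Z' n) (e i)) > t) \<longrightarrow> real d \<le> \<eta> * real (Suc n)"
  proof (eventually_elim, intro allI impI)
    fix n d e
    assume 1: "\<forall>d e. orthonormal (Suc n) d e \<longrightarrow> (\<forall>i<d. vnorm (Suc n) (kapply (Suc n) (Z n) (e i)) > c + s) \<longrightarrow> real d \<le> (\<eta>/2) * real (Suc n)"
      and 2: "\<forall>d e. orthonormal (Suc n) d e \<longrightarrow> (\<forall>i<d. vnorm (Suc n) (kapply (Suc n) (?D n) (e i)) > s) \<longrightarrow> real d \<le> (\<eta>/2) * real (Suc n)"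
      and e: "orthonormal (Suc n) d e" and big: "\<forall>i<d. vnorm (Suc n) (kapply (Suc n) (Z' n) (e i)) > t"
    let ?Q = "\<lambda>b v. if b then vnorm (Suc n) (kapply (Suc n) (Z n) v) > c + s else vnorm (Suc n) (kapply (Suc n) (?D n) v) > s"
    have "real d \<le> real (card (UNIV :: bool set)) * ((\<eta>/2) * real (Suc n))"
    proof (rule orthonormal_cover_count[where Q = ?Q and e = e and N = "Suc n"])
      fix i assume i: "i < d"
      have "vnorm (Suc n) (kapply (Suc n) (Z' n) (e i)) = vnorm (Suc n) (\<lambda>p. kapply (Suc n) (Z n) (e i) p + kapply (Suc n) (?D n) (e i) p)"
        by (simp add: kapply_diff_left)
      also have "\<dots> \<le> vnorm (Suc n) (kapply (Suc n) (Z n) (e i)) + vnorm (Suc n) (kapply (Suc n) (?D n) (e i))" by (rule vnorm_triangle)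
      finally have "?Q True (e i) \<or> ?Q False (e i)" using big i s(2) by force
      then show "\<exists>b\<in>UNIV. ?Q b (e i)" by blast
    next
      fix b d' e' assume "orthonormal (Suc n) d' e'" "\<And>i. i < d' \<Longrightarrow> ?Q b (e' i)"
      then show "real d' \<le> (\<eta>/2) * real (Suc n)" using 1 2 by (cases b) auto
    qed (use e in auto)
    then show "real d \<le> \<eta> * real (Suc n)" by (simp add: card_UNIV_bool)
  qed
qed

text \<open>One exceptional subspace serves finitely many sequences: the span of a maximal orthonormal family
of vectors each of which violates one of the bounds.\<close>

lemma ess_bounded_family:
  fixes J :: "((nat \<Rightarrow> nat \<Rightarrow> nat \<Rightarrow> complex) \<times> real) set"
  assumes J: "finite J" and ess: "\<And>Z c. (Z, c) \<in> J \<Longrightarrow> ess_bounded F Z c" and \<epsilon>: "\<epsilon> > 0" and \<eta>: "\<eta> > 0"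
  shows "\<forall>\<^sub>F n in F. \<exists>d e. orthonormal (Suc n) d e \<and> real d \<le> \<eta> * real (Suc n) \<and>
     (\<forall>Z c v. (Z, c) \<in> J \<longrightarrow> (\<forall>i<d. inprod (Suc n) (e i) v = 0) \<longrightarrow> vnorm (Suc n) (kapply (Suc n) (Z n) v) \<le> (c + \<epsilon>) * vnorm (Suc n) v)"
proof -
  \<comment> \<open>The added \<open>1\<close> only serves to avoid division by zero for empty \<open>J\<close>.\<close>
  define \<eta>' where "\<eta>' = \<eta> / (real (card J) + 1)"
  have \<eta>': "\<eta>' > 0" using \<eta> by (simp add: \<eta>'_def add_nonneg_pos)
  have cj: "real (card J) * \<eta>' \<le> \<eta>" using \<eta> by (simp add: \<eta>'_def field_simps)
  have "\<forall>\<^sub>F n in F. \<forall>j\<in>J. \<forall>d e. orthonormal (Suc n) d e \<longrightarrow> (\<forall>i<d. vnorm (Suc n) (kapply (Suc n) (fst j n) (e i)) > snd j + \<epsilon>) \<longrightarrow> real d \<le> \<eta>' * real (Suc n)"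
  proof (rule eventually_ball_finite[OF J], rule ballI)
    fix j assume "j \<in> J"
    then have "ess_bounded F (fst j) (snd j)" using ess[of "fst j" "snd j"] by simp
    moreover have "snd j + \<epsilon> > snd j" using \<epsilon> by simp
    ultimately show "\<forall>\<^sub>F n in F. \<forall>d e. orthonormal (Suc n) d e \<longrightarrow> (\<forall>i<d. vnorm (Suc n) (kapply (Suc n) (fst j n) (e i)) > snd j + \<epsilon>) \<longrightarrow> real d \<le> \<eta>' * real (Suc n)"
      using \<eta>' unfolding ess_bounded_def by blast
  qed
  then show ?thesis
  proof eventually_elim
    case (elim n)
    let ?Q = "\<lambda>j v. vnorm (Suc n) (kapply (Suc n) (fst j n) v) > snd j + \<epsilon>"
    obtain d e where e: "orthonormal (Suc n) d e" "\<forall>i<d. \<exists>j\<in>J. ?Q j (e i)"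
      and max: "\<And>v. vnorm (Suc n) v = 1 \<Longrightarrow> (\<forall>i<d. inprod (Suc n) (e i) v = 0) \<Longrightarrow> \<not> (\<exists>j\<in>J. ?Q j v)"
      using greedy_family[of "Suc n" "\<lambda>v. \<exists>j\<in>J. ?Q j v"] by blast
    have cd: "real d \<le> real (card J) * (\<eta>' * real (Suc n))"
      using elim e(2) by (intro orthonormal_cover_count[OF e(1) J, where Q = ?Q]) blast+
    have le: "real d \<le> \<eta> * real (Suc n)"
      using order_trans[OF cd] mult_right_mono[OF cj, of "real (Suc n)"] by (simp only: mult.assoc of_nat_0_le_iff)
    have main: "vnorm (Suc n) (kapply (Suc n) (Z n) v) \<le> (c + \<epsilon>) * vnorm (Suc n) v"
      if jJ: "(Z, c) \<in> J" and v: "\<forall>i<d. inprod (Suc n) (e i) v = 0" for Z c v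
    proof (cases "vnorm (Suc n) v = 0")
      case True
      then have "kapply (Suc n) (Z n) v = kapply (Suc n) (Z n) (\<lambda>p. 0)" by (intro kapply_cong) (simp add: vnorm_eq_0)
      then show ?thesis using True by (simp add: kapply_def)
    next
      case False
      then have pos: "vnorm (Suc n) v > 0" using vnorm_nonneg[of "Suc n" v] by linarith
      define w where "w = (\<lambda>p. complex_of_real (1 / vnorm (Suc n) v) * v p)"
      have "vnorm (Suc n) w = 1" using pos unfolding w_def vnorm_scale by (simp add: norm_divide)
      moreover have "\<forall>i<d. inprod (Suc n) (e i) w = 0" using v unfolding w_def inprod_scale_right by simp
      ultimately have "vnorm (Suc n) (kapply (Suc n) (Z n) w) \<le> c + \<epsilon>" using max[of w] jJ by force
      moreover have "vnorm (Suc n) (kapply (Suc n) (Z n) w) = vnorm (Suc n) (kapply (Suc n) (Z n) v) / vnorm (Suc n) v"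
        using pos unfolding w_def kapply_scale_right vnorm_scale by (simp add: norm_divide)
      ultimately show ?thesis using pos by (simp add: divide_le_eq)
    qed
    show ?case
      by (intro exI[of _ d] exI[of _ e] conjI allI impI) (rule e(1) le main; assumption)+
  qed
qed

section \<open>Almost multiplicative maps on a finite set\<close>

lemma path_eval_star_hom:
  fixes \<Phi> :: "'a::cstar_algebra \<Rightarrow> real \<Rightarrow> 'b::cstar_algebra"
  assumes "star_hom cstar_alg path_alg \<Phi>" "t \<in> {0..1}"
  shows "star_hom cstar_alg cstar_alg (\<lambda>a. \<Phi> a t)"
  using assms by (auto simp: star_hom_def cstar_alg_def path_alg_def)

lemma path_continuous:
  fixes \<Phi> :: "'a::cstar_algebra \<Rightarrow> real \<Rightarrow> 'b::cstar_algebra"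
  assumes "star_hom cstar_alg path_alg \<Phi>"
  shows "continuous_on {0..1} (\<Phi> a)"
  using assms by (auto simp: star_hom_def cstar_alg_def path_alg_def)

lemma fine_partition:
  fixes \<Phi> :: "'a::cstar_algebra \<Rightarrow> real \<Rightarrow> 'b::cstar_algebra"
  assumes \<Phi>: "star_hom cstar_alg path_alg \<Phi>" and A: "finite A" and \<delta>: "\<delta> > 0"
  shows "\<exists>K\<ge>1. \<forall>b\<in>A. \<forall>i<K. norm (\<Phi> b (real i / real K) - \<Phi> b (real (Suc i) / real K)) \<le> \<delta>"
proof -
  have "\<forall>\<^sub>F K in sequentially. \<forall>b\<in>A. \<forall>i<K. norm (\<Phi> b (real i / real K) - \<Phi> b (real (Suc i) / real K)) \<le> \<delta>"
  proof (rule eventually_ball_finite[OF A], rule ballI)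
    fix b
    have "uniformly_continuous_on {0..1} (\<Phi> b)"
      using path_continuous[OF \<Phi>] compact_uniformly_continuous by blast
    then obtain s where s: "s > 0" "\<And>x y. x \<in> {0..1} \<Longrightarrow> y \<in> {0..1} \<Longrightarrow> dist y x < s \<Longrightarrow> dist (\<Phi> b y) (\<Phi> b x) < \<delta>"
      using \<delta> unfolding uniformly_continuous_on_def by blast
    have "\<forall>\<^sub>F K in sequentially. inverse (real K) < s" using order_tendstoD(2)[OF lim_inverse_n s(1)] .
    then show "\<forall>\<^sub>F K in sequentially. \<forall>i<K. norm (\<Phi> b (real i / real K) - \<Phi> b (real (Suc i) / real K)) \<le> \<delta>"
    proof (eventually_elim, intro allI impI)
      fix K i :: nat assume K: "inverse (real K) < s" and i: "i < K"
      have h: "real (Suc i) / real K - real i / real K = inverse (real K)" using i by (simp add: field_simps)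
      have "dist (real (Suc i) / real K) (real i / real K) < s" unfolding dist_real_def h using K by simp
      then have "dist (real i / real K) (real (Suc i) / real K) < s" by (simp only: dist_commute)
      moreover have "real i / real K \<in> {0..1}" "real (Suc i) / real K \<in> {0..1}" using i by auto
      ultimately have "dist (\<Phi> b (real i / real K)) (\<Phi> b (real (Suc i) / real K)) < \<delta>" using s(2) by blast
      then show "norm (\<Phi> b (real i / real K) - \<Phi> b (real (Suc i) / real K)) \<le> \<delta>" by (simp add: dist_norm)
    qed
  qed
  then have "\<forall>\<^sub>F K in sequentially. 1 \<le> K \<and> (\<forall>b\<in>A. \<forall>i<K. norm (\<Phi> b (real i / real K) - \<Phi> b (real (Suc i) / real K)) \<le> \<delta>)"
    using eventually_ge_at_top[of 1] by eventually_elim simp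
  then show ?thesis by (auto simp: eventually_sequentially)
qed

text \<open>The output is left in the adapted basis; operator norm, trace and complete positivity do not depend on
the choice of an orthonormal basis.\<close>

definition patched :: "nat \<Rightarrow> nat \<Rightarrow> nat \<Rightarrow> (nat \<Rightarrow> nat) \<Rightarrow> (nat \<Rightarrow> nat \<Rightarrow> complex) \<Rightarrow> (nat \<Rightarrow> complex mat) \<Rightarrow> complex mat" where
  "patched N K P g e T = Matrix.mat N N (\<lambda>(p, q). patch {..K} (tent P) g (\<lambda>i. conj_basis N e (ent (T i))) p q)"

lemma patched_carrier [simp]: "patched N K P g e T \<in> carrier_mat N N" by (simp add: patched_def)

lemma ent_patched: "p < N \<Longrightarrow> q < N \<Longrightarrow> ent (patched N K P g e T) p q = patch {..K} (tent P) g (\<lambda>i. conj_basis N e (ent (T i))) p q"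
  by (simp add: patched_def ent_mat)

lemma patch_diff: "patch I c g (\<lambda>i p q. X i p q - Y i p q) = (\<lambda>p q. patch I c g X p q - patch I c g Y p q)"
  by (simp add: patch_def left_diff_distrib right_diff_distrib sum_subtractf)

lemma patch_scale: "patch I c g (\<lambda>i p q. z * X i p q) = (\<lambda>p q. z * patch I c g X p q)"
  by (simp add: patch_def sum_distrib_left mult_ac)

lemma patch_adj: "patch I c g (\<lambda>i. adj (X i)) = adj (patch I c g X)"
  by (simp add: patch_def adj_def mult_ac)

lemma patched_ccp:
  assumes N: "0 < N" and e: "orthonormal N N e" and P: "P > 0" and g: "\<And>p. g p \<le> K * P"
    and f: "\<And>i. i \<le> K \<Longrightarrow> ccp_map N (f i)"
  shows "ccp_map N (\<lambda>a. patched N K P g e (\<lambda>i. f i a))"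
proof (rule ccp_combine[where I = "{..K}" and k = "\<lambda>_. N" and f = f and W = "\<lambda>i r p. of_real (tent P i (g p)) * e p r"])
  fix a p q assume pq: "p < N" "q < N"
  show "patched N K P g e (\<lambda>i. f i a) $$ (p, q) = (\<Sum>i\<in>{..K}. \<Sum>r<N. \<Sum>s<N. cnj (of_real (tent P i (g p)) * e p r) * f i a $$ (r, s) * (of_real (tent P i (g q)) * e q s))"
    using pq by (simp add: patched_def patch_def conj_basis_def form_expand ent_def sum_distrib_left sum_distrib_right mult_ac)
next
  fix a
  have "op_bounded N (patch {..K} (tent P) g (\<lambda>i. conj_basis N e (ent (f i a)))) (norm a)"
  proof (rule patch_bound)
    show "(\<Sum>i\<in>{..K}. (tent P i (g p))\<^sup>2) \<le> 1" for p using tent_square_sum[OF P g] by simp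
    fix i v assume "i \<in> {..K}"
    then have "ccp_map N (f i)" using f by simp
    then have "op_bounded N (ent (f i a)) (norm a)" using op_norm_le_iff[of "f i a" N "norm a"] by (simp add: ccp_map_def)
    then show "vnorm N (kapply N (conj_basis N e (ent (f i a))) v) \<le> norm a * vnorm N v" using op_bounded_conj_basis[OF e] op_boundedD by blast
  qed auto
  then have "op_bounded N (ent (patched N K P g e (\<lambda>i. f i a))) (norm a)" by (rule op_bounded_cong) (simp add: ent_patched)
  then show "op_norm (patched N K P g e (\<lambda>i. f i a)) \<le> norm a" by (simp add: op_norm_le_iff[OF patched_carrier])
qed (use f in auto)

lemma op_norm_leI:
  assumes "S \<in> carrier_mat N N" "0 \<le> c" "op_bounded N a c" "\<And>p q. p < N \<Longrightarrow> q < N \<Longrightarrow> a p q = ent S p q"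
  shows "op_norm S \<le> c"
  using assms op_norm_le_iff op_bounded_cong by blast

definition local_model ::
  "('a::cstar_algebra \<Rightarrow> complex) \<Rightarrow> 'a set \<Rightarrow> complex set \<Rightarrow> real \<Rightarrow> nat \<Rightarrow> ('a \<Rightarrow> complex mat) \<Rightarrow> bool" where
  "local_model \<tau> A G \<epsilon> N \<theta> \<longleftrightarrow> 1 \<le> N \<and> (\<forall>a. \<theta> a \<in> carrier_mat N N) \<and>
     (\<forall>a\<in>A. \<forall>b\<in>A. op_norm (\<theta> (a * b) - \<theta> a * \<theta> b) \<le> \<epsilon>) \<and>
     (\<forall>c\<in>G. \<forall>d\<in>G. \<forall>a\<in>A. \<forall>b\<in>A. op_norm (\<theta> (c *\<^sub>C a + d *\<^sub>C b) - c \<cdot>\<^sub>m \<theta> a - d \<cdot>\<^sub>m \<theta> b) \<le> \<epsilon>) \<and>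
     (\<forall>a\<in>A. op_norm (\<theta> (star a) - mat_adjoint (\<theta> a)) \<le> \<epsilon>) \<and>
     (\<forall>a\<in>A. op_norm (\<theta> a) \<le> norm a + \<epsilon>) \<and>
     (\<forall>a\<in>A. cmod (\<tau> a - mat_tr (\<theta> a)) \<le> \<epsilon>)"

text \<open>The exceptional subspace is taken for all product, linearity and star errors of the pieces and for
their norms.  It is the bottom layer of the flag, to which only the exact homomorphism at index 0
has access.  At the top layer only the last piece, which is \<open>\<phi> n\<close> itself, is present.\<close>

lemma (in asymp_trace_hom) local_approximation:
  fixes \<alpha> :: "'b::cstar_algebra \<Rightarrow> 'a" and \<beta> :: "'a \<Rightarrow> 'b" and \<Phi> :: "'a \<Rightarrow> real \<Rightarrow> 'a"
  assumes nb: "F \<noteq> bot" and stable: "hilbert_schmidt_stable F TYPE('b)"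
    and \<alpha>: "star_hom cstar_alg cstar_alg \<alpha>" and \<beta>: "star_hom cstar_alg cstar_alg \<beta>"
    and \<Phi>: "star_hom cstar_alg path_alg \<Phi>" "\<And>a. \<Phi> a 0 = \<alpha> (\<beta> a)" "\<And>a. \<Phi> a 1 = a"
    and A0: "finite A0" and G0: "finite G0" and \<epsilon>: "\<epsilon> > 0"
  shows "\<exists>N \<theta>. local_model \<tau> A0 G0 \<epsilon> N \<theta> \<and> ((\<forall>n. ccp_map (Suc n) (\<phi> n)) \<longrightarrow> ccp_map N \<theta>)"
proof -
  note \<alpha>D = star_homD[OF \<alpha>] and \<beta>D = star_homD[OF \<beta>]
  \<comment> \<open>The class of the composite with \<open>\<alpha>\<close> is a homomorphism on the stable algebra, so it lifts.\<close>
  have "asymp_hom F (\<lambda>n b. \<phi> n (\<alpha> b))"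
    by unfold_locales (auto simp: \<alpha>D carr bdd intro: mult lin star)
  then obtain \<psi> where \<psi>: "\<And>n. mat_rep (Suc n) (\<psi> n)" "\<And>b. hs_null F (\<lambda>n p q. ent (\<psi> n b) p q - ent (\<phi> n (\<alpha> b)) p q)"
    using asymp_hom.lift_hom[OF _ stable] by blast
  have \<psi>c: "\<psi> n b \<in> carrier_mat (Suc n) (Suc n)" for n b using \<psi>(1)[of n] by (simp add: mat_rep_def)
  \<comment> \<open>The mesh \<open>\<delta>\<close> makes \<open>a * (T i b - T j b)\<close> smaller than \<open>\<epsilon> / 4\<close> for neighbouring \<open>i\<close>, \<open>j\<close>.
    The point \<open>0\<close> is used twice (\<open>s 0 = s 1 = 0\<close>): index 0 carries the exact homomorphism,
    index 1 the original map composed with the same end of the homotopy.\<close>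
  define R where "R = 1 + (\<Sum>a\<in>A0. norm a)"
  have R: "R > 0" "\<And>a. a \<in> A0 \<Longrightarrow> norm a \<le> R"
    using member_le_sum[of _ A0 norm] A0 by (auto simp: R_def add_pos_nonneg sum_nonneg intro: add_increasing)
  define \<delta> where "\<delta> = \<epsilon> / (4 * R)"
  have \<delta>: "\<delta> > 0" "R * \<delta> = \<epsilon> / 4" using R \<epsilon> by (auto simp: \<delta>_def)
  obtain K0 where K0: "K0 \<ge> 1" "\<And>b i. b \<in> A0 \<Longrightarrow> i < K0 \<Longrightarrow> norm (\<Phi> b (real i / real K0) - \<Phi> b (real (Suc i) / real K0)) \<le> \<delta>"
    using fine_partition[OF \<Phi>(1) A0 \<delta>(1)] by blast
  define K where "K = Suc K0"
  define s where "s = (\<lambda>i::nat. real (i - 1) / real K0)"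
  define T where "T = (\<lambda>i a. \<Phi> a (s i))"
  have s01: "s i \<in> {0..1}" if "i \<le> K" for i using that K0(1) by (auto simp: s_def K_def)
  have Th: "star_hom cstar_alg cstar_alg (T i)" if "i \<le> K" for i
    unfolding T_def by (rule path_eval_star_hom[OF \<Phi>(1) s01[OF that]])
  have T0: "T 0 a = \<alpha> (\<beta> a)" for a by (simp add: T_def s_def \<Phi>(2))
  have TK: "T K a = a" for a using K0(1) by (simp add: T_def s_def K_def \<Phi>(3))
  have step: "norm (T i b - T (Suc i) b) \<le> \<delta>" if "b \<in> A0" "Suc i \<le> K" for i b
  proof (cases i)
    case 0 then show ?thesis using \<delta>(1) by (simp add: T_def s_def)
  next
    case (Suc i')
    then show ?thesis using K0(2)[OF that(1), of i'] that(2) by (simp add: T_def s_def K_def)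
  qed
  have near: "norm (T i b - T j b) \<le> \<delta>" if ij: "b \<in> A0" "i \<le> K" "j \<le> K" "i \<le> Suc j" "j \<le> Suc i" for i j b
  proof -
    consider "i = j" | "i = Suc j" | "j = Suc i" using ij(4,5) by linarith
    then show ?thesis using step[of b i] step[of b j] that \<delta>(1) by cases (auto simp: norm_minus_commute)
  qed
  \<comment> \<open>Every piece agrees with \<open>\<phi> n \<circ> T i\<close> up to a Hilbert-Schmidt null sequence, index 0 included.
    All bounds are uniform in \<open>n\<close>; \<open>C\<close> depends on the mesh, which is why \<open>P\<close> is chosen only later.\<close>
  define \<sigma> where "\<sigma> = (\<lambda>n i a. if i = 0 then \<psi> n (\<beta> a) else \<phi> n (T i a))"
  define Y where "Y = (\<lambda>i a n. ent (\<sigma> n i a))"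
  have \<sigma>c: "\<sigma> n i a \<in> carrier_mat (Suc n) (Suc n)" for n i a by (simp add: \<sigma>_def carr \<psi>c)
  have nY: "hs_null F (\<lambda>n p q. Y i a n p q - X (T i a) n p q)" for i a
    using \<psi>(2)[of "\<beta> a"] by (cases "i = 0") (simp_all add: Y_def \<sigma>_def T0 hs_null_zero)
  have "\<exists>C\<ge>0. \<forall>n. op_bounded (Suc n) (Y i a n) C" for i a
  proof (cases "i = 0")
    case True
    have "op_bounded (Suc n) (ent (\<psi> n (\<beta> a))) (norm (\<beta> a))" for n
      using mat_rep_contractive[OF \<psi>(1)] op_norm_le_iff[OF \<psi>c, of "norm (\<beta> a)"] norm_ge_zero by blast
    then show ?thesis using True by (intro exI[of _ "norm (\<beta> a)"]) (simp add: Y_def \<sigma>_def)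
  next
    case False
    then show ?thesis using bound[of "T i a"] by (simp add: Y_def \<sigma>_def)
  qed
  then obtain Cf where Cf: "\<And>i a. Cf i a \<ge> 0" "\<And>i a n. op_bounded (Suc n) (Y i a n) (Cf i a)" by metis
  define A1 where "A1 = A0 \<union> (\<lambda>(a, b). a * b) ` (A0 \<times> A0)"
  have A1: "finite A1" "A0 \<subseteq> A1" "\<And>a b. a \<in> A0 \<Longrightarrow> b \<in> A0 \<Longrightarrow> a * b \<in> A1" using A0 by (auto simp: A1_def)
  define C where "C = 1 + (\<Sum>(i, a)\<in>{..K} \<times> A1. Cf i a)"
  have C0: "C > 0" using Cf(1) by (auto simp: C_def intro!: add_pos_nonneg sum_nonneg)
  have C: "op_bounded (Suc n) (Y i a n) C" if "i \<le> K" "a \<in> A1" for i a n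
  proof (rule op_bounded_mono[OF Cf(2)])
    have "Cf i a \<le> (\<Sum>(i, a)\<in>{..K} \<times> A1. Cf i a)"
      using member_le_sum[of "(i, a)" "{..K} \<times> A1" "\<lambda>(i, a). Cf i a"] that A1(1) Cf(1) by auto
    then show "Cf i a \<le> C" by (simp add: C_def)
  qed
  \<comment> \<open>The finitely many sequences that must be small (or have controlled norm) off the exceptional
    subspace.  \<open>W i j a b\<close> is a null sequence away from the image of \<open>z i j a b\<close>.\<close>
  define W where "W = (\<lambda>i j a b n p q. Y i (a * b) n p q - kmult (Suc n) (Y i a n) (Y j b n) p q)"
  define z where "z = (\<lambda>i j a b. T i a * (T i b - T j b))"
  define St where "St = (\<lambda>i a n p q. Y i (star a) n p q - adj (Y i a n) p q)"
  define Li where "Li = (\<lambda>i c d a b n p q. Y i (c *\<^sub>C a + d *\<^sub>C b) n p q - c * Y i a n p q - d * Y i b n p q)"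
  have nW: "hs_null F (\<lambda>n p q. W i j a b n p q - X (z i j a b) n p q)" if ij: "i \<le> K" "j \<le> K" for i j a b
  proof -
    obtain D where D: "D \<ge> 0" "\<And>n. op_bounded (Suc n) (X (T i a) n) D" using bound by blast
    have zz: "z i j a b = T i (a * b) - T i a * T j b"
      using star_homD(3)[OF Th[OF ij(1)]] by (simp add: z_def right_diff_distrib)
    have "hs_null F (\<lambda>n p q. (Y i (a * b) n p q - X (T i (a * b)) n p q)
        - kmult (Suc n) (\<lambda>p q. Y i a n p q - X (T i a) n p q) (Y j b n) p q
        - kmult (Suc n) (X (T i a) n) (\<lambda>p q. Y j b n p q - X (T j b) n p q) p q
        + (X (T i a * T j b) n p q - kmult (Suc n) (X (T i a) n) (X (T j b) n) p q)
        - (X (T i (a * b) - T i a * T j b) n p q - (X (T i (a * b)) n p q - X (T i a * T j b) n p q)))"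
      by (intro hs_null_diff hs_null_add nY hs_null_kmult_right[OF nY Cf(2,1)] hs_null_kmult_left[OF nY D(2,1)] hs_null_mult hs_null_diff_lin)
    then show ?thesis by (rule hs_null_cong) (simp add: W_def zz kmult_diff_left kmult_diff_right)
  qed
  have nSt: "hs_null F (St i a)" if i: "i \<le> K" for i a
  proof -
    have "hs_null F (\<lambda>n p q. (Y i (star a) n p q - X (T i (star a)) n p q) + (X (star (T i a)) n p q - adj (X (T i a) n) p q)
        - adj (\<lambda>p q. Y i a n p q - X (T i a) n p q) p q)"
      by (intro hs_null_diff hs_null_add nY hs_null_star hs_null_adj[OF nY])
    then show ?thesis by (rule hs_null_cong) (simp add: St_def adj_def star_homD(4)[OF Th[OF i]])
  qed
  have nLi: "hs_null F (Li i c d a b)" if i: "i \<le> K" for i c d a b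
  proof -
    have "hs_null F (\<lambda>n p q. (Y i (c *\<^sub>C a + d *\<^sub>C b) n p q - X (T i (c *\<^sub>C a + d *\<^sub>C b)) n p q)
        + (X (c *\<^sub>C T i a + d *\<^sub>C T i b) n p q - c * X (T i a) n p q - d * X (T i b) n p q)
        - c * (Y i a n p q - X (T i a) n p q) - d * (Y i b n p q - X (T i b) n p q))"
      by (intro hs_null_diff hs_null_add nY hs_null_lin hs_null_scale)
    then show ?thesis by (rule hs_null_cong) (simp add: Li_def star_homD(1,2)[OF Th[OF i]] algebra_simps)
  qed
  define J where "J = (\<lambda>(i, a). (Y i a, norm a)) ` ({..K} \<times> A0) \<union> (\<lambda>(i, a). (St i a, 0)) ` ({..K} \<times> A0)
     \<union> (\<lambda>(i, c, d, a, b). (Li i c d a b, 0)) ` ({..K} \<times> G0 \<times> G0 \<times> A0 \<times> A0)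
     \<union> (\<lambda>(i, j, a, b). (W i j a b, norm (z i j a b))) ` ({..K} \<times> {..K} \<times> A0 \<times> A0)"
  have J: "finite J" using A0 G0 by (simp add: J_def)
  have JY: "(Y i a, norm a) \<in> J" if "i \<le> K" "a \<in> A0" for i a
    unfolding J_def using that by (intro UnI1 image_eqI[where x = "(i, a)"]) auto
  have JS: "(St i a, 0) \<in> J" if "i \<le> K" "a \<in> A0" for i a
    unfolding J_def by (rule UnI1, rule UnI1, intro UnI2 image_eqI[where x = "(i, a)"]) (use that in auto)
  have JL: "(Li i c d a b, 0) \<in> J" if "i \<le> K" "c \<in> G0" "d \<in> G0" "a \<in> A0" "b \<in> A0" for i c d a b
    unfolding J_def by (rule UnI1, intro UnI2 image_eqI[where x = "(i, c, d, a, b)"]) (use that in auto)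
  have JW: "(W i j a b, norm (z i j a b)) \<in> J" if "i \<le> K" "j \<le> K" "a \<in> A0" "b \<in> A0" for i j a b
    unfolding J_def using that by (intro UnI2 image_eqI[where x = "(i, j, a, b)"]) auto
  have ess: "ess_bounded F Z c" if Zc: "(Z, c) \<in> J" for Z c
  proof -
    have "ess_bounded F (Y i a) (norm a)" if "i \<le> K" for i a
    proof -
      have "ess_bounded F (Y i a) (norm (T i a))" by (rule ess_bounded_perturb[OF ess_bounded_norm nY])
      moreover have "norm (T i a) \<le> norm a" by (rule star_hom_contractive[OF Th[OF that]])
      ultimately show ?thesis unfolding ess_bounded_def by (meson order_le_less_trans)
    qed
    moreover have "ess_bounded F (W i j a b) (norm (z i j a b))" if "i \<le> K" "j \<le> K" for i j a b
      by (rule ess_bounded_perturb[OF ess_bounded_norm nW[OF that]])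
    ultimately show ?thesis using Zc hs_null_ess_bounded[OF nSt] hs_null_ess_bounded[OF nLi] by (auto simp: J_def)
  qed
  \<comment> \<open>Order of choices: \<open>P\<close> makes the tents flat enough for the commutator error, which fixes the
    length \<open>M\<close> of the flag, and \<open>\<eta>\<close> makes the top \<open>M\<close>-th space of the flag tracially negligible.\<close>
  define r where "r = real (K + 1) ^ 2 * (4 * C + 8 * C\<^sup>2)"
  have r0: "r > 0" using C0 by (simp add: r_def add_pos_pos)
  obtain P where P: "P > 0" "r / real P \<le> \<epsilon> / 2"
  proof -
    obtain P where "2 * r / \<epsilon> < real P" using reals_Archimedean2 by blast
    moreover have "2 * r / \<epsilon> > 0" using r0 \<epsilon> by simp
    ultimately have "P > 0" "2 * r / \<epsilon> < real P" by (auto intro: gr0I)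
    then show ?thesis using \<epsilon> by (intro that[of P]) (auto simp: field_simps)
  qed
  define M where "M = K * P - 1"
  have M: "Suc M = K * P" using P by (simp add: M_def K_def)
  obtain ps where ps: "set ps = {..K} \<times> A1" using finite_list[of "{..K} \<times> A1"] A1(1) by blast
  define D where "D = real ((1 + 2 * length ps) ^ M)"
  have D: "D > 0" unfolding D_def by (simp del: of_nat_power)
  define \<eta> where "\<eta> = \<epsilon> / (4 * C * D)"
  have \<eta>: "\<eta> > 0" "2 * C * (D * \<eta>) = \<epsilon> / 2" using \<epsilon> C0 D by (auto simp: \<eta>_def)
  have ev1: "\<forall>\<^sub>F n in F. \<forall>a\<in>A0. dist (mat_tr (\<phi> n a)) (\<tau> a) < \<epsilon> / 2"
    using tendstoD[OF tr half_gt_zero[OF \<epsilon>]] by (intro eventually_ball_finite[OF A0]) blast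
  have \<epsilon>4: "\<epsilon> / 4 > 0" using \<epsilon> by simp
  have ev2: "\<forall>\<^sub>F n in F. \<exists>d e. orthonormal (Suc n) d e \<and> real d \<le> \<eta> * real (Suc n) \<and> (\<forall>Z c v. (Z, c) \<in> J \<longrightarrow>
         (\<forall>i<d. inprod (Suc n) (e i) v = 0) \<longrightarrow> vnorm (Suc n) (kapply (Suc n) (Z n) v) \<le> (c + \<epsilon> / 4) * vnorm (Suc n) v)"
    by (rule ess_bounded_family[OF J _ \<epsilon>4 \<eta>(1)]) (rule ess)
  obtain n where n: "\<forall>a\<in>A0. dist (mat_tr (\<phi> n a)) (\<tau> a) < \<epsilon> / 2"
      and ex: "\<exists>d e. orthonormal (Suc n) d e \<and> real d \<le> \<eta> * real (Suc n) \<and> (\<forall>Z c v. (Z, c) \<in> J \<longrightarrow>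
         (\<forall>i<d. inprod (Suc n) (e i) v = 0) \<longrightarrow> vnorm (Suc n) (kapply (Suc n) (Z n) v) \<le> (c + \<epsilon> / 4) * vnorm (Suc n) v)"
    using eventually_happens'[OF nb eventually_conj[OF ev1 ev2]] by - (erule exE, erule conjE, (rule that; assumption))
  have trn: "\<And>a. a \<in> A0 \<Longrightarrow> dist (mat_tr (\<phi> n a)) (\<tau> a) < \<epsilon> / 2" using n by blast
  from ex obtain d e0 where e0: "orthonormal (Suc n) d e0" "real d \<le> \<eta> * real (Suc n)"
    and good': "\<forall>Z c v. (Z, c) \<in> J \<longrightarrow> (\<forall>i<d. inprod (Suc n) (e0 i) v = 0) \<longrightarrow>
         vnorm (Suc n) (kapply (Suc n) (Z n) v) \<le> (c + \<epsilon> / 4) * vnorm (Suc n) v"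
    by (elim exE conjE) (rule that; assumption)
  have good: "vnorm (Suc n) (kapply (Suc n) (Z n) v) \<le> (c + \<epsilon> / 4) * vnorm (Suc n) v"
    if "(Z, c) \<in> J" "\<And>i. i < d \<Longrightarrow> inprod (Suc n) (e0 i) v = 0" for Z c v
    using good'[rule_format, OF that] .
  define N where "N = Suc n"
  obtain e g where e: "orthonormal N N e" "\<forall>i<d. e i = e0 i" and g0: "\<forall>i. g i = 0 \<longleftrightarrow> i < d" and g': "\<forall>i. g i \<le> Suc M"
    and cardg: "card {i. g i \<le> M} \<le> (1 + 2 * length (map (\<lambda>(i, a). Y i a n) ps)) ^ M * d" "finite {i. g i \<le> M}"
    and band': "\<forall>A\<in>set (map (\<lambda>(i, a). Y i a n) ps). \<forall>i<N. \<forall>j<N. conj_basis N e A i j \<noteq> 0 \<longrightarrow> g i \<le> g j + 1 \<and> g j \<le> g i + 1"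
    using block_tridiagonal[OF e0(1), of M "map (\<lambda>(i, a). Y i a n) ps", folded N_def]
    by (elim exE conjE) (rule that; assumption)
  have g: "g i \<le> Suc M" for i using g' by blast
  have band: "banded N g (conj_basis N e A)" if "A \<in> set (map (\<lambda>(i, a). Y i a n) ps)" for A
    unfolding banded_def by (rule bspec[OF band' that])
  define S where "S = (\<lambda>i a. conj_basis N e (Y i a n))"
  define \<theta> where "\<theta> = (\<lambda>a. patched N K P g e (\<lambda>i. \<sigma> n i a))"
  have \<theta>c: "\<theta> a \<in> carrier_mat N N" for a by (simp add: \<theta>_def)
  have \<theta>e: "ent (\<theta> a) p q = patch {..K} (tent P) g (\<lambda>i. S i a) p q" if "p < N" "q < N" for a p q
    unfolding \<theta>_def S_def Y_def by (rule ent_patched[OF that])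
  have gK: "g p \<le> K * P" for p using g M by simp
  have sq: "(\<Sum>i\<in>{..K}. (tent P i (g p))\<^sup>2) = 1" for p by (rule tent_square_sum[OF P(1) gK])
  have bandS: "banded N g (S i a)" if "i \<le> K" "a \<in> A1" for i a
    unfolding S_def using that ps by (intro band) force
  have obdS: "op_bounded N (S i a) C" if "i \<le> K" "a \<in> A1" for i a
    unfolding S_def using op_bounded_conj_basis[OF e(1)] C[OF that] by (simp add: N_def)
  \<comment> \<open>In the adapted basis the exceptional subspace is spanned by the basis vectors in layer 0.\<close>
  have goodS: "vnorm N (kapply N (conj_basis N e (Z n)) v) \<le> (c + \<epsilon> / 4) * vnorm N v"
    if Zc: "(Z, c) \<in> J" and v: "\<And>p. p < N \<Longrightarrow> g p = 0 \<Longrightarrow> v p = 0" for Z c v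
  proof -
    have dN: "d \<le> N" using orthonormal_le[OF e0(1)] by (simp add: N_def)
    have "vnorm N (kapply N (Z n) (synth N e v)) \<le> (c + \<epsilon> / 4) * vnorm N (synth N e v)" unfolding N_def
    proof (rule good[OF Zc])
      fix i assume i: "i < d"
      then have "inprod N (e0 i) (synth N e v) = v i" using inprod_synth[OF e(1), of i v] e(2) dN by simp
      then show "inprod (Suc n) (e0 i) (synth (Suc n) e v) = 0" using v[of i] i g0 dN by (simp add: N_def)
    qed
    then show ?thesis by (simp add: vnorm_kapply_conj_basis[OF e(1)] vnorm_synth[OF e(1)])
  qed
  have zero: "vnorm N (kapply N (conj_basis N e Z) v) = 0" if "\<And>p q. p < N \<Longrightarrow> q < N \<Longrightarrow> Z p q = 0" for Z v
  proof -
    have "conj_basis N e Z = conj_basis N e (\<lambda>p q. 0)" by (rule conj_basis_cong[OF that])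
    then show ?thesis by (simp add: conj_basis_def kapply_def inprod_def)
  qed
  have rep: "\<psi> n (x + y) = \<psi> n x + \<psi> n y" "\<psi> n (c *\<^sub>C x) = c \<cdot>\<^sub>m \<psi> n x" "\<psi> n (x * y) = \<psi> n x * \<psi> n y" "\<psi> n (star x) = mat_adjoint (\<psi> n x)" for x y c
    using \<psi>(1)[of n] by (auto simp: mat_rep_def)
  \<comment> \<open>Only the tent with index 0 meets layer 0, and the exact homomorphism has no error there.\<close>
  have small: "op_bounded N (patch {..K} (tent P) g (\<lambda>i. conj_basis N e (Z i n))) \<epsilon>"
    if Z: "\<And>i. i \<le> K \<Longrightarrow> (Z i, 0) \<in> J" "\<And>p q. p < N \<Longrightarrow> q < N \<Longrightarrow> Z 0 n p q = 0" for Z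
  proof (rule patch_bound)
    fix i and v :: "nat \<Rightarrow> complex"
    assume i: "i \<in> {..K}" and v: "\<And>p. p < N \<Longrightarrow> tent P i (g p) = 0 \<Longrightarrow> v p = 0"
    show "vnorm N (kapply N (conj_basis N e (Z i n)) v) \<le> \<epsilon> * vnorm N v"
    proof (cases "i = 0")
      case True
      then show ?thesis using zero[OF Z(2)] \<epsilon> by simp
    next
      case False
      have "vnorm N (kapply N (conj_basis N e (Z i n)) v) \<le> (0 + \<epsilon> / 4) * vnorm N v"
        using Z(1) i v tent_start False by (intro goodS) auto
      also have "\<dots> \<le> \<epsilon> * vnorm N v" using \<epsilon> by (intro mult_right_mono) auto
      finally show ?thesis .
    qed
  qed (use sq \<epsilon> in auto)
  have mult_est: "op_norm (\<theta> (a * b) - \<theta> a * \<theta> b) \<le> \<epsilon>" if ab: "a \<in> A0" "b \<in> A0" for a b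
  proof (rule op_norm_leI)
    have \<theta>m: "\<theta> a * \<theta> b \<in> carrier_mat N N" by (rule mult_carrier_mat[OF \<theta>c \<theta>c])
    then show "\<theta> (a * b) - \<theta> a * \<theta> b \<in> carrier_mat N N" by (rule minus_carrier_mat)
    have "op_bounded N (\<lambda>p q. patch {..K} (tent P) g (\<lambda>i. S i (a * b)) p q - kmult N (patch {..K} (tent P) g (\<lambda>i. S i a)) (patch {..K} (tent P) g (\<lambda>i. S i b)) p q)
           (\<epsilon> / 2 + real (card {..K}) ^ 2 * (2 * (2 / real P) * C + 4 * (2 / real P) * C\<^sup>2))"
    proof (rule patch_mult)
      show "\<bar>tent P i (Suc m) - tent P i m\<bar> \<le> 2 / real P" for i m by (rule tent_Lipschitz[OF P(1)])
      fix i j and v :: "nat \<Rightarrow> complex"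
      assume ij: "i \<in> {..K}" "j \<in> {..K}" and v: "\<And>p. p < N \<Longrightarrow> tent P i (g p) * tent P j (g p) = 0 \<Longrightarrow> v p = 0"
      have WS: "(\<lambda>p q. S i (a * b) p q - kmult N (S i a) (S j b) p q) = conj_basis N e (W i j a b n)"
        unfolding S_def W_def N_def[symmetric] by (simp add: conj_basis_diff conj_basis_kmult[OF e(1)])
      show "vnorm N (kapply N (\<lambda>p q. S i (a * b) p q - kmult N (S i a) (S j b) p q) v) \<le> \<epsilon> / 2 * vnorm N v"
      proof (cases "i + 2 \<le> j \<or> j + 2 \<le> i")
        case True
        then have "tent P i m * tent P j m = 0" for m using tent_disjoint[of i j P m] tent_disjoint[of j i P m] by (auto simp: mult.commute)
        then have "v p = 0" if "p < N" for p using v that by blast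
        then have "kapply N A v = kapply N A (\<lambda>p. 0)" for A by (intro kapply_cong) auto
        then show ?thesis using \<epsilon> by (simp add: kapply_def)
      next
        case adj: False
        show ?thesis
        proof (cases "i = 0 \<and> j = 0")
          case True
          \<comment> \<open>Here \<open>v\<close> may be supported in layer 0, but the product error is exactly zero.\<close>
          have "W 0 0 a b n p q = 0" if "p < N" "q < N" for p q
            using that by (simp add: W_def Y_def \<sigma>_def \<beta>D rep ent_mult[OF \<psi>c \<psi>c] N_def)
          then show ?thesis unfolding WS using True zero \<epsilon> by simp
        next
          case False
          \<comment> \<open>One of the two tents vanishes in layer 0, so \<open>v\<close> avoids the exceptional subspace.\<close>
          have "norm (z i j a b) \<le> norm (T i a) * norm (T i b - T j b)" unfolding z_def by (rule norm_mult_ineq)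
          also have "\<dots> \<le> R * \<delta>"
          proof (intro mult_mono)
            show "norm (T i a) \<le> R" using star_hom_contractive[OF Th, of i a] ij R(2)[OF ab(1)] by simp
            show "norm (T i b - T j b) \<le> \<delta>" using near[OF ab(2), of i j] ij adj by simp
          qed (use R in auto)
          finally have zn: "norm (z i j a b) \<le> \<epsilon> / 4" using \<delta> by simp
          have "(W i j a b, norm (z i j a b)) \<in> J" using JW ij ab by simp
          then have "vnorm N (kapply N (conj_basis N e (W i j a b n)) v) \<le> (norm (z i j a b) + \<epsilon> / 4) * vnorm N v"
            using v tent_start False by (intro goodS) auto
          also have "\<dots> \<le> \<epsilon> / 2 * vnorm N v" using zn by (intro mult_right_mono) auto
          finally show ?thesis unfolding WS .
        qed
      qed
    qed (use ab A1 C0 \<epsilon> sq g tent_abs_le obdS bandS in auto)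
    moreover have "\<epsilon> / 2 + real (card {..K}) ^ 2 * (2 * (2 / real P) * C + 4 * (2 / real P) * C\<^sup>2) \<le> \<epsilon>"
    proof -
      have eq: "real (card {..K}) ^ 2 * (2 * (2 / real P) * C + 4 * (2 / real P) * C\<^sup>2) = r / real P"
        by (simp add: r_def algebra_simps add_divide_distrib)
      show ?thesis unfolding eq using P(2) by linarith
    qed
    ultimately show "op_bounded N (\<lambda>p q. patch {..K} (tent P) g (\<lambda>i. S i (a * b)) p q - kmult N (patch {..K} (tent P) g (\<lambda>i. S i a)) (patch {..K} (tent P) g (\<lambda>i. S i b)) p q) \<epsilon>"
      by (rule op_bounded_mono)
    fix p q assume pq: "p < N" "q < N"
    have "ent (\<theta> a * \<theta> b) p q = kmult N (ent (\<theta> a)) (ent (\<theta> b)) p q" by (rule ent_mult[OF \<theta>c \<theta>c pq])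
    also have "\<dots> = kmult N (patch {..K} (tent P) g (\<lambda>i. S i a)) (patch {..K} (tent P) g (\<lambda>i. S i b)) p q"
      by (rule kmult_cong[OF \<theta>e \<theta>e pq])
    finally show "patch {..K} (tent P) g (\<lambda>i. S i (a * b)) p q - kmult N (patch {..K} (tent P) g (\<lambda>i. S i a)) (patch {..K} (tent P) g (\<lambda>i. S i b)) p q
        = ent (\<theta> (a * b) - \<theta> a * \<theta> b) p q" by (simp add: ent_diff[OF \<theta>m pq] \<theta>e[OF pq])
  qed (use \<epsilon> in simp)
  have lin_est: "op_norm (\<theta> (c *\<^sub>C a + d' *\<^sub>C b) - c \<cdot>\<^sub>m \<theta> a - d' \<cdot>\<^sub>m \<theta> b) \<le> \<epsilon>"
    if cd: "c \<in> G0" "d' \<in> G0" and ab: "a \<in> A0" "b \<in> A0" for c d' a b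
  proof (rule op_norm_leI)
    have m: "x \<cdot>\<^sub>m \<theta> a \<in> carrier_mat N N" for x a using \<theta>c by simp
    show "\<theta> (c *\<^sub>C a + d' *\<^sub>C b) - c \<cdot>\<^sub>m \<theta> a - d' \<cdot>\<^sub>m \<theta> b \<in> carrier_mat N N" by (rule minus_carrier_mat[OF m])
    show "op_bounded N (patch {..K} (tent P) g (\<lambda>i. conj_basis N e (Li i c d' a b n))) \<epsilon>"
    proof (rule small)
      show "(Li i c d' a b, 0) \<in> J" if "i \<le> K" for i using JL that cd ab by blast
      show "Li 0 c d' a b n p q = 0" if "p < N" "q < N" for p q
      proof -
        have m': "x \<cdot>\<^sub>m \<psi> n y \<in> carrier_mat (Suc n) (Suc n)" for x y using \<psi>c by simp
        show ?thesis using that by (simp add: Li_def Y_def \<sigma>_def \<beta>D rep ent_add[OF m'] ent_smult[OF \<psi>c] N_def)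
      qed
    qed
    show "patch {..K} (tent P) g (\<lambda>i. conj_basis N e (Li i c d' a b n)) p q = ent (\<theta> (c *\<^sub>C a + d' *\<^sub>C b) - c \<cdot>\<^sub>m \<theta> a - d' \<cdot>\<^sub>m \<theta> b) p q"
      if pq: "p < N" "q < N" for p q
      by (simp add: ent_diff[OF m pq] ent_smult[OF \<theta>c pq] \<theta>e[OF pq] Li_def conj_basis_diff conj_basis_scale patch_diff patch_scale S_def)
  qed (use \<epsilon> in simp)
  have star_est: "op_norm (\<theta> (star a) - mat_adjoint (\<theta> a)) \<le> \<epsilon>" if a: "a \<in> A0" for a
  proof (rule op_norm_leI)
    have m: "mat_adjoint (\<theta> a) \<in> carrier_mat N N" by (rule mat_adjoint_carrier[OF \<theta>c])
    show "\<theta> (star a) - mat_adjoint (\<theta> a) \<in> carrier_mat N N" by (rule minus_carrier_mat[OF m])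
    show "op_bounded N (patch {..K} (tent P) g (\<lambda>i. conj_basis N e (St i a n))) \<epsilon>"
    proof (rule small)
      show "(St i a, 0) \<in> J" if "i \<le> K" for i using JS that a by simp
      show "St 0 a n p q = 0" if "p < N" "q < N" for p q
        using that by (simp add: St_def Y_def \<sigma>_def \<beta>D rep ent_adjoint[OF \<psi>c] N_def)
    qed
    show "patch {..K} (tent P) g (\<lambda>i. conj_basis N e (St i a n)) p q = ent (\<theta> (star a) - mat_adjoint (\<theta> a)) p q" if pq: "p < N" "q < N" for p q
    proof -
      have "ent (mat_adjoint (\<theta> a)) p q = adj (patch {..K} (tent P) g (\<lambda>i. S i a)) p q"
        using ent_adjoint[OF \<theta>c pq] \<theta>e[OF pq(2,1)] by (simp add: adj_def)
      then show ?thesis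
        by (simp add: ent_diff[OF m pq] \<theta>e[OF pq] St_def conj_basis_diff conj_basis_adj patch_diff patch_adj S_def)
    qed
  qed (use \<epsilon> in simp)
  have norm_est: "op_norm (\<theta> a) \<le> norm a + \<epsilon>" if a: "a \<in> A0" for a
  proof (rule op_norm_leI[OF \<theta>c])
    show "op_bounded N (patch {..K} (tent P) g (\<lambda>i. S i a)) (norm a + \<epsilon>)"
    proof (rule patch_bound)
      fix i and v :: "nat \<Rightarrow> complex"
      assume i: "i \<in> {..K}" and v: "\<And>p. p < N \<Longrightarrow> tent P i (g p) = 0 \<Longrightarrow> v p = 0"
      show "vnorm N (kapply N (S i a) v) \<le> (norm a + \<epsilon>) * vnorm N v"
      proof (cases "i = 0")
        case True
        have "op_norm (\<psi> n (\<beta> a)) \<le> norm a + \<epsilon>"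
          using mat_rep_contractive[OF \<psi>(1)] star_hom_contractive[OF \<beta>, of a] \<epsilon> by (meson add_increasing2 less_imp_le order_trans)
        then have "op_bounded N (Y 0 a n) (norm a + \<epsilon>)" using op_norm_le_iff[OF \<psi>c, of "norm a + \<epsilon>"] \<epsilon> by (simp add: Y_def \<sigma>_def N_def)
        then show ?thesis using True op_boundedD[OF op_bounded_conj_basis[OF e(1)]] by (simp add: S_def)
      next
        case False
        have "(Y i a, norm a) \<in> J" using JY i a by simp
        then have "vnorm N (kapply N (S i a) v) \<le> (norm a + \<epsilon> / 4) * vnorm N v"
          unfolding S_def using v tent_start False by (intro goodS) auto
        also have "\<dots> \<le> (norm a + \<epsilon>) * vnorm N v" using \<epsilon> by (intro mult_right_mono) auto
        finally show ?thesis .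
      qed
    qed (use sq \<epsilon> in auto)
  qed (use \<epsilon> \<theta>e in auto)
  have trace_est: "cmod (\<tau> a - mat_tr (\<theta> a)) \<le> \<epsilon>" if a: "a \<in> A0" for a
  proof -
    have aA1: "a \<in> A1" using a A1 by auto
    let ?D = "(1 + 2 * length ps) ^ M * d"
    have "cmod ((\<Sum>p<N. patch {..K} (tent P) g (\<lambda>i. S i a) p p) - (\<Sum>p<N. S K a p p)) \<le> 2 * C * real ?D"
    proof (rule patch_trace[where M = M])
      show "tent P i (g p) = (if i = K then 1 else 0)" if "\<not> g p \<le> M" "i \<in> {..K}" for i p
      proof -
        have "g p = K * P" using g[of p] that(1) M by simp
        then show ?thesis using tent_end[OF P(1), of i K] that(2) by simp
      qed
    qed (use sq obdS aA1 C0 cardg in auto)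
    moreover have "(\<Sum>p<N. S K a p p) = (\<Sum>p<N. ent (\<phi> n a) p p)"
      unfolding S_def conj_basis_trace[OF e(1)] by (simp add: Y_def \<sigma>_def TK) (simp add: K_def)
    moreover have "(\<Sum>p<N. patch {..K} (tent P) g (\<lambda>i. S i a) p p) = (\<Sum>p<N. ent (\<theta> a) p p)" using \<theta>e by simp
    ultimately have "cmod ((\<Sum>p<N. ent (\<theta> a) p p) - (\<Sum>p<N. ent (\<phi> n a) p p)) \<le> 2 * C * real ?D" by simp
    also have "\<dots> = 2 * C * (D * real d)" by (simp add: D_def)
    also have "\<dots> \<le> 2 * C * (D * (\<eta> * real N))" using e0(2) C0 D by (intro mult_left_mono) (auto simp: N_def)
    also have "\<dots> = 2 * C * (D * \<eta>) * real N" by (simp only: mult.assoc)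
    also have "\<dots> = \<epsilon> / 2 * real N" unfolding \<eta>(2) ..
    finally have "cmod ((\<Sum>p<N. ent (\<theta> a) p p) - (\<Sum>p<N. ent (\<phi> n a) p p)) / real N \<le> \<epsilon> / 2"
      by (simp add: divide_le_eq N_def del: of_nat_Suc)
    moreover have "mat_tr (\<theta> a) - mat_tr (\<phi> n a) = ((\<Sum>p<N. ent (\<theta> a) p p) - (\<Sum>p<N. ent (\<phi> n a) p p)) / of_nat N"
      unfolding mat_tr_eq[OF \<theta>c] mat_tr_eq[OF carr] N_def by (rule diff_divide_distrib[symmetric])
    ultimately have "cmod (mat_tr (\<theta> a) - mat_tr (\<phi> n a)) \<le> \<epsilon> / 2" by (simp add: norm_divide)
    then have "dist (mat_tr (\<theta> a)) (\<tau> a) \<le> \<epsilon>" using trn[OF a] dist_triangle[of "mat_tr (\<theta> a)" "\<tau> a" "mat_tr (\<phi> n a)"]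
      by (simp add: dist_norm)
    then show ?thesis by (simp add: dist_norm norm_minus_commute)
  qed
  have ccp: "ccp_map N \<theta>" if "\<forall>n. ccp_map (Suc n) (\<phi> n)"
    unfolding \<theta>_def
  proof (rule patched_ccp[OF _ e(1) P(1) gK])
    fix i assume i: "i \<le> K"
    have "ccp_map N (\<psi> n \<circ> \<beta>)" using ccp_comp_star_hom[OF mat_rep_ccp[OF \<psi>(1)] \<beta>] by (simp add: N_def)
    moreover have "ccp_map N (\<phi> n \<circ> T i)" using ccp_comp_star_hom[OF _ Th[OF i]] that by (simp add: N_def)
    ultimately show "ccp_map N (\<sigma> n i)" by (cases "i = 0") (simp_all add: \<sigma>_def comp_def)
  qed (simp add: N_def)
  show ?thesis
    unfolding local_model_def
    by (intro exI[of _ N] exI[of _ \<theta>] conjI ballI allI impI mult_est lin_est star_est norm_est trace_est ccp \<theta>c)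
       (auto simp: N_def)
qed

section \<open>From finite sets to the whole algebra\<close>

text \<open>\<open>u n a\<close> is a point closest to \<open>a\<close> among the first \<open>n + 1\<close> terms of a dense sequence.\<close>

lemma nearest_points:
  fixes C :: "'a::real_normed_vector set"
  assumes C: "countable C" and dense: "\<And>x e. e > 0 \<Longrightarrow> \<exists>y\<in>C. norm (y - x) < e"
  shows "\<exists>D u. (\<forall>n. finite (D n)) \<and> (\<forall>n a. u n a \<in> D n) \<and> (\<forall>a. \<exists>B. \<forall>n. norm (u n a) \<le> B) \<and>
    (\<forall>a. (\<lambda>n. u n a) \<longlonglongrightarrow> (a::'a))"
proof -
  have ne: "C \<noteq> {}" using dense[of 1 0] by auto
  define d where "d = from_nat_into C"
  have d: "\<exists>i. norm (d i - x) < e" if e: "e > 0" for x e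
  proof -
    obtain y where y: "y \<in> C" "norm (y - x) < e" using dense[OF e] by blast
    then obtain i where "y = d i" using range_from_nat_into[OF ne C] by (auto simp: d_def)
    then show ?thesis using y by auto
  qed
  have "\<forall>n a. \<exists>u. u \<in> d ` {..n} \<and> (\<forall>i\<le>n. norm (u - a) \<le> norm (d i - a))"
  proof (intro allI)
    fix n a
    let ?M = "Min ((\<lambda>u. norm (u - a)) ` d ` {..n})"
    have "?M \<in> (\<lambda>u. norm (u - a)) ` d ` {..n}" by (rule Min_in) auto
    then obtain u where u: "?M = norm (u - a)" "u \<in> d ` {..n}" by (rule imageE)
    have "norm (u - a) \<le> norm (d i - a)" if "i \<le> n" for i unfolding u(1)[symmetric] using that by (intro Min_le) auto
    then show "\<exists>u. u \<in> d ` {..n} \<and> (\<forall>i\<le>n. norm (u - a) \<le> norm (d i - a))" using u(2) by blast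
  qed
  then obtain u where u: "\<And>n a. u n a \<in> d ` {..n}" "\<And>n a i. i \<le> n \<Longrightarrow> norm (u n a - a) \<le> norm (d i - a)" by metis
  have "(\<lambda>n. u n a) \<longlonglongrightarrow> a" for a
  proof (rule LIMSEQ_I)
    fix e :: real assume "e > 0"
    then obtain i where i: "norm (d i - a) < e" using d by blast
    show "\<exists>m. \<forall>n\<ge>m. norm (u n a - a) < e" using u(2)[of i] i by (intro exI[of _ i]) (meson order_le_less_trans)
  qed
  moreover have "norm (u n a) \<le> norm a + norm (d 0 - a)" for n a
    using norm_triangle_ineq[of a "u n a - a"] u(2)[of 0 n a] by simp
  ultimately show ?thesis using u(1)
    by (intro exI[of _ "\<lambda>n. d ` {..n}"] exI[of _ u]) blast
qed

lemma local_modelD: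
  assumes m: "local_model \<tau> A G \<epsilon> N \<theta>" and \<epsilon>: "\<epsilon> \<ge> 0"
  shows "1 \<le> N" "\<theta> a \<in> carrier_mat N N"
    "a \<in> A \<Longrightarrow> b \<in> A \<Longrightarrow> op_bounded N (\<lambda>p q. ent (\<theta> (a * b)) p q - kmult N (ent (\<theta> a)) (ent (\<theta> b)) p q) \<epsilon>"
    "c \<in> G \<Longrightarrow> d \<in> G \<Longrightarrow> a \<in> A \<Longrightarrow> b \<in> A \<Longrightarrow>
       op_bounded N (\<lambda>p q. ent (\<theta> (c *\<^sub>C a + d *\<^sub>C b)) p q - c * ent (\<theta> a) p q - d * ent (\<theta> b) p q) \<epsilon>"
    "a \<in> A \<Longrightarrow> op_bounded N (\<lambda>p q. ent (\<theta> (star a)) p q - adj (ent (\<theta> a)) p q) \<epsilon>"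
    "a \<in> A \<Longrightarrow> op_bounded N (ent (\<theta> a)) (norm a + \<epsilon>)"
    "a \<in> A \<Longrightarrow> cmod (\<tau> a - mat_tr (\<theta> a)) \<le> \<epsilon>"
proof -
  have c: "\<theta> a \<in> carrier_mat N N" for a using m by (simp add: local_model_def)
  show "1 \<le> N" "\<theta> a \<in> carrier_mat N N" "a \<in> A \<Longrightarrow> cmod (\<tau> a - mat_tr (\<theta> a)) \<le> \<epsilon>" using m by (simp_all add: local_model_def)
  show "a \<in> A \<Longrightarrow> op_bounded N (ent (\<theta> a)) (norm a + \<epsilon>)"
    using m \<epsilon> by (subst op_norm_le_iff[OF c, symmetric]) (auto simp: local_model_def)
  have cm: "\<theta> a * \<theta> b \<in> carrier_mat N N" by (rule mult_carrier_mat[OF c c])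
  show "op_bounded N (\<lambda>p q. ent (\<theta> (a * b)) p q - kmult N (ent (\<theta> a)) (ent (\<theta> b)) p q) \<epsilon>" if "a \<in> A" "b \<in> A"
  proof (rule op_bounded_cong)
    show "op_bounded N (ent (\<theta> (a * b) - \<theta> a * \<theta> b)) \<epsilon>" using m that
      by (subst op_norm_le_iff[OF minus_carrier_mat[OF cm] \<epsilon>, symmetric]) (simp add: local_model_def)
  qed (simp add: ent_diff[OF cm] ent_mult[OF c c])
  have ca: "\<And>x y. x \<cdot>\<^sub>m \<theta> y \<in> carrier_mat N N" using c by simp
  show "op_bounded N (\<lambda>p q. ent (\<theta> (c *\<^sub>C a + d *\<^sub>C b)) p q - c * ent (\<theta> a) p q - d * ent (\<theta> b) p q) \<epsilon>"
    if "c \<in> G" "d \<in> G" "a \<in> A" "b \<in> A"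
  proof (rule op_bounded_cong)
    show "op_bounded N (ent (\<theta> (c *\<^sub>C a + d *\<^sub>C b) - c \<cdot>\<^sub>m \<theta> a - d \<cdot>\<^sub>m \<theta> b)) \<epsilon>" using m that
      by (subst op_norm_le_iff[OF minus_carrier_mat[OF ca] \<epsilon>, symmetric]) (simp add: local_model_def)
  qed (simp add: ent_diff[OF ca] ent_smult[OF c])
  have cs: "mat_adjoint (\<theta> a) \<in> carrier_mat N N" by (rule mat_adjoint_carrier[OF c])
  show "op_bounded N (\<lambda>p q. ent (\<theta> (star a)) p q - adj (ent (\<theta> a)) p q) \<epsilon>" if "a \<in> A"
  proof (rule op_bounded_cong)
    show "op_bounded N (ent (\<theta> (star a) - mat_adjoint (\<theta> a))) \<epsilon>" using m that
      by (subst op_norm_le_iff[OF minus_carrier_mat[OF cs] \<epsilon>, symmetric]) (simp add: local_model_def)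
  qed (simp add: ent_diff[OF cs] ent_adjoint[OF c])
qed

lemma op_norm_tendsto_0:
  assumes c: "\<And>n. S n \<in> carrier_mat (N n) (N n)" and b: "\<And>n. op_bounded (N n) (a n) (f n)" and f0: "\<And>n. 0 \<le> f n"
    and eq: "\<And>n p q. p < N n \<Longrightarrow> q < N n \<Longrightarrow> a n p q = ent (S n) p q" and f: "f \<longlonglongrightarrow> 0"
  shows "(\<lambda>n. op_norm (S n)) \<longlonglongrightarrow> 0"
proof (rule tendsto_sandwich[OF _ _ tendsto_const f])
  show "\<forall>\<^sub>F n in sequentially. 0 \<le> op_norm (S n)" using op_norm_nonneg[OF c] by simp
  show "\<forall>\<^sub>F n in sequentially. op_norm (S n) \<le> f n" using op_norm_leI[OF c f0 b eq] by simp
qed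

lemma trace_diff: "cstar_trace \<tau> \<Longrightarrow> cmod (\<tau> a - \<tau> b) \<le> norm (a - b)"
proof -
  assume t: "cstar_trace \<tau>"
  have "\<tau> a = \<tau> (a - b) + \<tau> b" using t unfolding cstar_trace_def by (metis diff_add_cancel)
  then have "\<tau> a - \<tau> b = \<tau> (a - b)" by simp
  then show ?thesis using t by (simp add: cstar_trace_def)
qed

text \<open>The finite sets \<open>A n\<close> contain, besides the approximants \<open>u n a\<close>, the results of the operations on
them and the differences of these results, since the norm bound of a local model is needed for them.\<close>

lemma exhaust_by_local_models:
  fixes \<tau> :: "'a::cstar_algebra \<Rightarrow> complex"
  assumes sep: "separable_cstar TYPE('a)"
    and loc: "\<And>A G \<epsilon>. finite A \<Longrightarrow> finite G \<Longrightarrow> \<epsilon> > 0 \<Longrightarrow> \<exists>N \<theta>. local_model \<tau> A G \<epsilon> N \<theta> \<and> Q N \<theta>"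
  obtains u :: "nat \<Rightarrow> 'a \<Rightarrow> 'a" and v :: "nat \<Rightarrow> complex \<Rightarrow> complex" and A G N \<theta>
  where "\<And>n. local_model \<tau> (A n) (G n) (1 / real (Suc n)) (N n) (\<theta> n)" "\<And>n. Q (N n) (\<theta> n)"
    "\<And>n a. u n a \<in> A n" "\<And>n a b. u n a * u n b \<in> A n" "\<And>n a. star (u n a) \<in> A n"
    "\<And>n a b x y. v n x *\<^sub>C u n a + v n y *\<^sub>C u n b \<in> A n"
    "\<And>n a b c. u n a - u n b * u n c \<in> A n" "\<And>n a b. u n a - star (u n b) \<in> A n"
    "\<And>n a b c x y. u n c - (v n x *\<^sub>C u n a + v n y *\<^sub>C u n b) \<in> A n"
    "\<And>n. 1 \<in> G n" "\<And>n. - 1 \<in> G n" "\<And>n x. v n x \<in> G n"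
    "\<And>a. (\<lambda>n. u n a) \<longlonglongrightarrow> a" "\<And>x. (\<lambda>n. v n x) \<longlonglongrightarrow> x" "\<And>a. \<exists>B. \<forall>n. norm (u n a) \<le> B"
proof -
  obtain C :: "'a set" where C: "countable C" "closure C = UNIV"
    using sep by (auto simp: separable_cstar_def separable_space_def)
  have dC: "\<exists>y\<in>C. norm (y - x) < e" if "e > 0" for x e
    using C(2) that closure_approachable[of x C] by (auto simp: dist_norm)
  obtain D u where u: "\<And>n. finite (D n)" "\<And>n a. u n a \<in> D n" "\<And>a. \<exists>B. \<forall>n. norm (u n a) \<le> B" "\<And>a::'a. (\<lambda>n. u n a) \<longlonglongrightarrow> a"
    using nearest_points[OF C(1) dC] by metis
  obtain CC :: "complex set" where CC: "countable CC" "\<And>X. open X \<Longrightarrow> X \<noteq> {} \<Longrightarrow> \<exists>d\<in>CC. d \<in> X"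
    using countable_dense_exists by metis
  have dCC: "\<exists>y\<in>CC. norm (y - x) < e" if "e > 0" for x e
    using CC(2)[of "ball x e"] that by (auto simp: dist_norm norm_minus_commute)
  obtain H v where v: "\<And>n. finite (H n)" "\<And>n a. v n a \<in> H n" "\<And>a::complex. (\<lambda>n. v n a) \<longlonglongrightarrow> a"
    using nearest_points[OF CC(1) dCC] by metis
  define B where "B = (\<lambda>n. D n \<union> (\<lambda>(a, b). a * b) ` (D n \<times> D n) \<union> star ` D n \<union> (\<lambda>(x, y, a, b). x *\<^sub>C a + y *\<^sub>C b) ` (H n \<times> H n \<times> D n \<times> D n))"
  define A where "A = (\<lambda>n. B n \<union> (\<lambda>(a, b). a - b) ` (B n \<times> B n))"
  define G where "G = (\<lambda>n. insert 1 (insert (- 1) (H n)))"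
  have finA: "finite (A n)" for n using u(1)[of n] v(1)[of n] by (simp add: A_def B_def)
  have finG: "finite (G n)" for n using v(1)[of n] by (simp add: G_def)
  have B1: "u n a \<in> B n" for n a using u(2) by (simp add: B_def)
  have B2: "u n a * u n b \<in> B n" for n a b unfolding B_def by (rule UnI1, rule UnI1, rule UnI2, rule image_eqI[of _ _ "(u n a, u n b)"]) (use u(2) in auto)
  have B3: "star (u n a) \<in> B n" for n a unfolding B_def by (rule UnI1, rule UnI2, rule imageI) (rule u(2))
  have B4: "v n x *\<^sub>C u n a + v n y *\<^sub>C u n b \<in> B n" for n a b x y unfolding B_def
    by (rule UnI2, rule image_eqI[of _ _ "(v n x, v n y, u n a, u n b)"]) (use u(2) v(2) in auto)
  have BA: "B n \<subseteq> A n" for n by (simp add: A_def)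
  have BB: "a - b \<in> A n" if "a \<in> B n" "b \<in> B n" for a b n unfolding A_def
    by (rule UnI2, rule image_eqI[of _ _ "(a, b)"]) (use that in auto)
  have "\<forall>n. \<exists>N \<theta>. local_model \<tau> (A n) (G n) (1 / real (Suc n)) N \<theta> \<and> Q N \<theta>" using loc[OF finA finG] by simp
  from choice[OF this] obtain N where "\<forall>n. \<exists>\<theta>. local_model \<tau> (A n) (G n) (1 / real (Suc n)) (N n) \<theta> \<and> Q (N n) \<theta>" by blast
  from choice[OF this] obtain \<theta> where \<theta>: "\<And>n. local_model \<tau> (A n) (G n) (1 / real (Suc n)) (N n) (\<theta> n)" "\<And>n. Q (N n) (\<theta> n)" by blast
  show ?thesis
    by (rule that[of A G N \<theta> u v, OF \<theta>])
      (use subsetD[OF BA B1] subsetD[OF BA B2] subsetD[OF BA B3] subsetD[OF BA B4] B1 B2 B3 B4 BB u(3,4) v(2,3) in \<open>simp_all add: G_def\<close>)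
qed

text \<open>The maps are \<open>a \<mapsto> \<theta> n (u n a)\<close>.  A local model is controlled on a finite set only, so each relation is
first moved to the approximants, at the cost of the norm of a small difference lying in \<open>A n\<close>.\<close>

lemma MF_from_local_models:
  fixes \<tau> :: "'a::cstar_algebra \<Rightarrow> complex"
  assumes tau: "cstar_trace \<tau>" and sep: "separable_cstar TYPE('a)"
    and loc: "\<And>A G \<epsilon>. finite A \<Longrightarrow> finite G \<Longrightarrow> \<epsilon> > 0 \<Longrightarrow> \<exists>N \<theta>. local_model \<tau> A G \<epsilon> N \<theta>"
  shows "MF_trace \<tau>"
proof (rule exhaust_by_local_models[OF sep, where Q = "\<lambda>_ _. True" and \<tau> = \<tau>])
  show "\<exists>N \<theta>. local_model \<tau> A G \<epsilon> N \<theta> \<and> True" if "finite A" "finite G" "\<epsilon> > 0" for A G \<epsilon>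
    using loc[OF that] by simp
next
  fix u :: "nat \<Rightarrow> 'a \<Rightarrow> 'a" and v :: "nat \<Rightarrow> complex \<Rightarrow> complex" and A G N \<theta>
  assume m: "\<And>n. local_model \<tau> (A n) (G n) (1 / real (Suc n)) (N n) (\<theta> n)"
    and A: "\<And>n a. u n a \<in> A n" "\<And>n a b. u n a * u n b \<in> A n" "\<And>n a. star (u n a) \<in> A n"
    "\<And>n a b x y. v n x *\<^sub>C u n a + v n y *\<^sub>C u n b \<in> A n"
    "\<And>n a b c. u n a - u n b * u n c \<in> A n" "\<And>n a b. u n a - star (u n b) \<in> A n"
    "\<And>n a b c x y. u n c - (v n x *\<^sub>C u n a + v n y *\<^sub>C u n b) \<in> A n"
    and G: "\<And>n. 1 \<in> G n" "\<And>n. - 1 \<in> G n" "\<And>n x. v n x \<in> G n"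
    and lim: "\<And>a. (\<lambda>n. u n a) \<longlonglongrightarrow> a" "\<And>x. (\<lambda>n. v n x) \<longlonglongrightarrow> x" and bdd: "\<And>a. \<exists>B. \<forall>n. norm (u n a) \<le> B"
  define \<epsilon> where "\<epsilon> = (\<lambda>n. 1 / real (Suc n))"
  have \<epsilon>0: "0 \<le> \<epsilon> n" for n by (simp add: \<epsilon>_def)
  have \<epsilon>l: "\<epsilon> \<longlonglongrightarrow> 0" unfolding \<epsilon>_def using LIMSEQ_inverse_real_of_nat by (simp add: inverse_eq_divide)
  have m': "local_model \<tau> (A n) (G n) (\<epsilon> n) (N n) (\<theta> n)" for n unfolding \<epsilon>_def by (rule m)
  note M = local_modelD[OF m' \<epsilon>0]
  let ?e = "\<lambda>n a. ent (\<theta> n a)"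
  have close: "op_bounded (N n) (\<lambda>p q. ?e n x p q - ?e n y p q) (norm (x - y) + 2 * \<epsilon> n)"
    if "x \<in> A n" "y \<in> A n" "x - y \<in> A n" for n x y
  proof -
    have "op_bounded (N n) (\<lambda>p q. ?e n (1 *\<^sub>C x + (- 1) *\<^sub>C y) p q - 1 * ?e n x p q - (- 1) * ?e n y p q) (\<epsilon> n)" by (rule M(4)[OF G(1,2) that(1,2)])
    then have "op_bounded (N n) (\<lambda>p q. ?e n (x - y) p q - ?e n x p q + ?e n y p q) (\<epsilon> n)" by (simp add: scaleC_one scaleC_minus_one)
    from op_bounded_diff[OF M(6)[OF that(3)] this] show ?thesis by (simp add: algebra_simps)
  qed
  define \<phi> where "\<phi> = (\<lambda>n a. \<theta> n (u n a))"
  have c: "\<theta> n a \<in> carrier_mat (N n) (N n)" for n a by (rule M(2))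
  have bddu: "Bseq (\<lambda>n. norm (u n a))" for a using tendsto_norm[OF lim(1)] convergent_imp_Bseq convergentI by blast
  have "asymp_mult op_norm \<phi>" unfolding asymp_mult_def
  proof (intro allI)
    fix a b
    have cm: "\<theta> n x * \<theta> n y \<in> carrier_mat (N n) (N n)" for n x y by (rule mult_carrier_mat[OF c c])
    show "(\<lambda>n. op_norm (\<phi> n (a * b) - \<phi> n a * \<phi> n b)) \<longlonglongrightarrow> 0"
    proof (rule op_norm_tendsto_0)
      show "\<phi> n (a * b) - \<phi> n a * \<phi> n b \<in> carrier_mat (N n) (N n)" for n unfolding \<phi>_def by (rule minus_carrier_mat[OF cm])
      show "op_bounded (N n) (\<lambda>p q. (?e n (u n (a * b)) p q - ?e n (u n a * u n b) p q) +
         (?e n (u n a * u n b) p q - kmult (N n) (?e n (u n a)) (?e n (u n b)) p q)) ((norm (u n (a * b) - u n a * u n b) + 2 * \<epsilon> n) + \<epsilon> n)" for n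
        by (intro op_bounded_add close M(3) A)
      show "(?e n (u n (a * b)) p q - ?e n (u n a * u n b) p q) + (?e n (u n a * u n b) p q - kmult (N n) (?e n (u n a)) (?e n (u n b)) p q)
         = ent (\<phi> n (a * b) - \<phi> n a * \<phi> n b) p q" if "p < N n" "q < N n" for n p q
        using that by (simp add: \<phi>_def ent_diff[OF cm] ent_mult[OF c c])
      have "(\<lambda>n. (norm (u n (a * b) - u n a * u n b) + 2 * \<epsilon> n) + \<epsilon> n) \<longlonglongrightarrow> (norm (a * b - a * b) + 2 * 0) + 0"
        by (intro tendsto_intros lim \<epsilon>l)
      then show "(\<lambda>n. (norm (u n (a * b) - u n a * u n b) + 2 * \<epsilon> n) + \<epsilon> n) \<longlonglongrightarrow> 0" by simp
    qed (use \<epsilon>0 in simp)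
  qed
  moreover have "asymp_star op_norm \<phi>" unfolding asymp_star_def
  proof (intro allI)
    fix a
    have cs: "mat_adjoint (\<theta> n x) \<in> carrier_mat (N n) (N n)" for n x by (rule mat_adjoint_carrier[OF c])
    show "(\<lambda>n. op_norm (\<phi> n (star a) - mat_adjoint (\<phi> n a))) \<longlonglongrightarrow> 0"
    proof (rule op_norm_tendsto_0)
      show "\<phi> n (star a) - mat_adjoint (\<phi> n a) \<in> carrier_mat (N n) (N n)" for n unfolding \<phi>_def by (rule minus_carrier_mat[OF cs])
      show "op_bounded (N n) (\<lambda>p q. (?e n (u n (star a)) p q - ?e n (star (u n a)) p q) +
         (?e n (star (u n a)) p q - adj (?e n (u n a)) p q)) ((norm (u n (star a) - star (u n a)) + 2 * \<epsilon> n) + \<epsilon> n)" for n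
        by (intro op_bounded_add close M(5) A)
      show "(?e n (u n (star a)) p q - ?e n (star (u n a)) p q) + (?e n (star (u n a)) p q - adj (?e n (u n a)) p q)
         = ent (\<phi> n (star a) - mat_adjoint (\<phi> n a)) p q" if "p < N n" "q < N n" for n p q
        using that by (simp add: \<phi>_def ent_diff[OF cs] ent_adjoint[OF c])
      have "(\<lambda>n. star (u n a)) \<longlonglongrightarrow> star a"
        using continuous_on_star[of "UNIV :: 'a set"]
        by (intro isCont_tendsto_compose[OF _ lim(1)]) (simp add: continuous_on_eq_continuous_at)
      then have "(\<lambda>n. (norm (u n (star a) - star (u n a)) + 2 * \<epsilon> n) + \<epsilon> n) \<longlonglongrightarrow> (norm (star a - star a) + 2 * 0) + 0"
        by (intro tendsto_intros lim \<epsilon>l)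
      then show "(\<lambda>n. (norm (u n (star a) - star (u n a)) + 2 * \<epsilon> n) + \<epsilon> n) \<longlonglongrightarrow> 0" by simp
    qed (use \<epsilon>0 in simp)
  qed
  moreover have "asymp_linear op_norm \<phi>" unfolding asymp_linear_def
  proof (intro allI)
    fix x y :: complex and a b
    have cs: "z \<cdot>\<^sub>m \<theta> n w \<in> carrier_mat (N n) (N n)" for n z w using c by simp
    let ?w = "\<lambda>n. v n x *\<^sub>C u n a + v n y *\<^sub>C u n b"
    let ?f = "\<lambda>n. (norm (u n (x *\<^sub>C a + y *\<^sub>C b) - ?w n) + 2 * \<epsilon> n) + \<epsilon> n + cmod (v n x - x) * (norm (u n a) + \<epsilon> n) + cmod (v n y - y) * (norm (u n b) + \<epsilon> n)"
    let ?g = "\<lambda>n p q. (?e n (u n (x *\<^sub>C a + y *\<^sub>C b)) p q - ?e n (?w n) p q) +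
         (?e n (?w n) p q - v n x * ?e n (u n a) p q - v n y * ?e n (u n b) p q) + (v n x - x) * ?e n (u n a) p q + (v n y - y) * ?e n (u n b) p q"
    show "(\<lambda>n. op_norm (\<phi> n (x *\<^sub>C a + y *\<^sub>C b) - x \<cdot>\<^sub>m \<phi> n a - y \<cdot>\<^sub>m \<phi> n b)) \<longlonglongrightarrow> 0"
    proof (rule op_norm_tendsto_0[where a = ?g and f = ?f])
      show "\<phi> n (x *\<^sub>C a + y *\<^sub>C b) - x \<cdot>\<^sub>m \<phi> n a - y \<cdot>\<^sub>m \<phi> n b \<in> carrier_mat (N n) (N n)" for n unfolding \<phi>_def by (rule minus_carrier_mat[OF cs])
      show "op_bounded (N n) (?g n) (?f n)" for n
        by (intro op_bounded_add op_bounded_scale close M(4) M(6) A G)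
      show "?g n p q = ent (\<phi> n (x *\<^sub>C a + y *\<^sub>C b) - x \<cdot>\<^sub>m \<phi> n a - y \<cdot>\<^sub>m \<phi> n b) p q" if "p < N n" "q < N n" for n p q
        using that by (simp add: \<phi>_def ent_diff[OF cs] ent_smult[OF c] algebra_simps)
      have sc: "(\<lambda>n. v n z *\<^sub>C u n a') \<longlonglongrightarrow> z *\<^sub>C a'" for z a'
      proof (rule LIM_zero_cancel, rule tendsto_norm_zero_cancel, rule tendsto_sandwich[OF _ _ tendsto_const])
        have "(\<lambda>n. cmod (v n z) * norm (u n a' - a') + cmod (v n z - z) * norm a') \<longlonglongrightarrow> cmod z * norm (a' - a') + cmod (z - z) * norm a'"
          by (intro tendsto_intros lim)
        then show "(\<lambda>n. cmod (v n z) * norm (u n a' - a') + cmod (v n z - z) * norm a') \<longlonglongrightarrow> 0" by simp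
        have "norm (v n z *\<^sub>C u n a' - z *\<^sub>C a') \<le> cmod (v n z) * norm (u n a' - a') + cmod (v n z - z) * norm a'" for n
        proof -
          have "v n z *\<^sub>C a' = (v n z - z) *\<^sub>C a' + z *\<^sub>C a'" by (simp flip: scaleC_add_left)
          then have "v n z *\<^sub>C u n a' - z *\<^sub>C a' = v n z *\<^sub>C (u n a' - a') + (v n z - z) *\<^sub>C a'" by (simp add: scaleC_diff_right)
          then show ?thesis using norm_triangle_ineq[of "v n z *\<^sub>C (u n a' - a')" "(v n z - z) *\<^sub>C a'"] by (simp add: norm_scaleC)
        qed
        then show "\<forall>\<^sub>F n in sequentially. norm (v n z *\<^sub>C u n a' - z *\<^sub>C a') \<le> cmod (v n z) * norm (u n a' - a') + cmod (v n z - z) * norm a'" by simp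
      qed simp
      have "?f \<longlonglongrightarrow> (norm (x *\<^sub>C a + y *\<^sub>C b - (x *\<^sub>C a + y *\<^sub>C b)) + 2 * 0) + 0 + cmod (x - x) * (norm a + 0) + cmod (y - y) * (norm b + 0)"
        by (intro tendsto_intros lim \<epsilon>l sc)
      then show "?f \<longlonglongrightarrow> 0" by simp
    qed (use \<epsilon>0 in simp)
  qed
  moreover have "bdd_above (range (\<lambda>n. op_norm (\<phi> n a)))" for a
  proof -
    obtain B where B: "\<And>n. norm (u n a) \<le> B" using bdd by blast
    have "op_norm (\<phi> n a) \<le> B + 1" for n
    proof -
      have "\<epsilon> n \<le> 1" by (simp add: \<epsilon>_def)
      then have "norm (u n a) + \<epsilon> n \<le> B + 1" using B[of n] by linarith
      moreover have "0 \<le> B + 1" using B[of 0] norm_ge_zero[of "u 0 a"] by linarith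
      ultimately show ?thesis unfolding \<phi>_def op_norm_le_iff[OF c \<open>0 \<le> B + 1\<close>] using op_bounded_mono[OF M(6)[OF A(1)]] by blast
    qed
    then show ?thesis by (intro bdd_aboveI2)
  qed
  moreover have "approximates_trace \<phi> \<tau>" unfolding approximates_trace_def
  proof (rule allI, rule tendsto_sandwich[OF _ _ tendsto_const])
    fix a
    have "(\<lambda>n. norm (a - u n a) + \<epsilon> n) \<longlonglongrightarrow> norm (a - a) + 0" by (intro tendsto_intros lim \<epsilon>l)
    then show "(\<lambda>n. norm (a - u n a) + \<epsilon> n) \<longlonglongrightarrow> 0" by simp
    have "cmod (\<tau> a - mat_tr (\<phi> n a)) \<le> norm (a - u n a) + \<epsilon> n" for n
      using trace_diff[OF tau, of a "u n a"] M(7)[OF A(1), of n a] norm_triangle_ineq[of "\<tau> a - \<tau> (u n a)" "\<tau> (u n a) - mat_tr (\<phi> n a)"]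
      by (simp add: \<phi>_def)
    then show "\<forall>\<^sub>F n in sequentially. cmod (\<tau> a - mat_tr (\<phi> n a)) \<le> norm (a - u n a) + \<epsilon> n" by simp
  qed simp
  moreover have "matrix_maps N \<phi>" using M(1,2) by (simp add: matrix_maps_def \<phi>_def)
  ultimately show ?thesis using tau
    unfolding MF_trace_def trace_approx_by_maps_def
    by - (intro conjI exI[of _ N] exI[of _ \<phi>] allI; assumption)
qed

text \<open>Here the local models are linear contractions, hence can be used on all of the algebra without
replacing \<open>a\<close> by an approximant.\<close>

lemma quasidiagonal_from_local_models:
  fixes \<tau> :: "'a::cstar_algebra \<Rightarrow> complex"
  assumes tau: "cstar_trace \<tau>" and sep: "separable_cstar TYPE('a)"
    and loc: "\<And>A G \<epsilon>. finite A \<Longrightarrow> finite G \<Longrightarrow> \<epsilon> > 0 \<Longrightarrow> \<exists>N \<theta>. local_model \<tau> A G \<epsilon> N \<theta> \<and> ccp_map N \<theta>"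
  shows "quasidiagonal_trace \<tau>"
proof (rule exhaust_by_local_models[OF sep, where Q = ccp_map and \<tau> = \<tau>])
  show "\<exists>N \<theta>. local_model \<tau> A G \<epsilon> N \<theta> \<and> ccp_map N \<theta>" if "finite A" "finite G" "\<epsilon> > 0" for A G \<epsilon>
    by (rule loc[OF that])
next
  fix u :: "nat \<Rightarrow> 'a \<Rightarrow> 'a" and v :: "nat \<Rightarrow> complex \<Rightarrow> complex" and A G N \<theta>
  assume m: "\<And>n. local_model \<tau> (A n) (G n) (1 / real (Suc n)) (N n) (\<theta> n)" and ccp: "\<And>n. ccp_map (N n) (\<theta> n)"
    and A: "\<And>n a. u n a \<in> A n"
    and lim: "\<And>a. (\<lambda>n. u n a) \<longlonglongrightarrow> a"
  define \<epsilon> where "\<epsilon> = (\<lambda>n. 1 / real (Suc n))"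
  have \<epsilon>0: "0 \<le> \<epsilon> n" for n by (simp add: \<epsilon>_def)
  have \<epsilon>l: "\<epsilon> \<longlonglongrightarrow> 0" unfolding \<epsilon>_def using LIMSEQ_inverse_real_of_nat by (simp add: inverse_eq_divide)
  have m': "local_model \<tau> (A n) (G n) (\<epsilon> n) (N n) (\<theta> n)" for n unfolding \<epsilon>_def by (rule m)
  note M = local_modelD[OF m' \<epsilon>0]
  let ?e = "\<lambda>n a. ent (\<theta> n a)"
  have c: "\<theta> n a \<in> carrier_mat (N n) (N n)" for n a by (rule M(2))
  have bnd: "op_bounded (N n) (?e n a) (norm a)" for n a
    using ccp[of n] op_norm_le_iff[OF c, of "norm a" n a] by (simp add: ccp_map_def)
  have diff: "?e n (a - b) p q = ?e n a p q - ?e n b p q" if "p < N n" "q < N n" for n a b p q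
  proof -
    have "\<theta> n (a - b + b) = \<theta> n (a - b) + \<theta> n b" using ccp[of n] unfolding ccp_map_def by blast
    then have "?e n a p q = ?e n (a - b) p q + ?e n b p q" using ent_add[OF c that] by simp
    then show ?thesis by simp
  qed
  have dbnd: "op_bounded (N n) (\<lambda>p q. ?e n a p q - ?e n b p q) (norm (a - b))" for n a b
    by (rule op_bounded_cong[OF bnd]) (rule diff)
  have "asymp_mult op_norm \<theta>" unfolding asymp_mult_def
  proof (intro allI)
    fix a b
    have cm: "\<theta> n x * \<theta> n y \<in> carrier_mat (N n) (N n)" for n x y by (rule mult_carrier_mat[OF c c])
    let ?f = "\<lambda>n. norm (a * b - u n a * u n b) + \<epsilon> n + norm (u n a) * norm (u n b - b) + norm (u n a - a) * norm b"
    let ?g = "\<lambda>n p q. (?e n (a * b) p q - ?e n (u n a * u n b) p q) + (?e n (u n a * u n b) p q - kmult (N n) (?e n (u n a)) (?e n (u n b)) p q)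
        + kmult (N n) (?e n (u n a)) (\<lambda>p q. ?e n (u n b) p q - ?e n b p q) p q + kmult (N n) (\<lambda>p q. ?e n (u n a) p q - ?e n a p q) (?e n b) p q"
    show "(\<lambda>n. op_norm (\<theta> n (a * b) - \<theta> n a * \<theta> n b)) \<longlonglongrightarrow> 0"
    proof (rule op_norm_tendsto_0[where a = ?g and f = ?f])
      show "\<theta> n (a * b) - \<theta> n a * \<theta> n b \<in> carrier_mat (N n) (N n)" for n by (rule minus_carrier_mat[OF cm])
      show "op_bounded (N n) (?g n) (?f n)" for n by (intro op_bounded_add op_bounded_kmult dbnd bnd M(3) A norm_ge_zero)
      show "?g n p q = ent (\<theta> n (a * b) - \<theta> n a * \<theta> n b) p q" if "p < N n" "q < N n" for n p q
        using that by (simp add: ent_diff[OF cm] ent_mult[OF c c] kmult_diff_left kmult_diff_right)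
      have "?f \<longlonglongrightarrow> norm (a * b - a * b) + 0 + norm a * norm (b - b) + norm (a - a) * norm b"
        by (intro tendsto_intros lim \<epsilon>l)
      then show "?f \<longlonglongrightarrow> 0" by simp
    qed (use \<epsilon>0 in simp)
  qed
  moreover have "approximates_trace \<theta> \<tau>" unfolding approximates_trace_def
  proof (rule allI, rule tendsto_sandwich[OF _ _ tendsto_const])
    fix a
    have "(\<lambda>n. norm (a - u n a) + \<epsilon> n + norm (u n a - a)) \<longlonglongrightarrow> norm (a - a) + 0 + norm (a - a)" by (intro tendsto_intros lim \<epsilon>l)
    then show "(\<lambda>n. norm (a - u n a) + \<epsilon> n + norm (u n a - a)) \<longlonglongrightarrow> 0" by simp
    have "cmod (\<tau> a - mat_tr (\<theta> n a)) \<le> norm (a - u n a) + \<epsilon> n + norm (u n a - a)" for n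
    proof -
      have N: "0 < N n" using M(1)[of n] by simp
      have "cmod (mat_tr (\<theta> n (u n a - a))) \<le> op_norm (\<theta> n (u n a - a))"
        using mat_tr_le_hs[OF c] hs_le_op[OF c N] order_trans by blast
      also have "\<dots> \<le> norm (u n a - a)" using ccp by (simp add: ccp_map_def)
      also have "mat_tr (\<theta> n (u n a - a)) = mat_tr (\<theta> n (u n a)) - mat_tr (\<theta> n a)"
        unfolding mat_tr_eq[OF c] diff_divide_distrib[symmetric] sum_subtractf[symmetric]
        by (intro arg_cong2[where f = "(/)"] sum.cong refl) (simp add: diff)
      finally have "cmod (mat_tr (\<theta> n (u n a)) - mat_tr (\<theta> n a)) \<le> norm (u n a - a)" .
      then show ?thesis
        using trace_diff[OF tau, of a "u n a"] M(7)[OF A, of n a] norm_triangle_ineq[of "\<tau> a - \<tau> (u n a)" "\<tau> (u n a) - mat_tr (\<theta> n (u n a))"]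
          norm_triangle_ineq[of "\<tau> a - mat_tr (\<theta> n (u n a))" "mat_tr (\<theta> n (u n a)) - mat_tr (\<theta> n a)"] by simp
    qed
    then show "\<forall>\<^sub>F n in sequentially. cmod (\<tau> a - mat_tr (\<theta> n a)) \<le> norm (a - u n a) + \<epsilon> n + norm (u n a - a)" by simp
  qed simp
  moreover have "matrix_maps N \<theta>" using M(1,2) by (simp add: matrix_maps_def)
  ultimately show ?thesis using tau ccp
    unfolding quasidiagonal_trace_def trace_approx_by_ccp_maps_def
    by - (intro conjI exI[of _ N] exI[of _ \<theta>] allI; assumption)
qed

lemma ccp_maps_asymp:
  fixes \<phi> :: "nat \<Rightarrow> 'a::cstar_algebra \<Rightarrow> complex mat"
  assumes ccp: "\<And>n. ccp_map (k n) (\<phi> n)"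
  shows "asymp_linear hs_norm \<phi>" "asymp_star hs_norm \<phi>" "bdd_above (range (\<lambda>n. op_norm (\<phi> n a)))"
proof -
  have c: "\<phi> n a \<in> carrier_mat (k n) (k n)" for n a using ccp by (simp add: ccp_map_def)
  have z: "hs_norm (S - S) = 0" if "S \<in> carrier_mat N N" for S N
  proof -
    have "frob N (ent (S - S)) = frob N (\<lambda>p q. 0)" by (rule frob_cong) (simp add: ent_diff[OF that])
    then show ?thesis by (simp add: hs_norm_eq[OF minus_carrier_mat[OF that]] frob_def L2_set_def)
  qed
  have "hs_norm (\<phi> n (x *\<^sub>C a + y *\<^sub>C b) - x \<cdot>\<^sub>m \<phi> n a - y \<cdot>\<^sub>m \<phi> n b) = 0" for n x y a b
  proof -
    have cs: "z \<cdot>\<^sub>m \<phi> n w \<in> carrier_mat (k n) (k n)" for z w using c by simp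
    have "\<phi> n (x *\<^sub>C a + y *\<^sub>C b) = x \<cdot>\<^sub>m \<phi> n a + y \<cdot>\<^sub>m \<phi> n b" using ccp[of n] by (simp add: ccp_map_def)
    moreover have "x \<cdot>\<^sub>m \<phi> n a + y \<cdot>\<^sub>m \<phi> n b - x \<cdot>\<^sub>m \<phi> n a = y \<cdot>\<^sub>m \<phi> n b"
      using c[of n a] c[of n b] by (intro eq_matI) auto
    ultimately show ?thesis using z[OF cs[of y b]] by simp
  qed
  then show "asymp_linear hs_norm \<phi>" by (simp add: asymp_linear_def)
  show "asymp_star hs_norm \<phi>" unfolding asymp_star_def ccp_star[OF ccp] z[OF mat_adjoint_carrier[OF c]] by simp
  show "bdd_above (range (\<lambda>n. op_norm (\<phi> n a)))" using ccp by (intro bdd_aboveI2[where M = "norm a"]) (simp add: ccp_map_def)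
qed

theorem corollary35:
  fixes \<omega> :: "nat filter"
  assumes "nontrivial_ultrafilter \<omega>"
    and "separable_cstar TYPE('a::cstar_algebra)"
    and "separable_cstar TYPE('b::cstar_algebra)"
    and "hilbert_schmidt_stable \<omega> TYPE('b)"
    and "homotopy_dominated TYPE('a) TYPE('b)"
  shows "(\<forall>\<tau> :: 'a \<Rightarrow> complex. hyperlinear_trace \<tau> \<longrightarrow> MF_trace \<tau>) \<and>
         (\<forall>\<tau> :: 'a \<Rightarrow> complex. amenable_trace \<tau> \<longrightarrow> quasidiagonal_trace \<tau>)"
proof -
  obtain \<alpha> :: "'b \<Rightarrow> 'a" and \<beta> :: "'a \<Rightarrow> 'b" and \<Phi> :: "'a \<Rightarrow> real \<Rightarrow> 'a"
    where dom: "star_hom cstar_alg cstar_alg \<alpha>" "star_hom cstar_alg cstar_alg \<beta>" "star_hom cstar_alg path_alg \<Phi>"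
      "\<And>a. \<Phi> a 0 = \<alpha> (\<beta> a)" "\<And>a. \<Phi> a 1 = a"
    using assms(5) unfolding homotopy_dominated_def homotopic_homs_def by auto
  have nb: "\<omega> \<noteq> bot" using assms(1) by (simp add: nontrivial_ultrafilter_def)
  have local: "\<exists>N \<theta>. local_model \<tau> A G \<epsilon> N \<theta> \<and> ((\<forall>n. ccp_map (k n) (\<phi> n)) \<longrightarrow> ccp_map N \<theta>)"
    if \<phi>: "matrix_maps k \<phi>" "asymp_mult hs_norm \<phi>" "asymp_linear hs_norm \<phi>" "asymp_star hs_norm \<phi>"
      "\<And>a. bdd_above (range (\<lambda>n. op_norm (\<phi> n a)))" "approximates_trace \<phi> \<tau>" "cstar_trace \<tau>"
      and fin: "finite A" "finite G" "\<epsilon> > 0"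
    for \<tau> :: "'a \<Rightarrow> complex" and k \<phi> A G \<epsilon>
  proof -
    obtain \<phi>' where \<phi>': "asymp_trace_hom sequentially \<phi>' \<tau>" "(\<forall>n. ccp_map (k n) (\<phi> n)) \<longrightarrow> (\<forall>n. ccp_map (Suc n) (\<phi>' n))"
      using resize[OF \<phi>] by blast
    have "asymp_trace_hom \<omega> \<phi>' \<tau>" by (rule asymp_trace_hom_mono[OF \<phi>'(1) nontrivial_ultrafilter_le[OF assms(1)]])
    from asymp_trace_hom.local_approximation[OF this nb assms(4) dom fin] show ?thesis using \<phi>'(2) by blast
  qed
  show ?thesis
  proof (intro conjI allI impI)
    fix \<tau> :: "'a \<Rightarrow> complex" assume "hyperlinear_trace \<tau>"
    then obtain k \<phi> where \<tau>: "cstar_trace \<tau>" "matrix_maps k \<phi>" "asymp_mult hs_norm \<phi>" "asymp_linear hs_norm \<phi>" "asymp_star hs_norm \<phi>"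
      "\<And>a. bdd_above (range (\<lambda>n. op_norm (\<phi> n a)))" "approximates_trace \<phi> \<tau>"
      unfolding hyperlinear_trace_def trace_approx_by_maps_def by blast
    show "MF_trace \<tau>"
    proof (rule MF_from_local_models[OF \<tau>(1) assms(2)])
      show "\<exists>N \<theta>. local_model \<tau> A G \<epsilon> N \<theta>" if "finite A" "finite G" "\<epsilon> > 0" for A G \<epsilon>
        using local[OF \<tau>(2-7,1) that] by (elim ex_forward conjunct1)
    qed
  next
    fix \<tau> :: "'a \<Rightarrow> complex" assume "amenable_trace \<tau>"
    then obtain k \<phi> where \<tau>: "cstar_trace \<tau>" "matrix_maps k \<phi>" "\<And>n. ccp_map (k n) (\<phi> n)" "asymp_mult hs_norm \<phi>" "approximates_trace \<phi> \<tau>"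
      unfolding amenable_trace_def trace_approx_by_ccp_maps_def by blast
    note as = ccp_maps_asymp[OF \<tau>(3)]
    show "quasidiagonal_trace \<tau>"
    proof (rule quasidiagonal_from_local_models[OF \<tau>(1) assms(2)])
      show "\<exists>N \<theta>. local_model \<tau> A G \<epsilon> N \<theta> \<and> ccp_map N \<theta>" if "finite A" "finite G" "\<epsilon> > 0" for A G \<epsilon>
        using local[OF \<tau>(2,4) as(1,2) as(3) \<tau>(5,1) that] \<tau>(3) by simp
    qed
  qed
qed

end
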